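(* Let $N\ge1$, $s\in(0,1)$, let $\Omega\subset\mathbb{R}^N$ be an open set, let $c\in L^\infty(\Omega)$, and let $u\in H^s_0(\Omega)\cap C(\mathbb{R}^N)$ satisfy, in the weak sense, $$(-\Delta)^su\ge c(x)u\ \text{ in }\Omega,\qquad u=0\ \text{ in }\mathbb{R}^N\setminus\Omega.$$ Suppose that $u^-\in L^\infty(\Omega)$. Let $x_0\in\partial\Omega$. Suppose that $\Omega$ satisfies an interior ball condition at $x_0$, i.e. there is a ball $B_R(y_0)\subset\Omega$ with $x_0\in\partial B_R(y_0)$, and suppose that there exists a ball $B_\delta(x_0)$, $\delta>0$, such that $u\ge0$ in $B_\delta(x_0)\cap\Omega$. For $r>0$ small enough, let $z_r\in\Omega$ be such that $B_r(z_r)\subset\Omega$ and $x_0\in\partial B_r(z_r)$. Then the following two conditions are equivalent: (i) $$\limsup_{r\to0^+}\left(\frac{1}{r^{2s}}\inf_{B_{r/2}(z_r)}|u|\right)>0.$$ (ii) For every $\beta\in\left(0,\frac{\pi}{2}\right)$, $$\liminf_{\substack{x\to x_0\\ x\in C_\beta(x_0)}}\frac{u(x)}{|x-x_0|^s}>0.$$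
   Context: $u^-(x):=\max\{-u(x),0\}$. $H^s(\mathbb{R}^N)$ is the space of $u\in L^2(\mathbb{R}^N)$ with finite Gagliardo seminorm $[u]_{H^s(\mathbb{R}^N)}=\left(\int_{\mathbb{R}^N}\int_{\mathbb{R}^N}\frac{|u(x)-u(y)|^2}{|x-y|^{N+2s}}\,dx\,dy\right)^{1/2}$. $H^s_0(\Omega)$ is the closure of $C^\infty_c(\Omega)$ with respect to the Gagliardo seminorm (functions extended by $0$ outside $\Omega$). The weak sense of "$(-\Delta)^su\ge c(x)u$ in $\Omega$, $u=0$ in $\mathbb{R}^N\setminus\Omega$" is: $u\in H^s(\mathbb{R}^N)$, $u\in H^s_0(\Omega)$, and $$\int_{\mathbb{R}^N}\int_{\mathbb{R}^N}\frac{(u(x)-u(y))(\varphi(x)-\varphi(y))}{|x-y|^{N+2s}}\,dx\,dy\ge\int_\Omega c(x)u(x)\varphi(x)\,dx$$ for every $\varphi\in H^s_0(\Omega)$ with $\varphi\ge0$ in $\Omega$ (no normalizing constant in front of the double integral). Since $u$ is continuous, $u=0$ in $\mathbb{R}^N\setminus\Omega$ holds pointwise. With $B_R(y_0)$ the interior ball at $x_0$, for $\beta\in\left(0,\frac{\pi}{2}\right)$, $$C_\beta(x_0):=\left\{x\in\Omega\,\Big|\,\arccos\left(\frac{x-x_0}{|x-x_0|}\cdot\frac{y_0-x_0}{|y_0-x_0|}\right)<\beta\right\}.$$ $B_\rho(z)$ denotes the open ball of radius $\rho$ centered at $z$. *)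

theory Defs
  imports "HOL-Analysis.Analysis"
begin

text \<open>
  The space \<open>R^N\<close> is an arbitrary type \<open>'a :: euclidean_space\<close> with \<open>N = DIM('a)\<close>. Elements of
  function spaces are total functions \<open>'a \<Rightarrow> real\<close>, understood as representatives of classes modulo
  equality almost everywhere.
\<close>

primrec Ck :: "nat \<Rightarrow> ('a::euclidean_space \<Rightarrow> real) \<Rightarrow> bool" where
  "Ck 0 f \<longleftrightarrow> continuous_on UNIV f"
| "Ck (Suc k) f \<longleftrightarrow>
     (\<forall>x. f differentiable (at x)) \<and> (\<forall>b\<in>Basis. Ck k (\<lambda>x. frechet_derivative f (at x) b))"

definition Cc_infinity :: "'a::euclidean_space set \<Rightarrow> ('a \<Rightarrow> real) set" where
  "Cc_infinity \<Omega> = {f. (\<forall>k. Ck k f) \<and>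
     compact (closure {x. f x \<noteq> 0}) \<and> closure {x. f x \<noteq> 0} \<subseteq> \<Omega>}"

definition L_infinity :: "'a::euclidean_space set \<Rightarrow> ('a \<Rightarrow> real) set" where
  "L_infinity \<Omega> = {f \<in> borel_measurable (lebesgue_on \<Omega>). \<exists>C. AE x in lebesgue_on \<Omega>. \<bar>f x\<bar> \<le> C}"

definition neg_part :: "('a \<Rightarrow> real) \<Rightarrow> 'a \<Rightarrow> real" where
  "neg_part u = (\<lambda>x. max (- u x) 0)"

definition gagliardo_energy :: "real \<Rightarrow> ('a::euclidean_space \<Rightarrow> real) \<Rightarrow> ennreal" where
  "gagliardo_energy s u =
     (\<integral>\<^sup>+x. \<integral>\<^sup>+y. ennreal (\<bar>u x - u y\<bar>\<^sup>2 / norm (x - y) powr (real DIM('a) + 2 * s)) \<partial>lebesgue \<partial>lebesgue)"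

definition Hs :: "real \<Rightarrow> ('a::euclidean_space \<Rightarrow> real) set" where
  "Hs s = {u \<in> borel_measurable lebesgue.
     integrable lebesgue (\<lambda>x. (u x)\<^sup>2) \<and> gagliardo_energy s u < \<infinity>}"

text \<open>Only meaningful when the energy is finite, since \<open>enn2real \<infinity> = 0\<close>.\<close>

definition gagliardo_seminorm :: "real \<Rightarrow> ('a::euclidean_space \<Rightarrow> real) \<Rightarrow> real" where
  "gagliardo_seminorm s u = sqrt (enn2real (gagliardo_energy s u))"

text \<open>
  The closure is taken inside \<open>Hs s\<close>, so for \<open>0 < s < 1\<close> the difference \<open>u - f\<close> has finite energy.
  The almost everywhere condition expresses that functions on \<open>\<Omega>\<close> are extended by zero; it does
  not follow from the closure condition for every unbounded \<open>\<Omega>\<close>, because the seminorm does not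
  see constants.
\<close>

definition Hs0 :: "real \<Rightarrow> 'a::euclidean_space set \<Rightarrow> ('a \<Rightarrow> real) set" where
  "Hs0 s \<Omega> = {u \<in> Hs s. (AE x in lebesgue. x \<notin> \<Omega> \<longrightarrow> u x = 0) \<and>
     (\<forall>\<epsilon>>0. \<exists>f\<in>Cc_infinity \<Omega>. gagliardo_seminorm s (\<lambda>x. u x - f x) < \<epsilon>)}"

definition gagliardo_form ::
    "real \<Rightarrow> ('a::euclidean_space \<Rightarrow> real) \<Rightarrow> ('a \<Rightarrow> real) \<Rightarrow> real" where
  "gagliardo_form s u \<phi> =
     (LINT x|lebesgue. LINT y|lebesgue.
        (u x - u y) * (\<phi> x - \<phi> y) / norm (x - y) powr (real DIM('a) + 2 * s))"

text \<open>
  Weak form of \<open>(-\<Delta>)^s u \<ge> c u\<close> in \<open>\<Omega>\<close>, \<open>u = 0\<close> outside \<open>\<Omega>\<close>. The exterior condition is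
  required at every point, as appropriate for the continuous representative.
\<close>

definition weak_supersolution ::
    "real \<Rightarrow> 'a::euclidean_space set \<Rightarrow> ('a \<Rightarrow> real) \<Rightarrow> ('a \<Rightarrow> real) \<Rightarrow> bool" where
  "weak_supersolution s \<Omega> c u \<longleftrightarrow>
     u \<in> Hs s \<and> u \<in> Hs0 s \<Omega> \<and> (\<forall>x. x \<notin> \<Omega> \<longrightarrow> u x = 0) \<and>
     (\<forall>\<phi>\<in>Hs0 s \<Omega>. (AE x in lebesgue_on \<Omega>. 0 \<le> \<phi> x) \<longrightarrow>
        gagliardo_form s u \<phi> \<ge> (LINT x|lebesgue_on \<Omega>. c x * u x * \<phi> x))"

definition interior_cone :: "'a::euclidean_space set \<Rightarrow> 'a \<Rightarrow> 'a \<Rightarrow> real \<Rightarrow> 'a set" where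
  "interior_cone \<Omega> x0 y0 \<beta> =
     {x \<in> \<Omega>. arccos (((x - x0) /\<^sub>R norm (x - x0)) \<bullet> ((y0 - x0) /\<^sub>R norm (y0 - x0))) < \<beta>}"

end

theory Submission
  imports Defs
begin

text \<open>
  Both conditions are equivalent to the divergence of the integral of
  \<open>u y * norm (y - x0) powr - (N + 2 * s)\<close> over a neighbourhood of \<open>x0\<close>. Values of \<open>u\<close> near \<open>x0\<close> are
  nonnegative and enter the fractional Laplacian at nearby points with the favourable sign, weighted
  by this kernel. Negative values occur only at a distance from \<open>x0\<close>, and together with the
  bounded coefficient \<open>c\<close> they contribute a bounded amount. If the integral diverges, the favourable
  part wins, and \<open>u\<close> lies above the barrier \<open>(r\<^sup>2 - (norm (y - z))\<^sup>2) powr s\<close> on every small ball in \<open>\<Omega>\<close>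
  with centre \<open>z\<close>, radius \<open>r\<close> and \<open>x0\<close> on its boundary (\<open>supersolution_ge_ball_profile_of_growth\<close>).
  On the ball of half the radius the barrier is at least \<open>(3 / 4) powr s * r powr (2 * s)\<close>, which is (i). For a
  fixed ball tangent to the interior ball, the barrier is at least a constant times
  \<open>norm (x - x0) powr s\<close> in each cone, which is (ii).

  Conversely, each of the two conditions provides a constant \<open>\<kappa> > 0\<close> and arbitrarily small \<open>r\<close> such that
  \<open>u \<ge> \<kappa> * r powr (2 * s)\<close> on a ball of radius \<open>r / 2\<close> whose centre is at distance \<open>r\<close> from \<open>x0\<close>. Such a
  ball contributes an amount independent of \<open>r\<close> to the integral, so infinitely many scales make it
  diverge (\<open>kernel_mass_unbounded\<close>). Only the scale of the ball enters. This links the balls in (i), which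
  may lie in any direction from \<open>x0\<close>, with the cones in (ii).

  That the barrier has a bounded fractional Laplacian is reduced to dimension one. The fractional
  Laplacian is an average over the lines through a point, and on a line the barrier is
  a multiple of \<open>((t + a) * (b - t)) powr s\<close>. The half-line profile \<open>x\<^sub>+ powr s\<close> is \<open>s\<close>-harmonic because
  an inversion turns the integrand into an exact derivative, and the profile of the interval differs
  from it by an error of the right homogeneity (\<open>interval_integral_le\<close>, \<open>ball_profile_operator_le\<close>).

  The comparison avoids test functions built from \<open>u\<close>. Testing the weak inequality with translates of a
  smooth bump function yields a pointwise inequality for the second differences of the mollified \<open>u\<close>
  (\<open>gagliardo_form_translate_bump\<close>, \<open>supersolution_mollified_ge\<close>). It is evaluated at a point of contact with
  the barrier (\<open>contact_point_operator_le\<close>), and the mollification is removed by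
  uniform convergence on compact sets.
\<close>

section \<open>A profile on an interval of the real line\<close>

text \<open>
  The function \<open>x\<^sub>+ powr s\<close> is \<open>s\<close>-harmonic on the half-line. Seen from the point \<open>1\<close>, the
  contributions of the points \<open>1 - t\<close> and \<open>1 / (1 - t)\<close> add up to a constant multiple of the derivative
  below, so their sum has an elementary primitive.
\<close>

lemma halfline_antiderivative:
  fixes s t :: real
  assumes "0 < s" "0 < t" "t < 1"
  shows "((\<lambda>t. (1 - (1 - t) powr s)\<^sup>2 * t powr (- 2 * s)) has_real_derivative
    2 * s * ((1 - (1 - t) powr s) * ((1 - t) powr (s - 1) - 1) * t powr (- 1 - 2 * s))) (at t)"
proof -
  have t: "t powr (- 2 * s) = t * t powr (- 1 - 2 * s)"
    using assms powr_add[of t 1 "- 1 - 2 * s"] by simp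
  have t': "t powr (- (2 * s) - 1) = t powr (- 1 - 2 * s)"
    by (rule arg_cong[where f="\<lambda>x. t powr x"]) simp
  have t'': "(1 - t) powr s = (1 - t) * (1 - t) powr (s - 1)"
    using assms powr_add[of "1 - t" 1 "s - 1"] by simp
  have "((\<lambda>t. (1 - (1 - t) powr s)\<^sup>2 * t powr (- 2 * s)) has_real_derivative
      2 * (1 - (1 - t) powr s) * (s * (1 - t) powr (s - 1)) * t powr (- 2 * s)
      + (1 - (1 - t) powr s)\<^sup>2 * (- 2 * s * t powr (- 1 - 2 * s))) (at t)"
    using assms by (auto intro!: derivative_eq_intros simp: t')
  moreover have "2 * (1 - (1 - t) powr s) * (s * (1 - t) powr (s - 1)) * t powr (- 2 * s)
      + (1 - (1 - t) powr s)\<^sup>2 * (- 2 * s * t powr (- 1 - 2 * s)) =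
      2 * s * ((1 - (1 - t) powr s) * ((1 - t) powr (s - 1) - 1) * t powr (- 1 - 2 * s))"
    unfolding t t'' by (simp add: algebra_simps power2_eq_square)
  ultimately show ?thesis by simp
qed

lemma integral_powr_Icc:
  fixes a b p :: real
  assumes "0 < a" "a \<le> b" "p \<noteq> -1"
  shows "((\<lambda>t. t powr p) has_integral ((b powr (p + 1) - a powr (p + 1)) / (p + 1))) {a..b}"
proof -
  have "((\<lambda>t. t powr p) has_integral (b powr (p + 1) / (p + 1) - a powr (p + 1) / (p + 1))) {a..b}"
  proof (rule fundamental_theorem_of_calculus[OF assms(2)])
    fix x assume "x \<in> {a..b}"
    then have "((\<lambda>t. t powr (p + 1) / (p + 1)) has_real_derivative x powr p) (at x)"
      using assms by (auto intro!: derivative_eq_intros)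
    then show "((\<lambda>t. t powr (p + 1) / (p + 1)) has_vector_derivative x powr p) (at x within {a..b})"
      by (simp add: has_real_derivative_iff_has_vector_derivative has_vector_derivative_at_within)
  qed
  then show ?thesis by (simp add: diff_divide_distrib)
qed

text \<open>
  The integral over all \<open>t > e\<close> would tend to \<open>0\<close> with \<open>e\<close>, which is the \<open>s\<close>-harmonicity of
  \<open>x\<^sub>+ powr s\<close>. The integral is stopped at \<open>L\<close> because it is compared later with that of a profile
  supported in an interval of relative length \<open>L\<close>; the price is of the order \<open>L powr (- s)\<close>.
\<close>

lemma halfline_integral_le:
  fixes s e L :: real
  assumes s: "0 < s" "s < 1" and e: "0 < e" "e \<le> 1 / 2" and L: "1 \<le> L"
  shows "integral {e..L} (\<lambda>t. (2 - (1 + t) powr s - (max 0 (1 - t)) powr s) * t powr (- 1 - 2 * s))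
    \<le> (e powr (2 - 2 * s) + 8 * L powr (- s) - L powr (- 2 * s)) / (2 * s)"
proof -
  \<comment> \<open>The substitution maps \<open>\<tau>\<close> to \<open>L\<close>, so that both halves of the integrand are cut at matching points.\<close>
  define \<tau> where "\<tau> = L / (1 + L)"
  define k where "k = (\<lambda>t::real. t powr (- 1 - 2 * s))"
  define n where "n = (\<lambda>t. (1 - (1 - t) powr s) * (1 - t) powr (s - 1) * k t)"
  define A where "A = (\<lambda>t. (1 - (max 0 (1 - t)) powr s) * k t)"
  define N where "N = (\<lambda>t. ((1 + t) powr s - 1) * k t)"
  define \<Theta> where "\<Theta> = (\<lambda>t. (1 - (1 - t) powr s)\<^sup>2 * t powr (- 2 * s))"
  have tau: "1 / 2 \<le> \<tau>" "\<tau> < 1" "\<tau> \<le> L" "1 - \<tau> = 1 / (1 + L)" "\<tau> / (1 - \<tau>) = L"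
    using L unfolding \<tau>_def by (auto simp: field_simps)
  then have tau: "1 / 2 \<le> \<tau>" "\<tau> < 1" "e \<le> \<tau>" "\<tau> \<le> L" "1 - \<tau> = 1 / (1 + L)" "\<tau> / (1 - \<tau>) = L"
    using e by linarith+
  have kc: "continuous_on {a..b} k" if "0 < a" for a b
    unfolding k_def using that by (auto intro!: continuous_intros)
  have Ac: "continuous_on {a..b} A" if "0 < a" for a b
    unfolding A_def using that s by (auto intro!: continuous_intros kc continuous_on_powr')
  have Nc: "continuous_on {a..b} N" if "0 < a" for a b
    unfolding N_def using that s by (auto intro!: continuous_intros kc)
  have nc: "continuous_on {e..\<tau>} n"
    unfolding n_def using e tau by (auto intro!: continuous_intros kc)
  have k0: "0 \<le> k t" for t unfolding k_def by simp
  have N0: "0 \<le> N t" if "0 \<le> t" for t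
    unfolding N_def using that s k0 by (auto intro!: mult_nonneg_nonneg ge_one_powr_ge_zero)
  \<comment> \<open>The inversion: \<open>1 + t\<close> and \<open>1 - x\<close> are reciprocal for \<open>t = x / (1 - x)\<close>.\<close>
  have sub: "((\<lambda>x. (1 / (1 - x)\<^sup>2) *\<^sub>R N (x / (1 - x))) has_integral
      (integral {e / (1 - e)..\<tau> / (1 - \<tau>)} N)) {e..\<tau>}"
  proof (rule has_integral_substitution[where c="e" and d=L])
    show "(\<lambda>x. x / (1 - x)) ` {e..\<tau>} \<subseteq> {e..L}"
    proof clarify
      fix x assume x: "x \<in> {e..\<tau>}"
      then have "x \<le> x / (1 - x)" using tau e by (auto simp: field_simps)
      moreover have "x / (1 - x) \<le> \<tau> / (1 - \<tau>)" using x tau e by (intro frac_le) auto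
      ultimately show "x / (1 - x) \<in> {e..L}" using x tau by auto
    qed
    show "e / (1 - e) \<le> \<tau> / (1 - \<tau>)" using e tau by (intro frac_le) auto
    show "continuous_on {e..L} N" using Nc e by auto
    fix x assume "x \<in> {e..\<tau>}"
    then show "((\<lambda>x. x / (1 - x)) has_real_derivative 1 / (1 - x)\<^sup>2) (at x within {e..\<tau>})"
      using tau by (auto intro!: derivative_eq_intros simp: power2_eq_square field_simps)
  qed (use tau e L in auto)
  have eq: "(1 / (1 - x)\<^sup>2) *\<^sub>R N (x / (1 - x)) = n x" if "x \<in> {e..\<tau>}" for x
  proof -
    have x: "0 < x" "x < 1" using that e tau by auto
    have 1: "1 + x / (1 - x) = 1 / (1 - x)" using x by (simp add: field_simps)
    have 2: "(x / (1 - x)) powr (- 1 - 2 * s) = k x * (1 - x) powr (1 + 2 * s)"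
      using x by (simp add: k_def powr_divide powr_minus_divide[symmetric] field_simps powr_add[symmetric])
    have 3: "(1 / (1 - x)) powr s = (1 - x) powr (- s)"
      using x by (simp add: powr_divide powr_minus_divide)
    have 4: "1 / (1 - x)\<^sup>2 = (1 - x) powr (- 2)"
      using x by (simp add: powr_minus_divide powr_numeral)
    have "(1 / (1 - x)\<^sup>2) *\<^sub>R N (x / (1 - x)) =
        ((1 - x) powr (- s) - 1) * (k x * ((1 - x) powr (1 + 2 * s) * (1 - x) powr (- 2)))"
      using 1 2 3 4 unfolding N_def k_def by simp
    also have "\<dots> = ((1 - x) powr (- s) * (1 - x) powr (2 * s - 1) - (1 - x) powr (2 * s - 1)) * k x"
      by (simp add: powr_add[symmetric] algebra_simps)
    also have "\<dots> = ((1 - x) powr (s - 1) - (1 - x) powr (s + (s - 1))) * k x"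
      by (simp add: powr_add[symmetric] algebra_simps)
    also have "\<dots> = n x" unfolding n_def powr_add by (simp add: algebra_simps)
    finally show ?thesis .
  qed
  have n_int: "(n has_integral (integral {e / (1 - e)..L} N)) {e..\<tau>}"
    using has_integral_eq[OF eq sub] tau by simp
  \<comment> \<open>Moving the lower end from \<open>e / (1 - e)\<close> down to \<open>e\<close> only adds a nonnegative amount to the subtracted integral.\<close>
  have Nle: "integral {e / (1 - e)..L} N \<le> integral {e..L} N"
  proof (rule integral_subset_le)
    show "{e / (1 - e)..L} \<subseteq> {e..L}" using e by (auto simp: field_simps intro: order_trans[rotated])
    show "N integrable_on {e / (1 - e)..L}" "N integrable_on {e..L}"
      using e by (auto intro!: integrable_continuous_real Nc)
  qed (use e N0 in auto)
  have An: "((\<lambda>t. A t - n t) has_integral (- (\<Theta> \<tau> - \<Theta> e) / (2 * s))) {e..\<tau>}"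
  proof -
    have "((\<lambda>t. 2 * s * ((1 - (1 - t) powr s) * ((1 - t) powr (s - 1) - 1) * t powr (- 1 - 2 * s)))
        has_integral \<Theta> \<tau> - \<Theta> e) {e..\<tau>}"
    proof (rule fundamental_theorem_of_calculus)
      fix x assume "x \<in> {e..\<tau>}"
      then show "(\<Theta> has_vector_derivative 2 * s * ((1 - (1 - x) powr s) *
          ((1 - x) powr (s - 1) - 1) * x powr (- 1 - 2 * s))) (at x within {e..\<tau>})"
        using halfline_antiderivative[of s x] e tau s unfolding \<Theta>_def
        by (auto simp: has_real_derivative_iff_has_vector_derivative has_vector_derivative_at_within)
    qed (use tau in auto)
    from has_integral_mult_right[OF this, of "- 1 / (2 * s)"]
    have "((\<lambda>t. - ((1 - (1 - t) powr s) * ((1 - t) powr (s - 1) - 1) * t powr (- 1 - 2 * s)))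
        has_integral - 1 / (2 * s) * (\<Theta> \<tau> - \<Theta> e)) {e..\<tau>}"
      by (rule has_integral_eq[rotated]) (use s in \<open>simp add: field_simps\<close>)
    then have "((\<lambda>t. - ((1 - (1 - t) powr s) * ((1 - t) powr (s - 1) - 1) * t powr (- 1 - 2 * s)))
        has_integral - (\<Theta> \<tau> - \<Theta> e) / (2 * s)) {e..\<tau>}"
    proof (rule has_integral_eq_rhs)
      have "- d / (2 * s) = - 1 / (2 * s) * d" for d by simp
      then show "- (\<Theta> \<tau> - \<Theta> e) / (2 * s) = - 1 / (2 * s) * (\<Theta> \<tau> - \<Theta> e)" .
    qed
    then show ?thesis
      by (rule has_integral_eq[rotated]) (use tau in \<open>auto simp: A_def n_def k_def algebra_simps\<close>)
  qed
  have A1: "integral {e..\<tau>} A - integral {e / (1 - e)..L} N = - (\<Theta> \<tau> - \<Theta> e) / (2 * s)"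
    using integral_unique[OF An] integral_unique[OF n_int]
    by (subst (asm) integral_diff) (use Ac e nc in \<open>auto intro!: integrable_continuous_real\<close>)
  have A2: "integral {\<tau>..L} A \<le> (\<tau> powr (- 2 * s) - L powr (- 2 * s)) / (2 * s)"
  proof -
    have i: "(k has_integral (L powr (- 2 * s) - \<tau> powr (- 2 * s)) / (- 2 * s)) {\<tau>..L}"
      using integral_powr_Icc[of \<tau> L "- 1 - 2 * s"] tau s unfolding k_def by simp
    have "integral {\<tau>..L} A \<le> integral {\<tau>..L} k"
    proof (rule integral_le)
      show "A integrable_on {\<tau>..L}" "k integrable_on {\<tau>..L}"
        using tau by (auto intro!: integrable_continuous_real Ac kc)
      fix t assume "t \<in> {\<tau>..L}"
      then have "max 0 (1 - t) powr s \<le> 1" using tau s by (auto intro!: powr_le1)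
      then show "A t \<le> k t" by (auto simp: A_def k0 intro!: mult_left_le_one_le)
    qed
    then show ?thesis using integral_unique[OF i] s by (simp add: field_simps)
  qed
  have T: "\<tau> powr (- 2 * s) - \<Theta> \<tau> \<le> 8 * L powr (- s)"
  proof -
    define p where "p = (1 - \<tau>) powr s"
    have p: "0 \<le> p" "p \<le> L powr (- s)"
    proof -
      have "p \<le> (1 / L) powr s" unfolding p_def using tau L s by (intro powr_mono2) (auto simp: field_simps)
      then show "p \<le> L powr (- s)" using L by (simp add: powr_divide powr_minus_divide)
    qed (simp add: p_def)
    have "\<tau> powr (- 2 * s) \<le> (1 / 2) powr (- 2 * s)"
      using tau s by (intro powr_mono2') auto
    also have "\<dots> = 2 powr (2 * s)" by (simp add: powr_divide powr_minus_divide)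
    also have "\<dots> \<le> 2 powr 2" using s by (intro powr_mono) auto
    finally have t4: "\<tau> powr (- 2 * s) \<le> 4" by simp
    have "\<tau> powr (- 2 * s) - \<Theta> \<tau> = \<tau> powr (- 2 * s) * (p * (2 - p))"
      unfolding \<Theta>_def p_def by (simp add: power2_eq_square algebra_simps)
    also have "\<dots> \<le> \<tau> powr (- 2 * s) * (2 * p)"
      using p by (intro mult_left_mono) (auto simp: algebra_simps)
    also have "\<dots> \<le> 4 * (2 * L powr (- s))"
      using t4 p by (intro mult_mono) auto
    finally show ?thesis by simp
  qed
  have Te: "\<Theta> e \<le> e powr (2 - 2 * s)"
  proof -
    have "1 - e \<le> (1 - e) powr s" using powr_mono'[of s 1 "1 - e"] s e by simp
    moreover have "(1 - e) powr s \<le> 1" using e s by (simp add: powr_le1)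
    ultimately have "(1 - (1 - e) powr s)\<^sup>2 \<le> e\<^sup>2" by (intro power_mono) auto
    then have "\<Theta> e \<le> e\<^sup>2 * e powr (- 2 * s)" unfolding \<Theta>_def by (intro mult_right_mono) auto
    also have "\<dots> = e powr 2 * e powr (- 2 * s)" using e by (simp add: powr_numeral)
    also have "\<dots> = e powr (2 - 2 * s)" by (simp add: powr_add[symmetric])
    finally show ?thesis .
  qed
  have "integral {e..L} (\<lambda>t. (2 - (1 + t) powr s - (max 0 (1 - t)) powr s) * t powr (- 1 - 2 * s))
      = integral {e..L} (\<lambda>t. A t - N t)"
    by (rule integral_cong) (simp add: A_def N_def k_def algebra_simps)
  also have "\<dots> = integral {e..L} A - integral {e..L} N"
    by (rule integral_diff) (use e in \<open>auto intro!: integrable_continuous_real Ac Nc\<close>)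
  also have "integral {e..L} A = integral {e..\<tau>} A + integral {\<tau>..L} A"
    by (rule Henstock_Kurzweil_Integration.integral_combine[symmetric])
       (use e tau in \<open>auto intro!: integrable_continuous_real Ac\<close>)
  finally have "integral {e..L} (\<lambda>t. (2 - (1 + t) powr s - (max 0 (1 - t)) powr s) * t powr (- 1 - 2 * s))
      \<le> - (\<Theta> \<tau> - \<Theta> e) / (2 * s) + (\<tau> powr (- 2 * s) - L powr (- 2 * s)) / (2 * s)"
    using A1 A2 Nle by linarith
  also have "\<dots> = (\<Theta> e + (\<tau> powr (- 2 * s) - \<Theta> \<tau>) - L powr (- 2 * s)) / (2 * s)"
    by (simp add: add_divide_distrib diff_divide_distrib)
  also have "\<dots> \<le> (e powr (2 - 2 * s) + 8 * L powr (- s) - L powr (- 2 * s)) / (2 * s)"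
    using T Te s by (intro divide_right_mono) auto
  finally show ?thesis .
qed

text \<open>
  The tangent line at \<open>0\<close> of the convex function \<open>(1 + x) powr (s - 1)\<close>, multiplied by \<open>1 + x\<close>.
\<close>

lemma powr_second_order:
  fixes s x :: real
  assumes "0 < s" "s < 1" "-1 < x"
  shows "1 + s * x - x\<^sup>2 \<le> (1 + x) powr s"
proof -
  have "1 + (s - 1) * x \<le> 1 + (s - 1) * ln (1 + x)"
    using assms ln_le_minus_one[of "1 + x"] by (auto intro!: mult_left_mono_neg)
  also have "\<dots> \<le> (1 + x) powr (s - 1)"
    using assms exp_ge_add_one_self[of "(s - 1) * ln (1 + x)"] by (simp add: powr_def)
  finally have "(1 + x) * (1 + (s - 1) * x) \<le> (1 + x) * (1 + x) powr (s - 1)"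
    using assms by (intro mult_left_mono) auto
  also have "\<dots> = (1 + x) powr s"
    using assms powr_add[of "1 + x" 1 "s - 1"] by simp
  finally have "1 + s * x + (s - 1) * x\<^sup>2 \<le> (1 + x) powr s"
    by (simp add: algebra_simps power2_eq_square)
  moreover have "- x\<^sup>2 \<le> (s - 1) * x\<^sup>2" using assms mult_right_mono[of "-1" "s - 1" "x\<^sup>2"] by simp
  ultimately show ?thesis by linarith
qed

text \<open>
  The left-hand side is the change of the second difference when the profile of the half-line
  is replaced by that of the interval from \<open>-1\<close> to \<open>L\<close>. For \<open>t < 1\<close> the terms of first order in
  \<open>t / L\<close> cancel between \<open>t\<close> and \<open>-t\<close>; this is why the right-hand side is integrable at \<open>0\<close>
  against \<open>t powr (- 1 - 2 * s)\<close> for every \<open>s < 1\<close>.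
\<close>

lemma interval_halfline_difference:
  fixes s t L :: real
  assumes s: "0 < s" "s < 1" and t: "0 < t" "t \<le> L" and L: "1 \<le> L"
  shows "(1 + t) powr s * (1 - (1 - t / L) powr s) + (max 0 (1 - t)) powr s * (1 - (1 + t / L) powr s)
     \<le> 5 * t powr (1 + s) / L"
proof -
  define \<tau> where "\<tau> = t / L"
  have tau: "0 < \<tau>" "\<tau> \<le> 1" "\<tau> \<le> t" using t L by (auto simp: \<tau>_def field_simps)
  have b: "\<tau> * t powr s = t powr (1 + s) / L" using t by (simp add: \<tau>_def powr_add)
  have sm: "1 - \<tau> \<le> (1 - \<tau>) powr s" using powr_mono'[of s 1 "1 - \<tau>"] s tau by simp
  have neg: "(max 0 (1 - t)) powr s * (1 - (1 + \<tau>) powr s) \<le> 0"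
    using tau s by (auto intro!: mult_nonneg_nonpos ge_one_powr_ge_zero)
  show ?thesis unfolding \<tau>_def[symmetric]
  proof (cases "t < 1")
    case False
    have "(1 + t) powr s * (1 - (1 - \<tau>) powr s) \<le> (4 * t) powr s * \<tau>"
      using sm tau t False s by (intro mult_mono powr_mono2) (auto simp: powr_le1)
    also have "\<dots> = 4 powr s * (\<tau> * t powr s)" using t by (simp add: powr_mult)
    also have "\<dots> \<le> 5 * (\<tau> * t powr s)"
      using powr_mono[of s 1 4] s tau by (intro mult_right_mono) auto
    finally show "(1 + t) powr s * (1 - (1 - \<tau>) powr s)
       + (max 0 (1 - t)) powr s * (1 - (1 + \<tau>) powr s) \<le> 5 * t powr (1 + s) / L"
      using neg b by linarith
  next
    case True
    have tau1: "\<tau> < 1" using True tau by linarith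
    have p: "1 - (1 - \<tau>) powr s \<le> s * \<tau> + \<tau>\<^sup>2" "1 - (1 + \<tau>) powr s \<le> - s * \<tau> + \<tau>\<^sup>2"
      using powr_second_order[of s "-\<tau>"] powr_second_order[of s \<tau>] s tau tau1 by auto
    have q: "(1 + t) powr s \<le> 1 + t" "1 - t \<le> (1 - t) powr s" "(1 - t) powr s \<le> 1"
      using powr_mono[of s 1 "1 + t"] powr_mono'[of s 1 "1 - t"] s t True by (auto simp: powr_le1)
    have "(1 + t) powr s * (1 - (1 - \<tau>) powr s) \<le> (1 + t) * (s * \<tau> + \<tau>\<^sup>2)"
      using p q t tau s by (intro mult_mono) (auto simp: powr_le1)
    moreover have "(1 - t) powr s * (1 - (1 + \<tau>) powr s) \<le> (1 - t) powr s * (- s * \<tau> + \<tau>\<^sup>2)"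
      using p by (intro mult_left_mono) auto
    moreover have "(1 - t) powr s * \<tau>\<^sup>2 \<le> \<tau>\<^sup>2" using q by (simp add: mult_left_le_one_le)
    moreover have "(1 - t) * (s * \<tau>) \<le> (1 - t) powr s * (s * \<tau>)"
      using q s tau by (intro mult_right_mono) auto
    ultimately have "(1 + t) powr s * (1 - (1 - \<tau>) powr s) + (1 - t) powr s * (1 - (1 + \<tau>) powr s)
        \<le> (1 + t) * (s * \<tau> + \<tau>\<^sup>2) - (1 - t) * (s * \<tau>) + \<tau>\<^sup>2"
      by (simp add: algebra_simps)
    also have "\<dots> = 2 * s * (t * \<tau>) + (2 + t) * (\<tau> * \<tau>)" by (simp add: algebra_simps power2_eq_square)
    also have "\<dots> \<le> 2 * 1 * (t * \<tau>) + 3 * (t * \<tau>)"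
      using s t tau True by (intro add_mono mult_mono) auto
    also have "\<dots> = 5 * (\<tau> * t)" by simp
    also have "t \<le> t powr s" using powr_mono'[of s 1 t] s t True by simp
    finally show "(1 + t) powr s * (1 - (1 - \<tau>) powr s)
       + (max 0 (1 - t)) powr s * (1 - (1 + \<tau>) powr s) \<le> 5 * t powr (1 + s) / L"
      using b True tau by (simp add: mult_left_mono)
  qed
qed

definition interval_const :: "real \<Rightarrow> real" where
  "interval_const s = 5 / s + 5 / (1 - s)"

text \<open>
  The summand \<open>L powr (- 2 * s) / s\<close> is the integral over \<open>t > L\<close>, where both shifted values vanish.
  The power \<open>L powr (- s)\<close> on the right is exactly what makes the rescaled bound below independent of
  the position in the interval.
\<close>

lemma scaled_interval_integral_le:
  fixes s e L :: real
  assumes s: "0 < s" "s < 1" and e: "0 < e" "e \<le> 1 / 2" and L: "1 \<le> L"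
  shows "integral {e..L} (\<lambda>t. (2 - (max 0 ((1 + t) * (1 - t / L))) powr s
        - (max 0 ((1 - t) * (1 + t / L))) powr s) * t powr (- 1 - 2 * s)) + L powr (- 2 * s) / s
    \<le> e powr (2 - 2 * s) / (2 * s) + interval_const s * L powr (- s)"
proof -
  define H where "H = (\<lambda>t. (2 - (1 + t) powr s - (max 0 (1 - t)) powr s) * t powr (- 1 - 2 * s))"
  have Hc: "continuous_on {e..L} H"
    unfolding H_def using e s by (auto intro!: continuous_intros continuous_on_powr')
  define m where "m = (\<lambda>t. (5 / L) * t powr (- s))"
  have m: "(m has_integral (5 / L) * ((L powr (1 - s) - e powr (1 - s)) / (1 - s))) {e..L}"
    unfolding m_def using integral_powr_Icc[of e L "- s"] e L s
    by (intro has_integral_mult_right) auto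
  have "integral {e..L} (\<lambda>t. (2 - (max 0 ((1 + t) * (1 - t / L))) powr s
        - (max 0 ((1 - t) * (1 + t / L))) powr s) * t powr (- 1 - 2 * s))
      \<le> integral {e..L} (\<lambda>t. H t + m t)"
  proof (rule integral_le)
    show "(\<lambda>t. (2 - (max 0 ((1 + t) * (1 - t / L))) powr s
        - (max 0 ((1 - t) * (1 + t / L))) powr s) * t powr (- 1 - 2 * s)) integrable_on {e..L}"
      using e s L by (intro integrable_continuous_real) (auto intro!: continuous_intros continuous_on_powr')
    show "(\<lambda>t. H t + m t) integrable_on {e..L}"
      using m Hc by (intro integrable_add integrable_continuous_real has_integral_integrable)
    fix t assume t: "t \<in> {e..L}"
    have t0: "0 < t" "t \<le> L" using t e by auto
    have m1: "(max 0 ((1 + t) * (1 - t / L))) powr s = (1 + t) powr s * (1 - t / L) powr s"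
    proof -
      have "0 \<le> (1 + t) * (1 - t / L)" using t0 L by (intro mult_nonneg_nonneg) auto
      then show ?thesis using t0 L by (simp add: powr_mult)
    qed
    have m2: "(max 0 ((1 - t) * (1 + t / L))) powr s = (max 0 (1 - t)) powr s * (1 + t / L) powr s"
    proof -
      have "max 0 ((1 - t) * (1 + t / L)) = max 0 (1 - t) * (1 + t / L)"
        using t0 L by (auto simp: max_def mult_nonpos_nonneg not_le zero_le_mult_iff)
           (auto simp: add_pos_nonneg field_simps intro: antisym)
      then show ?thesis using t0 L by (simp add: powr_mult)
    qed
    have "2 - (max 0 ((1 + t) * (1 - t / L))) powr s - (max 0 ((1 - t) * (1 + t / L))) powr s
       \<le> (2 - (1 + t) powr s - (max 0 (1 - t)) powr s) + 5 * t powr (1 + s) / L"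
      using interval_halfline_difference[OF s t0 L] unfolding m1 m2 by (simp add: algebra_simps)
    then have "(2 - (max 0 ((1 + t) * (1 - t / L))) powr s - (max 0 ((1 - t) * (1 + t / L))) powr s)
          * t powr (- 1 - 2 * s)
       \<le> ((2 - (1 + t) powr s - (max 0 (1 - t)) powr s) + 5 * t powr (1 + s) / L) * t powr (- 1 - 2 * s)"
      by (intro mult_right_mono) auto
    also have "\<dots> = H t + m t"
    proof -
      have "t powr (1 + s) * t powr (- 1 - 2 * s) = t powr (- s)"
        by (simp add: powr_add[symmetric])
      then show ?thesis unfolding H_def m_def by (simp add: algebra_simps)
    qed
    finally show "(2 - (max 0 ((1 + t) * (1 - t / L))) powr s - (max 0 ((1 - t) * (1 + t / L))) powr s)
          * t powr (- 1 - 2 * s) \<le> H t + m t" .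
  qed
  also have "\<dots> = integral {e..L} H + integral {e..L} m"
    using m Hc by (intro integral_add integrable_continuous_real has_integral_integrable)
  also have "integral {e..L} H \<le> (e powr (2 - 2 * s) + 8 * L powr (- s) - L powr (- 2 * s)) / (2 * s)"
    using halfline_integral_le[OF s e L] unfolding H_def .
  also have "integral {e..L} m \<le> (5 / L) * (L powr (1 - s) / (1 - s))"
    unfolding integral_unique[OF m] using L s by (intro mult_left_mono divide_right_mono) auto
  also have "(5 / L) * (L powr (1 - s) / (1 - s)) = 5 / (1 - s) * L powr (- s)"
    using L by (simp add: powr_diff powr_minus_divide)
  finally have "integral {e..L} (\<lambda>t. (2 - (max 0 ((1 + t) * (1 - t / L))) powr s
        - (max 0 ((1 - t) * (1 + t / L))) powr s) * t powr (- 1 - 2 * s)) + L powr (- 2 * s) / s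
     \<le> (e powr (2 - 2 * s) + 8 * L powr (- s) - L powr (- 2 * s)) / (2 * s) + 5 / (1 - s) * L powr (- s)
       + L powr (- 2 * s) / s"
    by simp
  also have "\<dots> = e powr (2 - 2 * s) / (2 * s) + (4 / s + 5 / (1 - s)) * L powr (- s)
       + L powr (- 2 * s) / (2 * s)"
    using s by (simp add: field_simps)
  also have "L powr (- 2 * s) / (2 * s) \<le> 1 / s * L powr (- s)"
  proof -
    have "L powr (- 2 * s) \<le> L powr (- s)" using L s by (intro powr_mono) auto
    then have "L powr (- 2 * s) / (2 * s) \<le> L powr (- s) / (2 * s)"
      using s by (intro divide_right_mono) auto
    also have "\<dots> \<le> 1 / s * L powr (- s)" using s by (simp add: field_simps)
    finally show ?thesis .
  qed
  finally show ?thesis by (simp add: interval_const_def algebra_simps add_divide_distrib)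
qed

text \<open>
  At distances \<open>a\<close> and \<open>b\<close> from the end points of an interval, the fractional Laplacian of the profile
  \<open>((t + a) * (b - t)) powr s\<close>, truncated at \<open>e\<close>, is bounded by a constant depending on \<open>s\<close> only, up to
  an error that vanishes with \<open>e\<close>. (Untruncated, it is a constant on the interval; a barrier requires the
  upper bound.) The substitution \<open>t = a * t'\<close> reduces to unit distance.
\<close>

lemma interval_integral_le:
  fixes s e a b :: real
  assumes s: "0 < s" "s < 1" and ab: "0 < a" "a \<le> b" and e: "0 < e" "e \<le> a / 2"
  defines "f \<equiv> \<lambda>t. (2 * (a * b) powr s - (max 0 ((a + t) * (b - t))) powr s
        - (max 0 ((a - t) * (b + t))) powr s) * t powr (- 1 - 2 * s)"
  shows "f absolutely_integrable_on {e..}"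
    and "integral {e..} f \<le> interval_const s + (b / a) powr s * ((e / a) powr (2 - 2 * s) / (2 * s))"
proof -
  define L where "L = b / a"
  define P where "P = (\<lambda>t. (2 - (max 0 ((1 + t) * (1 - t / L))) powr s
        - (max 0 ((1 - t) * (1 + t / L))) powr s) * t powr (- 1 - 2 * s))"
  have L: "1 \<le> L" "b = a * L" using ab by (auto simp: L_def)
  have eb: "e \<le> b" using e ab by auto
  have fc: "continuous_on {e..b} f"
    unfolding f_def using e s by (auto intro!: continuous_intros continuous_on_powr')
  have scale: "f (a * t) = L powr s / a * P t" if "0 < t" for t
  proof -
    have 1: "(a + a * t) * (b - a * t) = (a * b) * ((1 + t) * (1 - t / L))"
      "(a - a * t) * (b + a * t) = (a * b) * ((1 - t) * (1 + t / L))"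
      using ab L by (auto simp: field_simps)
    have 2: "(max 0 ((a * b) * x)) powr s = (a * b) powr s * (max 0 x) powr s" for x
    proof -
      have "max 0 ((a * b) * x) = (a * b) * max 0 x"
        using ab by (auto simp: max_def zero_le_mult_iff mult_le_0_iff)
      then show ?thesis using ab by (simp add: powr_mult)
    qed
    have 3: "(a * t) powr (- 1 - 2 * s) = a powr (- 1 - 2 * s) * t powr (- 1 - 2 * s)"
      using ab that by (simp add: powr_mult)
    have 4: "(a * b) powr s * a powr (- 1 - 2 * s) = L powr s / a"
    proof -
      have "(a * b) powr s * a powr (- 1 - 2 * s) = L powr s * (a powr s * a powr s * a powr (- 1 - 2 * s))"
        using ab L by (simp add: powr_mult)
      also have "a powr s * a powr s * a powr (- 1 - 2 * s) = a powr (- 1)"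
        by (simp only: powr_add[symmetric]) simp
      also have "\<dots> = 1 / a" using ab by (simp add: powr_minus_divide)
      finally show ?thesis by simp
    qed
    have "f (a * t) = (a * b) powr s * a powr (- 1 - 2 * s) * P t"
      unfolding f_def P_def 1 2 3 by (simp add: algebra_simps)
    then show ?thesis using 4 by simp
  qed
  have i1: "integral {e..b} f = L powr s * integral {e / a..L} P"
  proof -
    have "((\<lambda>t. a *\<^sub>R f (a * t)) has_integral (integral {a * (e / a)..a * L} f)) {e / a..L}"
    proof (rule has_integral_substitution[where c=e and d=b])
      show "(*) a ` {e / a..L} \<subseteq> {e..b}"
        using ab L by (auto simp: field_simps)
      have "e / a \<le> 1" using e ab by (simp add: field_simps)
      then show "e / a \<le> L" using L by linarith
      show "a * (e / a) \<le> a * L" using eb L ab by simp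
    qed (use fc eb in \<open>auto intro!: derivative_eq_intros\<close>)
    then have i: "((\<lambda>t. a *\<^sub>R f (a * t)) has_integral (integral {e..b} f)) {e / a..L}"
      using ab L by simp
    have "((\<lambda>t. L powr s * P t) has_integral (integral {e..b} f)) {e / a..L}"
    proof (rule has_integral_eq[OF _ i])
      fix t assume "t \<in> {e / a..L}"
      moreover have "0 < e / a" using e ab by simp
      ultimately have "0 < t" by auto
      then show "a *\<^sub>R f (a * t) = L powr s * P t" using scale ab by simp
    qed
    then show ?thesis by (metis integral_mult_right integral_unique)
  qed
  have f_b: "f t = 2 * (a * b) powr s * t powr (- 1 - 2 * s)" if "t \<in> {b..}" for t
  proof -
    have "(a + t) * (b - t) \<le> 0" using that ab by (intro mult_nonneg_nonpos) auto
    moreover have "(a - t) * (b + t) \<le> 0" using that ab by (intro mult_nonpos_nonneg) auto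
    ultimately show ?thesis unfolding f_def by (simp add: max_absorb1)
  qed
  have i2: "(f has_integral ((a * b) powr s * b powr (- 2 * s) / s)) {b..}"
  proof -
    have "((\<lambda>t. 2 * (a * b) powr s * t powr (- 1 - 2 * s)) has_integral
        2 * (a * b) powr s * (- (b powr ((- 1 - 2 * s) + 1)) / ((- 1 - 2 * s) + 1))) {b..}"
      using ab s by (intro has_integral_mult_right has_integral_powr_to_inf) auto
    then have "((\<lambda>t. 2 * (a * b) powr s * t powr (- 1 - 2 * s)) has_integral
        (a * b) powr s * b powr (- 2 * s) / s) {b..}"
      by (rule has_integral_eq_rhs) (use s in \<open>simp add: field_simps\<close>)
    then show ?thesis by (rule has_integral_eq[rotated]) (simp add: f_b)
  qed
  have split: "{e..b} \<union> {b..} = {e..}" using eb by auto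
  have "f absolutely_integrable_on {e..b}"
    using fc by (rule absolutely_integrable_continuous_real)
  moreover have "f absolutely_integrable_on {b..}"
    by (rule nonnegative_absolutely_integrable_1) (use i2 f_b in auto)
  ultimately show "f absolutely_integrable_on {e..}"
    unfolding split[symmetric] by (rule set_integrable_Un) auto
  have "(f has_integral (integral {e..b} f + (a * b) powr s * b powr (- 2 * s) / s)) ({e..b} \<union> {b..})"
  proof (rule has_integral_Un)
    show "(f has_integral integral {e..b} f) {e..b}"
      using fc by (simp add: integrable_integral integrable_continuous_real)
    have "{e..b} \<inter> {b..} \<subseteq> {b}" by auto
    then show "negligible ({e..b} \<inter> {b..})" using negligible_subset negligible_sing by blast
  qed (rule i2)
  then have "integral {e..} f = integral {e..b} f + (a * b) powr s * b powr (- 2 * s) / s"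
    unfolding split by (rule integral_unique)
  also have "(a * b) powr s * b powr (- 2 * s) = L powr s * L powr (- 2 * s)"
  proof -
    have "(a * b) powr s * b powr (- 2 * s) = L powr s * (a powr s * a powr s * a powr (- 2 * s)) * L powr (- 2 * s)"
      using ab L by (simp add: powr_mult)
    also have "a powr s * a powr s * a powr (- 2 * s) = 1"
      using ab by (simp only: powr_add[symmetric]) simp
    finally show ?thesis by simp
  qed
  finally have "integral {e..} f = L powr s * (integral {e / a..L} P + L powr (- 2 * s) / s)"
    unfolding i1 by (simp add: algebra_simps)
  also have "\<dots> \<le> L powr s * ((e / a) powr (2 - 2 * s) / (2 * s) + interval_const s * L powr (- s))"
    unfolding P_def using e ab by (intro mult_left_mono scaled_interval_integral_le s L) (auto simp: field_simps)
  also have "\<dots> = interval_const s * (L powr s * L powr (- s)) + L powr s * ((e / a) powr (2 - 2 * s) / (2 * s))"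
    by (simp add: algebra_simps)
  also have "L powr s * L powr (- s) = 1" using L by (simp add: powr_add[symmetric])
  finally show "integral {e..} f \<le> interval_const s + (b / a) powr s * ((e / a) powr (2 - 2 * s) / (2 * s))"
    unfolding L_def by simp
qed

section \<open>Integration along rays\<close>

lemma nn_integral_lborel_affine:
  fixes t :: "'a::euclidean_space" and f :: "'a \<Rightarrow> ennreal"
  assumes [measurable]: "f \<in> borel_measurable borel" and "c \<noteq> 0"
  shows "(\<integral>\<^sup>+x. f x \<partial>lborel) = ennreal (\<bar>c\<bar> ^ DIM('a)) * (\<integral>\<^sup>+x. f (t + c *\<^sub>R x) \<partial>lborel)"
  by (subst lborel_affine[OF assms(2), of t])
     (simp add: nn_integral_density nn_integral_distr nn_integral_cmult)

lemma integral_lborel_affine_unit: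
  fixes t :: "'a::euclidean_space" and f :: "'a \<Rightarrow> real"
  assumes [measurable]: "f \<in> borel_measurable borel" and "\<bar>c\<bar> = 1"
  shows "(LINT x|lborel. f (t + c *\<^sub>R x)) = (LINT x|lborel. f x)"
    and "integrable lborel (\<lambda>x. f (t + c *\<^sub>R x)) \<longleftrightarrow> integrable lborel f"
proof -
  have c: "c \<noteq> 0" using assms by auto
  have 1: "lborel = distr lborel borel (\<lambda>x. t + c *\<^sub>R x)"
    using lborel_affine[OF c, of t] assms(2) by (simp add: density_1)
  show "(LINT x|lborel. f (t + c *\<^sub>R x)) = (LINT x|lborel. f x)"
    by (subst (2) 1) (simp add: integral_distr)
  show "integrable lborel (\<lambda>x. f (t + c *\<^sub>R x)) \<longleftrightarrow> integrable lborel f"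
    by (subst (2) 1) (simp add: integrable_distr_eq)
qed

text \<open>
  Every point lies in the dilates \<open>l *\<^sub>R dyadic_shell\<close> for a set of \<open>l\<close> of the same logarithmic measure.
\<close>

lemma nn_integral_inverse_dyadic:
  assumes "0 < (r::real)"
  shows "(\<integral>\<^sup>+l. indicator {0<..} l * (indicator {1..2} (r / l) * ennreal (1 / l)) \<partial>lborel) = ennreal (ln 2)"
proof -
  have "(\<integral>\<^sup>+l. indicator {0<..} l * (indicator {1..2} (r / l) * ennreal (1 / l)) \<partial>lborel) =
      (\<integral>\<^sup>+l. ennreal (1 / l) * indicator {r / 2..r} l \<partial>lborel)"
    using assms by (intro nn_integral_cong) (auto simp: indicator_def field_simps)
  also have "\<dots> = ennreal (ln r - ln (r / 2))"
    using assms by (intro nn_integral_FTC_Icc) (auto intro!: derivative_eq_intros)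
  also have "ln r - ln (r / 2) = ln 2" using assms by (simp add: ln_div)
  finally show ?thesis .
qed

text \<open>
  The shell plays the role of the unit sphere in polar coordinates. Averaging over its dilates needs
  no surface measure.
\<close>

definition dyadic_shell :: "'a::euclidean_space set" where
  "dyadic_shell = {x. norm x \<in> {1..2}}"

lemma dyadic_shell_sets [measurable]: "dyadic_shell \<in> sets borel"
  unfolding dyadic_shell_def by measurable

text \<open>
  After exchanging the integrals, the dilation \<open>x = l *\<^sub>R \<theta>\<close> turns the inner integral into one over \<open>x\<close>,
  and the remaining integral over \<open>l\<close> has the value \<open>ln 2\<close> for every \<open>x \<noteq> 0\<close>.
\<close>

lemma nn_integral_polar:
  fixes f :: "'a::euclidean_space \<Rightarrow> ennreal"
  assumes f[measurable]: "f \<in> borel_measurable borel"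
  shows "(\<integral>\<^sup>+\<theta>. \<integral>\<^sup>+l. indicator dyadic_shell \<theta> * (indicator {0<..} l *
       ennreal (l ^ DIM('a) / l)) * f (l *\<^sub>R \<theta>) \<partial>lborel \<partial>lborel) = ennreal (ln 2) * (\<integral>\<^sup>+x. f x \<partial>lborel)"
proof -
  have "(\<integral>\<^sup>+\<theta>. \<integral>\<^sup>+l. indicator dyadic_shell \<theta> * (indicator {0<..} l *
       ennreal (l ^ DIM('a) / l)) * f (l *\<^sub>R \<theta>) \<partial>lborel \<partial>lborel) =
     (\<integral>\<^sup>+l. \<integral>\<^sup>+\<theta>. indicator dyadic_shell \<theta> * (indicator {0<..} l *
       ennreal (l ^ DIM('a) / l)) * f (l *\<^sub>R \<theta>) \<partial>lborel \<partial>lborel)"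
    by (subst lborel_pair.Fubini') simp_all
  also have "\<dots> = (\<integral>\<^sup>+l. \<integral>\<^sup>+x. f x * (indicator {0<..} l *
       (indicator {1..2} (norm x / l) * ennreal (1 / l))) \<partial>lborel \<partial>lborel)"
  proof (rule nn_integral_cong)
    fix l :: real
    show "(\<integral>\<^sup>+\<theta>. indicator dyadic_shell \<theta> * (indicator {0<..} l *
       ennreal (l ^ DIM('a) / l)) * f (l *\<^sub>R \<theta>) \<partial>lborel) =
      (\<integral>\<^sup>+x. f x * (indicator {0<..} l * (indicator {1..2} (norm x / l) * ennreal (1 / l))) \<partial>lborel)"
    proof (cases "0 < l")
      case True
      then have "(\<integral>\<^sup>+x. f x * (indicator {0<..} l * (indicator {1..2} (norm x / l) * ennreal (1 / l))) \<partial>lborel)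
        = ennreal (l ^ DIM('a)) * (\<integral>\<^sup>+\<theta>. f (l *\<^sub>R \<theta>) * (indicator {1..2} (norm \<theta>) * ennreal (1 / l)) \<partial>lborel)"
        by (subst nn_integral_lborel_affine[where c=l and t=0]) auto
      also have "\<dots> = (\<integral>\<^sup>+\<theta>. ennreal (l ^ DIM('a)) * (f (l *\<^sub>R \<theta>) * (indicator {1..2} (norm \<theta>) * ennreal (1 / l))) \<partial>lborel)"
        by (subst nn_integral_cmult) auto
      also have "\<dots> = (\<integral>\<^sup>+\<theta>. indicator dyadic_shell \<theta> * (indicator {0<..} l *
          ennreal (l ^ DIM('a) / l)) * f (l *\<^sub>R \<theta>) \<partial>lborel)"
      proof (intro nn_integral_cong)
        fix \<theta> :: 'a
        have "ennreal (l ^ DIM('a) / l) = ennreal (l ^ DIM('a)) * ennreal (1 / l)"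
          using True by (subst ennreal_mult[symmetric]) auto
        then show "ennreal (l ^ DIM('a)) * (f (l *\<^sub>R \<theta>) * (indicator {1..2} (norm \<theta>) * ennreal (1 / l))) =
          indicator dyadic_shell \<theta> * (indicator {0<..} l * ennreal (l ^ DIM('a) / l)) * f (l *\<^sub>R \<theta>)"
          using True by (simp add: dyadic_shell_def indicator_def mult_ac)
      qed
      finally show ?thesis by simp
    qed simp
  qed
  also have "\<dots> = (\<integral>\<^sup>+x. \<integral>\<^sup>+l. f x * (indicator {0<..} l *
       (indicator {1..2} (norm x / l) * ennreal (1 / l))) \<partial>lborel \<partial>lborel)"
    by (subst lborel_pair.Fubini') simp_all
  also have "\<dots> = (\<integral>\<^sup>+x. f x * ennreal (ln 2) \<partial>lborel)"
  proof (rule nn_integral_cong_AE)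
    show "AE x in lborel. (\<integral>\<^sup>+l. f x * (indicator {0<..} l *
       (indicator {1..2} (norm x / l) * ennreal (1 / l))) \<partial>lborel) = f x * ennreal (ln 2)"
      using AE_lborel_singleton[of 0]
      by eventually_elim (simp add: nn_integral_cmult nn_integral_inverse_dyadic)
  qed
  also have "\<dots> = ennreal (ln 2) * (\<integral>\<^sup>+x. f x \<partial>lborel)"
    by (simp add: nn_integral_multc mult.commute)
  finally show ?thesis .
qed

definition polar_weight :: "'a::euclidean_space \<times> real \<Rightarrow> real" where
  "polar_weight = (\<lambda>(\<theta>, l). indicator dyadic_shell \<theta> * (indicator {0<..} l * (l ^ DIM('a) / l)))"

lemma polar_weight_measurable [measurable]: "polar_weight \<in> borel_measurable (lborel \<Otimes>\<^sub>M lborel)"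
  unfolding polar_weight_def by measurable

lemma polar_weight_nonneg: "0 \<le> polar_weight p"
  by (cases p) (auto simp: polar_weight_def indicator_def)

lemma distr_polar:
  "distr (density (lborel \<Otimes>\<^sub>M lborel) (polar_weight :: 'a::euclidean_space \<times> real \<Rightarrow> real)) borel
     (\<lambda>(\<theta>, l). l *\<^sub>R \<theta>) = density lborel (\<lambda>_. ennreal (ln 2))" (is "?A = ?B")
proof (rule measure_eqI)
  fix X :: "'a set" assume "X \<in> sets ?A"
  then have X[measurable]: "X \<in> sets borel" by simp
  have "emeasure ?A X = (\<integral>\<^sup>+x. indicator X x \<partial>?A)" by simp
  also have "\<dots> = (\<integral>\<^sup>+p. ennreal (polar_weight p) * indicator X ((\<lambda>(\<theta>, l). l *\<^sub>R \<theta>) p)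
       \<partial>((lborel :: 'a measure) \<Otimes>\<^sub>M lborel))"
    by (subst nn_integral_distr, measurable) (subst nn_integral_density, auto)
  also have "\<dots> = (\<integral>\<^sup>+\<theta>. \<integral>\<^sup>+l. ennreal (polar_weight (\<theta>, l)) * indicator X (l *\<^sub>R \<theta> :: 'a) \<partial>lborel \<partial>lborel)"
    by (subst lborel.nn_integral_fst[symmetric]) (auto simp: case_prod_beta)
  also have "\<dots> = (\<integral>\<^sup>+\<theta>. \<integral>\<^sup>+l. indicator dyadic_shell \<theta> * (indicator {0<..} l *
       ennreal (l ^ DIM('a) / l)) * indicator X (l *\<^sub>R \<theta> :: 'a) \<partial>lborel \<partial>lborel)"
    by (intro nn_integral_cong) (auto simp: polar_weight_def indicator_def)
  also have "\<dots> = ennreal (ln 2) * (\<integral>\<^sup>+x. indicator X x \<partial>lborel)"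
    by (rule nn_integral_polar) simp
  also have "\<dots> = emeasure ?B X" by (simp add: emeasure_density nn_integral_cmult)
  finally show "emeasure ?A X = emeasure ?B X" .
qed simp

lemma integral_polar:
  fixes f :: "'a::euclidean_space \<Rightarrow> real"
  assumes f: "integrable lborel f"
  shows "integrable (lborel \<Otimes>\<^sub>M lborel) (\<lambda>p. polar_weight p * f (snd p *\<^sub>R fst p))"
    and "ln 2 * (LINT x|lborel. f x) =
      (LINT \<theta>|lborel. LINT l|lborel. polar_weight (\<theta>, l) * f (l *\<^sub>R \<theta>))"
proof -
  have [measurable]: "f \<in> borel_measurable borel" using f by auto
  let ?D = "density (lborel \<Otimes>\<^sub>M lborel) (polar_weight :: 'a \<times> real \<Rightarrow> real)"
  have *: "(\<lambda>(\<theta>, l). l *\<^sub>R \<theta> :: 'a) \<in> borel_measurable ?D" by measurable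
  have "integrable (density lborel (\<lambda>_. ennreal (ln 2))) f"
    using f by (subst integrable_density) auto
  then have "integrable (distr ?D borel (\<lambda>(\<theta>, l). l *\<^sub>R \<theta>)) f" unfolding distr_polar .
  then show i: "integrable (lborel \<Otimes>\<^sub>M lborel) (\<lambda>p. polar_weight p * f (snd p *\<^sub>R fst p))"
    by (subst (asm) integrable_distr_eq[OF *], measurable)
       (subst (asm) integrable_density, auto simp: polar_weight_nonneg case_prod_beta)
  have "ln 2 * (LINT x|lborel. f x) = (LINT x|density lborel (\<lambda>_. ennreal (ln 2)). f x)"
    by (subst integral_density) auto
  also have "\<dots> = (LINT p|(lborel \<Otimes>\<^sub>M lborel). polar_weight p * f (snd p *\<^sub>R fst p))"
    unfolding distr_polar[symmetric]
    by (subst integral_distr[OF *], measurable)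
       (subst integral_density, auto simp: polar_weight_nonneg case_prod_beta)
  also have "\<dots> = (LINT \<theta>|lborel. LINT l|lborel. polar_weight (\<theta>, l) * f (l *\<^sub>R \<theta>))"
    using lborel_pair.integral_fst'[OF i] by simp
  finally show "ln 2 * (LINT x|lborel. f x) =
      (LINT \<theta>|lborel. LINT l|lborel. polar_weight (\<theta>, l) * f (l *\<^sub>R \<theta>))" .
qed

section \<open>The kernel of the fractional Laplacian\<close>

definition frac_kernel :: "real \<Rightarrow> 'a::euclidean_space \<Rightarrow> real" where
  "frac_kernel s h = 1 / norm h powr (real DIM('a) + 2 * s)"

lemma frac_kernel_nonneg [simp]: "0 \<le> frac_kernel s h"
  by (simp add: frac_kernel_def)

lemma frac_kernel_measurable [measurable]: "frac_kernel s \<in> borel_measurable borel"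
  unfolding frac_kernel_def[abs_def] by measurable

lemma frac_kernel_minus [simp]: "frac_kernel s (- h) = frac_kernel s h"
  by (simp add: frac_kernel_def)

lemma frac_kernel_le:
  fixes h k :: "'a::euclidean_space"
  assumes "0 \<le> s" "norm h \<le> c * norm k" "h \<noteq> 0" "0 < c"
  shows "frac_kernel s k \<le> c powr (real DIM('a) + 2 * s) * frac_kernel s h"
proof -
  have k: "0 < norm k" using assms zero_less_norm_iff[of h]
    by (metis less_le_trans mult_zero_right norm_ge_zero order_le_less)
  have "norm h powr (real DIM('a) + 2 * s) \<le> (c * norm k) powr (real DIM('a) + 2 * s)"
    using assms by (intro powr_mono2) auto
  also have "\<dots> = c powr (real DIM('a) + 2 * s) * norm k powr (real DIM('a) + 2 * s)"
    using assms by (simp add: powr_mult)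
  finally show ?thesis using k assms(3) by (simp add: frac_kernel_def field_simps)
qed

text \<open>
  Along every ray the \<open>N\<close>-dimensional kernel becomes the one-dimensional kernel.
\<close>

lemma polar_weight_kernel:
  "polar_weight (\<theta>, l) * frac_kernel s (l *\<^sub>R (\<theta> :: 'a::euclidean_space)) =
     indicator dyadic_shell \<theta> * frac_kernel s \<theta> * (indicator {0<..} l * l powr (- 1 - 2 * s))"
proof (cases "0 < l")
  case True
  define P where "P = l powr (real DIM('a) + 2 * s)"
  have P: "0 < P" using True by (simp add: P_def)
  have "l powr (- 1 - 2 * s) * P = l powr (real DIM('a) - 1)"
    unfolding P_def by (simp add: powr_add[symmetric])
  also have "\<dots> = l ^ DIM('a) / l" using True by (simp add: powr_diff powr_realpow)
  finally have 1: "l ^ DIM('a) / l = l powr (- 1 - 2 * s) * P" by simp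
  have "frac_kernel s (l *\<^sub>R \<theta>) = frac_kernel s \<theta> / P"
    using True by (simp add: frac_kernel_def powr_mult P_def mult.commute)
  then have "polar_weight (\<theta>, l) * frac_kernel s (l *\<^sub>R \<theta>)
      = indicator dyadic_shell \<theta> * (l powr (- 1 - 2 * s) * P) * (frac_kernel s \<theta> / P)"
    unfolding polar_weight_def prod.case 1 using True by simp
  then show ?thesis using True P by simp
qed (simp add: polar_weight_def)

lemma kernel_shell_le_1: "0 \<le> s \<Longrightarrow> \<theta> \<in> dyadic_shell \<Longrightarrow> frac_kernel s \<theta> \<le> 1"
  by (auto simp: frac_kernel_def dyadic_shell_def ge_one_powr_ge_zero divide_le_eq_1)

lemma emeasure_dyadic_shell: "emeasure lborel (dyadic_shell :: 'a::euclidean_space set) < \<infinity>"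
proof -
  have "emeasure lborel (dyadic_shell :: 'a set) \<le> emeasure lborel (cball (0::'a) 2)"
    by (rule emeasure_mono) (auto simp: dyadic_shell_def)
  also have "\<dots> < \<infinity>" by (rule emeasure_lborel_cball_finite)
  finally show ?thesis .
qed

lemma has_integral_indicator_mult:
  fixes f :: "real \<Rightarrow> real"
  shows "((\<lambda>x. indicator S x * f x) has_integral I) UNIV \<longleftrightarrow> (f has_integral I) S"
proof -
  have "(\<lambda>x. indicator S x * f x) = (\<lambda>x. if x \<in> S then f x else 0)" by (auto simp: indicator_def)
  then show ?thesis by (simp only: has_integral_restrict_UNIV)
qed

lemma nn_integral_min_powr_finite:
  fixes s :: real
  assumes "0 < s" "s < 1"
  shows "(\<integral>\<^sup>+l. ennreal (indicator {0<..} l * l powr (- 1 - 2 * s) * min (l\<^sup>2) 1) \<partial>lborel) < \<infinity>"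
proof -
  have "(\<integral>\<^sup>+l. ennreal (indicator {0<..} l * l powr (- 1 - 2 * s) * min (l\<^sup>2) 1) \<partial>lborel)
     \<le> (\<integral>\<^sup>+l. ennreal (indicator {0..1} l * l powr (1 - 2 * s)) + ennreal (indicator {1..} l * l powr (- 1 - 2 * s)) \<partial>lborel)"
  proof (rule nn_integral_mono)
    fix l :: real
    consider "l \<le> 0" | "0 < l" "l \<le> 1" | "1 < l" by linarith
    then show "ennreal (indicator {0<..} l * l powr (- 1 - 2 * s) * min (l\<^sup>2) 1)
       \<le> ennreal (indicator {0..1} l * l powr (1 - 2 * s)) + ennreal (indicator {1..} l * l powr (- 1 - 2 * s))"
    proof cases
      case 2
      have "l powr (- 1 - 2 * s) * min (l\<^sup>2) 1 \<le> l powr (- 1 - 2 * s) * l powr 2"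
        using 2 by (intro mult_left_mono) (auto simp: powr_numeral)
      also have "\<dots> = l powr (1 - 2 * s)" by (simp add: powr_add[symmetric])
      finally show ?thesis using 2 by (auto simp: indicator_def intro!: ennreal_leI order_trans[OF _ le_add_same_cancel1[THEN iffD2]])
    next
      case 3
      have "l powr (- 1 - 2 * s) * min (l\<^sup>2) 1 \<le> l powr (- 1 - 2 * s) * 1"
        by (intro mult_left_mono) auto
      then show ?thesis using 3 by (auto simp: indicator_def intro!: ennreal_leI)
    qed auto
  qed
  also have "\<dots> = (\<integral>\<^sup>+l. ennreal (indicator {0..1} l * l powr (1 - 2 * s)) \<partial>lborel)
     + (\<integral>\<^sup>+l. ennreal (indicator {1..} l * l powr (- 1 - 2 * s)) \<partial>lborel)"
    by (rule nn_integral_add) auto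
  also have "(\<integral>\<^sup>+l. ennreal (indicator {0..1} l * l powr (1 - 2 * s)) \<partial>lborel)
      = ennreal (1 powr ((1 - 2 * s) + 1) / ((1 - 2 * s) + 1))"
  proof (rule nn_integral_has_integral_lborel)
    have "((\<lambda>l. l powr (1 - 2 * s)) has_integral (1 powr ((1 - 2 * s) + 1) / ((1 - 2 * s) + 1))) {0..1}"
      using has_integral_powr_from_0[of "1 - 2 * s" 1] assms by simp
    then show "((\<lambda>l. indicator {0..1} l * l powr (1 - 2 * s)) has_integral
        (1 powr ((1 - 2 * s) + 1) / ((1 - 2 * s) + 1))) UNIV"
      unfolding has_integral_indicator_mult .
  qed auto
  also have "(\<integral>\<^sup>+l. ennreal (indicator {1..} l * l powr (- 1 - 2 * s)) \<partial>lborel)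
      = ennreal (- (1 powr ((- 1 - 2 * s) + 1)) / ((- 1 - 2 * s) + 1))"
  proof (rule nn_integral_has_integral_lborel)
    have "((\<lambda>l. l powr (- 1 - 2 * s)) has_integral
        (- (1 powr ((- 1 - 2 * s) + 1)) / ((- 1 - 2 * s) + 1))) {1..}"
      using has_integral_powr_to_inf[of "- 1 - 2 * s" 1] assms by simp
    then show "((\<lambda>l. indicator {1..} l * l powr (- 1 - 2 * s)) has_integral
        (- (1 powr ((- 1 - 2 * s) + 1)) / ((- 1 - 2 * s) + 1))) UNIV"
      unfolding has_integral_indicator_mult .
  qed auto
  finally show ?thesis by (rule le_less_trans) simp
qed

lemma kernel_min_integrable:
  assumes s: "0 < s" "s < 1"
  shows "integrable lborel (\<lambda>h::'a::euclidean_space. min ((norm h)\<^sup>2) 1 * frac_kernel s h)"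
proof (rule integrableI_nonneg)
  let ?w = "\<lambda>l. indicator {0<..} l * l powr (- 1 - 2 * s) * min (l\<^sup>2) 1"
  have "ennreal (ln 2) * (\<integral>\<^sup>+(h::'a). ennreal (min ((norm h)\<^sup>2) 1 * frac_kernel s h) \<partial>lborel) =
    (\<integral>\<^sup>+(\<theta>::'a). \<integral>\<^sup>+l. indicator dyadic_shell \<theta> * (indicator {0<..} l *
       ennreal (l ^ DIM('a) / l)) * ennreal (min ((norm (l *\<^sub>R \<theta>))\<^sup>2) 1 * frac_kernel s (l *\<^sub>R \<theta>)) \<partial>lborel \<partial>lborel)"
    by (rule nn_integral_polar[symmetric]) measurable
  also have "\<dots> \<le> (\<integral>\<^sup>+(\<theta>::'a). \<integral>\<^sup>+l. 4 * indicator dyadic_shell \<theta> * ennreal (?w l) \<partial>lborel \<partial>lborel)"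
  proof (intro nn_integral_mono)
    fix \<theta> :: 'a and l :: real
    show "indicator dyadic_shell \<theta> * (indicator {0<..} l *
       ennreal (l ^ DIM('a) / l)) * ennreal (min ((norm (l *\<^sub>R \<theta>))\<^sup>2) 1 * frac_kernel s (l *\<^sub>R \<theta>))
       \<le> 4 * indicator dyadic_shell \<theta> * ennreal (?w l)"
    proof (cases "\<theta> \<in> dyadic_shell \<and> 0 < l")
      case True
      have n: "1 \<le> norm \<theta>" "norm \<theta> \<le> 2" using True by (auto simp: dyadic_shell_def)
      have "min ((norm (l *\<^sub>R \<theta>))\<^sup>2) 1 \<le> 4 * min (l\<^sup>2) 1"
      proof -
        have "(norm \<theta>)\<^sup>2 \<le> 2\<^sup>2" using n by (intro power_mono) auto
        then have "l\<^sup>2 * (norm \<theta>)\<^sup>2 \<le> l\<^sup>2 * 4" by (intro mult_left_mono) auto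
        then show ?thesis by (auto simp: power_mult_distrib min_def)
      qed
      then have "min ((norm (l *\<^sub>R \<theta>))\<^sup>2) 1 * (frac_kernel s \<theta> * l powr (- 1 - 2 * s)) \<le>
          (4 * min (l\<^sup>2) 1) * (1 * l powr (- 1 - 2 * s))"
        using kernel_shell_le_1[of s \<theta>] True s by (intro mult_mono mult_right_mono) auto
      moreover have "l ^ DIM('a) / l * frac_kernel s (l *\<^sub>R \<theta>) = frac_kernel s \<theta> * l powr (- 1 - 2 * s)"
        using polar_weight_kernel[of \<theta> l s] True by (simp add: polar_weight_def)
      moreover have "l ^ DIM('a) / l * (min ((norm (l *\<^sub>R \<theta>))\<^sup>2) 1 * frac_kernel s (l *\<^sub>R \<theta>)) =
          min ((norm (l *\<^sub>R \<theta>))\<^sup>2) 1 * (l ^ DIM('a) / l * frac_kernel s (l *\<^sub>R \<theta>))" by simp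
      moreover have "(4 * min (l\<^sup>2) 1) * (1 * l powr (- 1 - 2 * s)) = 4 * ?w l" using True by simp
      ultimately have "l ^ DIM('a) / l * (min ((norm (l *\<^sub>R \<theta>))\<^sup>2) 1 * frac_kernel s (l *\<^sub>R \<theta>)) \<le> 4 * ?w l"
        by (simp only:)
      then show ?thesis using True
        by (simp add: ennreal_mult'[symmetric] ennreal_leI flip: ennreal_numeral)
    qed auto
  qed
  also have "\<dots> = (\<integral>\<^sup>+(\<theta>::'a). 4 * indicator dyadic_shell \<theta> * (\<integral>\<^sup>+l. ennreal (?w l) \<partial>lborel) \<partial>lborel)"
    by (intro nn_integral_cong nn_integral_cmult) measurable
  also have "\<dots> = (\<integral>\<^sup>+l. ennreal (?w l) \<partial>lborel) * (4 * emeasure lborel (dyadic_shell :: 'a set))"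
    by (simp add: nn_integral_multc nn_integral_cmult mult.commute)
  also have "\<dots> < \<infinity>"
    using nn_integral_min_powr_finite[OF s] emeasure_dyadic_shell[where 'a='a]
    by (simp add: ennreal_mult_less_top)
  finally show "(\<integral>\<^sup>+(h::'a). ennreal (min ((norm h)\<^sup>2) 1 * frac_kernel s h) \<partial>lborel) < \<infinity>"
    by (auto simp: ennreal_mult_less_top)
qed auto

text \<open>
  The form in which integrability of the kernel away from the origin is used: truncated second
  differences of bounded functions.
\<close>

lemma integrable_kernel_away:
  fixes g :: "'a::euclidean_space \<Rightarrow> real"
  assumes s: "0 < s" "s < 1" and e: "0 < e" and [measurable]: "g \<in> borel_measurable borel"
    and C: "\<And>h. \<bar>g h\<bar> \<le> C" and z: "\<And>h. norm h < e \<Longrightarrow> g h = 0"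
  shows "integrable lborel (\<lambda>h. g h * frac_kernel s h)"
proof (rule Bochner_Integration.integrable_bound)
  let ?m = "min (e\<^sup>2) 1"
  have m: "0 < ?m" using e by simp
  show "integrable lborel (\<lambda>h::'a. C / ?m * (min ((norm h)\<^sup>2) 1 * frac_kernel s h))"
    by (intro integrable_mult_right kernel_min_integrable s)
  show "AE h in lborel. norm (g h * frac_kernel s h) \<le> norm (C / ?m * (min ((norm h)\<^sup>2) 1 * frac_kernel s h))"
  proof (rule AE_I2)
    fix h :: 'a
    have C0: "0 \<le> C" using C[of 0] by linarith
    have "\<bar>g h\<bar> \<le> C / ?m * min ((norm h)\<^sup>2) 1"
    proof (cases "norm h < e")
      case False
      then have "e\<^sup>2 \<le> (norm h)\<^sup>2" using e by (intro power_mono) auto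
      then have "?m \<le> min ((norm h)\<^sup>2) 1" by auto
      then have "C / ?m * ?m \<le> C / ?m * min ((norm h)\<^sup>2) 1"
        using C0 m by (intro mult_left_mono) auto
      then show ?thesis using C[of h] m by simp
    qed (use z m C0 in auto)
    then have "\<bar>g h\<bar> * frac_kernel s h \<le> C / ?m * min ((norm h)\<^sup>2) 1 * frac_kernel s h"
      by (rule mult_right_mono) simp
    moreover have "0 \<le> C / ?m * min ((norm h)\<^sup>2) 1" using C0 m by auto
    ultimately show "norm (g h * frac_kernel s h) \<le> norm (C / ?m * (min ((norm h)\<^sup>2) 1 * frac_kernel s h))"
      using C0 by (simp add: abs_mult mult.assoc)
  qed
qed measurable

definition gagliardo_shift_energy :: "real \<Rightarrow> ('a::euclidean_space \<Rightarrow> real) \<Rightarrow> ennreal" where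
  "gagliardo_shift_energy s u =
     (\<integral>\<^sup>+x. \<integral>\<^sup>+h. ennreal ((u x - u (x + h))\<^sup>2 * frac_kernel s h) \<partial>lborel \<partial>lborel)"

lemma gagliardo_energy_eq_shift:
  fixes u :: "'a::euclidean_space \<Rightarrow> real"
  assumes [measurable]: "u \<in> borel_measurable borel"
  shows "gagliardo_energy s u = gagliardo_shift_energy s u"
proof -
  have "gagliardo_energy s u =
     (\<integral>\<^sup>+x. \<integral>\<^sup>+y. ennreal ((u x - u y)\<^sup>2 * frac_kernel s (x - y)) \<partial>lborel \<partial>lborel)"
    unfolding gagliardo_energy_def nn_integral_completion by (simp add: frac_kernel_def)
  also have "\<dots> = gagliardo_shift_energy s u"
    unfolding gagliardo_shift_energy_def
  proof (rule nn_integral_cong)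
    fix x :: 'a
    show "(\<integral>\<^sup>+y. ennreal ((u x - u y)\<^sup>2 * frac_kernel s (x - y)) \<partial>lborel) =
      (\<integral>\<^sup>+h. ennreal ((u x - u (x + h))\<^sup>2 * frac_kernel s h) \<partial>lborel)"
      by (subst nn_integral_lborel_affine[where c=1 and t=x]) auto
  qed
  finally show ?thesis .
qed

lemma gagliardo_energy_lipschitz_finite:
  fixes f :: "'a::euclidean_space \<Rightarrow> real"
  assumes s: "0 < s" "s < 1" and lip: "\<And>x y. \<bar>f x - f y\<bar> \<le> L * norm (x - y)"
    and bd: "\<And>x. \<bar>f x\<bar> \<le> B" and supp: "\<And>x. x \<notin> cball a r \<Longrightarrow> f x = 0"
    and [measurable]: "f \<in> borel_measurable borel"
  shows "gagliardo_energy s f < \<infinity>"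
proof -
  \<comment> \<open>Lipschitz continuity controls small shifts, boundedness the large ones.\<close>
  define M where "M = max (L\<^sup>2) (4 * B\<^sup>2)"
  have M0: "0 \<le> M" by (simp add: M_def le_max_iff_disj)
  define I where "I = (indicator (cball a r) :: 'a \<Rightarrow> real)"
  have [measurable]: "I \<in> borel_measurable borel" unfolding I_def
    by (intro borel_measurable_indicator) simp
  define J where "J = (indicator (cball a r) :: 'a \<Rightarrow> ennreal)"
  have [measurable]: "J \<in> borel_measurable borel" unfolding J_def
    by (intro borel_measurable_indicator) simp
  let ?m = "\<lambda>h::'a. min ((norm h)\<^sup>2) 1 * frac_kernel s h"
  have le: "(f x - f (x + h))\<^sup>2 * frac_kernel s h \<le> M * ((I x + I (x + h)) * ?m h)" for x h
  proof -
    have 1: "(f x - f (x + h))\<^sup>2 \<le> L\<^sup>2 * (norm h)\<^sup>2"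
      using power_mono[OF lip[of x "x + h"], of 2] by (simp add: power_mult_distrib)
    have 2: "(f x - f (x + h))\<^sup>2 \<le> 4 * B\<^sup>2"
    proof -
      have "\<bar>f x - f (x + h)\<bar> \<le> 2 * B" using bd[of x] bd[of "x + h"] by linarith
      from power_mono[OF this, of 2] show ?thesis by (simp add: power_mult_distrib)
    qed
    have 3: "(f x - f (x + h))\<^sup>2 \<le> M * min ((norm h)\<^sup>2) 1"
    proof -
      have "L\<^sup>2 * (norm h)\<^sup>2 \<le> M * (norm h)\<^sup>2" by (intro mult_right_mono) (auto simp: M_def)
      moreover have "4 * B\<^sup>2 \<le> M * 1" by (simp add: M_def)
      ultimately show ?thesis using 1 2 by (auto simp: min_def)
    qed
    have "(f x - f (x + h))\<^sup>2 \<le> (I x + I (x + h)) * (M * min ((norm h)\<^sup>2) 1)"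
    proof (cases "x \<in> cball a r \<or> x + h \<in> cball a r")
      case True
      have "1 * (M * min ((norm h)\<^sup>2) 1) \<le> (I x + I (x + h)) * (M * min ((norm h)\<^sup>2) 1)"
        using True M0 by (intro mult_right_mono) (auto simp: I_def indicator_def)
      then show ?thesis using 3 by simp
    qed (use supp in \<open>auto simp: I_def\<close>)
    from mult_right_mono[OF this, of "frac_kernel s h"] show ?thesis by (simp add: mult_ac)
  qed
  have "gagliardo_energy s f \<le> (\<integral>\<^sup>+x. \<integral>\<^sup>+h. ennreal (M * ((I x + I (x + h)) * ?m h)) \<partial>lborel \<partial>lborel)"
    unfolding gagliardo_energy_eq_shift[OF assms(6)] gagliardo_shift_energy_def
    using le by (intro nn_integral_mono ennreal_leI)
  also have "\<dots> = (\<integral>\<^sup>+h. \<integral>\<^sup>+x. ennreal (M * ((I x + I (x + h)) * ?m h)) \<partial>lborel \<partial>lborel)"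
    by (subst lborel_pair.Fubini') simp_all
  also have "\<dots> = (\<integral>\<^sup>+h. ennreal (M * ?m h) * (2 * emeasure lborel (cball a r)) \<partial>lborel)"
  proof (rule nn_integral_cong)
    fix h :: 'a
    have "(\<integral>\<^sup>+x. ennreal (M * ((I x + I (x + h)) * ?m h)) \<partial>lborel) =
      (\<integral>\<^sup>+x. ennreal (M * ?m h) * (J x + J (h + 1 *\<^sub>R x)) \<partial>lborel)"
    proof (rule nn_integral_cong)
      fix x
      have "ennreal (M * ((I x + I (x + h)) * ?m h)) = ennreal (M * ?m h) * ennreal (I x + I (x + h))"
        using M0 by (subst ennreal_mult[symmetric]) (auto simp: mult_ac I_def)
      also have "ennreal (I x + I (x + h)) = J x + J (h + 1 *\<^sub>R x)"
        by (auto simp: I_def J_def indicator_def add.commute)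
      finally show "ennreal (M * ((I x + I (x + h)) * ?m h)) =
        ennreal (M * ?m h) * (J x + J (h + 1 *\<^sub>R x))" .
    qed
    also have "\<dots> = ennreal (M * ?m h) * ((\<integral>\<^sup>+x. J x \<partial>lborel) + (\<integral>\<^sup>+x. J (h + 1 *\<^sub>R x) \<partial>lborel))"
      by (subst nn_integral_cmult, measurable) (subst nn_integral_add, auto)
    also have "(\<integral>\<^sup>+x. J (h + 1 *\<^sub>R x) \<partial>lborel) = (\<integral>\<^sup>+x. J x \<partial>lborel)"
      by (subst (2) nn_integral_lborel_affine[where c=1 and t=h]) auto
    finally show "(\<integral>\<^sup>+x. ennreal (M * ((I x + I (x + h)) * ?m h)) \<partial>lborel) =
      ennreal (M * ?m h) * (2 * emeasure lborel (cball a r))"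
      by (simp add: mult_2 J_def)
  qed
  also have "\<dots> = (\<integral>\<^sup>+h. ennreal (M * ?m h) \<partial>lborel) * (2 * emeasure lborel (cball a r))"
    by (rule nn_integral_multc) measurable
  also have "(\<integral>\<^sup>+h. ennreal (M * ?m h) \<partial>lborel) = ennreal (LINT h|lborel. M * ?m h)"
    using M0 by (intro nn_integral_eq_integral integrable_mult_right kernel_min_integrable s) auto
  finally show ?thesis
    by (rule le_less_trans) (use emeasure_lborel_cball_finite[of a r] in \<open>auto simp: ennreal_mult_less_top\<close>)
qed

section \<open>The barrier on a ball\<close>

text \<open>
  Up to a factor, the solution of \<open>(-\<Delta>)\<^sup>s \<psi> = 1\<close> in the ball, extended by zero. It behaves like
  the distance to the boundary to the power \<open>s\<close>, the rate in the Hopf lemma.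
\<close>

definition ball_profile :: "real \<Rightarrow> 'a::euclidean_space \<Rightarrow> real \<Rightarrow> 'a \<Rightarrow> real" where
  "ball_profile s z r y = (max 0 (r\<^sup>2 - (norm (y - z))\<^sup>2)) powr s"

lemma ball_profile_nonneg [simp]: "0 \<le> ball_profile s z r y"
  by (simp add: ball_profile_def)

lemma ball_profile_continuous: "0 < s \<Longrightarrow> continuous_on A (ball_profile s z r)"
  unfolding ball_profile_def[abs_def] by (auto intro!: continuous_intros continuous_on_powr')

lemma ball_profile_measurable [measurable]: "ball_profile s z r \<in> borel_measurable borel"
  unfolding ball_profile_def[abs_def] by measurable

lemma ball_profile_le: "0 < s \<Longrightarrow> ball_profile s z r y \<le> (r\<^sup>2) powr s"
  unfolding ball_profile_def by (intro powr_mono2) auto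

lemma ball_profile_outside: "0 < s \<Longrightarrow> 0 \<le> r \<Longrightarrow> y \<notin> ball z r \<Longrightarrow> ball_profile s z r y = 0"
  unfolding ball_profile_def
  by (auto simp: dist_norm norm_minus_commute not_less max_def intro!: power_mono)

text \<open>
  On a line through \<open>x\<close> the quadratic \<open>r\<^sup>2 - (norm (y - z))\<^sup>2\<close> has two real roots, at distances \<open>a\<close> and \<open>b\<close> from
  \<open>x\<close> in units of \<open>norm \<theta>\<close>. The second difference does not see the orientation of the line, so
  \<open>a \<le> b\<close> can be arranged.
\<close>

lemma ball_profile_on_line:
  fixes x z \<theta> :: "'a::euclidean_space"
  assumes x: "norm (x - z) < r" and th: "1 \<le> norm \<theta>" "norm \<theta> \<le> 2"
  obtains a b where "(r - norm (x - z)) / 2 \<le> a" "a \<le> b" "b \<le> 2 * r"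
    and "\<And>l s. 0 < s \<Longrightarrow> 2 * ball_profile s z r x - ball_profile s z r (x + l *\<^sub>R \<theta>) - ball_profile s z r (x - l *\<^sub>R \<theta>) =
      norm \<theta> powr (2 * s) * (2 * (a * b) powr s - (max 0 ((a + l) * (b - l))) powr s - (max 0 ((a - l) * (b + l))) powr s)"
proof -
  define T where "T = (norm \<theta>)\<^sup>2"
  define A where "A = r\<^sup>2 - (norm (x - z))\<^sup>2"
  define B where "B = (x - z) \<bullet> \<theta>"
  define D where "D = sqrt (B\<^sup>2 + T * A)"
  have T: "0 < T" using th by (auto simp: T_def)
  have A: "0 < A" using x power_strict_mono[OF x, of 2] by (simp add: A_def)
  have D2: "D\<^sup>2 = B\<^sup>2 + T * A" unfolding D_def using T A by simp
  have DB: "\<bar>B\<bar> < D" unfolding D_def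
    using T A real_sqrt_less_mono[of "B\<^sup>2" "B\<^sup>2 + T * A"] by simp
  define p q where "p = (B + D) / T" and "q = (D - B) / T"
  have pq: "0 < p" "0 < q" using DB T by (auto simp: p_def q_def)
  have line: "r\<^sup>2 - (norm (x + l *\<^sub>R \<theta> - z))\<^sup>2 = T * ((p + l) * (q - l))" for l
  proof -
    have "(norm (x + l *\<^sub>R \<theta> - z))\<^sup>2 = (norm ((x - z) + l *\<^sub>R \<theta>))\<^sup>2" by (simp add: algebra_simps)
    also have "\<dots> = (norm (x - z))\<^sup>2 + 2 * l * B + l\<^sup>2 * T"
      unfolding T_def B_def power2_norm_eq_inner
      by (simp add: inner_add_left inner_add_right inner_commute power2_eq_square algebra_simps)
    finally have 1: "r\<^sup>2 - (norm (x + l *\<^sub>R \<theta> - z))\<^sup>2 = A - 2 * l * B - l\<^sup>2 * T" by (simp add: A_def)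
    have "T * p = B + D" "T * q = D - B" using T by (auto simp: p_def q_def)
    then have "T * (T * ((p + l) * (q - l))) = (B + D + T * l) * (D - B - T * l)"
      by (metis (no_types, opaque_lifting) distrib_left right_diff_distrib mult.assoc mult.left_commute)
    also have "\<dots> = D\<^sup>2 - B\<^sup>2 - 2 * B * (T * l) - (T * l)\<^sup>2"
      by (simp add: power2_eq_square algebra_simps)
    also have "\<dots> = T * (A - 2 * l * B - l\<^sup>2 * T)"
      unfolding D2 by (simp add: power2_eq_square algebra_simps)
    finally show ?thesis using T 1 by simp
  qed
  have prof: "ball_profile s z r (x + l *\<^sub>R \<theta>) = norm \<theta> powr (2 * s) * (max 0 ((p + l) * (q - l))) powr s"
    if "0 < s" for l s
  proof -
    have "max 0 (T * ((p + l) * (q - l))) = T * max 0 ((p + l) * (q - l))"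
      using T by (auto simp: max_def zero_le_mult_iff)
    moreover have "T powr s = norm \<theta> powr (2 * s)"
      unfolding T_def using th by (simp add: powr_powr[symmetric] powr_numeral)
    ultimately show ?thesis
      unfolding ball_profile_def line using T by (simp add: powr_mult)
  qed
  have edge: "(r - norm (x - z)) / 2 \<le> \<bar>l\<bar> \<and> \<bar>l\<bar> \<le> 2 * r" if "(p + l) * (q - l) = 0" for l
  proof -
    have r: "0 < r" using x norm_ge_zero[of "x - z"] by linarith
    have "(norm (x + l *\<^sub>R \<theta> - z))\<^sup>2 = r\<^sup>2" using line[of l] that by simp
    then have n: "norm (x + l *\<^sub>R \<theta> - z) = r" using r by (simp add: power2_eq_iff_nonneg)
    have "r \<le> norm (x - z) + norm (l *\<^sub>R \<theta>)"
      using norm_triangle_ineq[of "x - z" "l *\<^sub>R \<theta>"] n by (simp add: algebra_simps)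
    moreover have "norm (l *\<^sub>R \<theta>) \<le> \<bar>l\<bar> * 2" using th by (auto intro: mult_left_mono)
    moreover have "norm (l *\<^sub>R \<theta>) \<le> r + norm (x - z)"
      using norm_triangle_ineq4[of "x + l *\<^sub>R \<theta> - z" "x - z"] n by simp
    moreover have "\<bar>l\<bar> * 1 \<le> norm (l *\<^sub>R \<theta>)" using th by (simp add: mult_left_mono del: mult_1_right)
    ultimately show ?thesis using x by auto
  qed
  have e: "(r - norm (x - z)) / 2 \<le> p" "p \<le> 2 * r" "(r - norm (x - z)) / 2 \<le> q" "q \<le> 2 * r"
    using edge[of "- p"] edge[of q] pq by auto
  have diff: "2 * ball_profile s z r x - ball_profile s z r (x + l *\<^sub>R \<theta>) - ball_profile s z r (x - l *\<^sub>R \<theta>) =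
      norm \<theta> powr (2 * s) * (2 * (p * q) powr s - (max 0 ((p + l) * (q - l))) powr s - (max 0 ((p - l) * (q + l))) powr s)"
    if "0 < s" for l s
    using prof[OF that, of 0] prof[OF that, of l] prof[OF that, of "- l"] pq
    by (simp add: right_diff_distrib)
  show thesis
  proof (cases "p \<le> q")
    case True
    show ?thesis
      by (rule that[of p q]) (use True e diff in auto)
  next
    case False
    have "2 * ball_profile s z r x - ball_profile s z r (x + l *\<^sub>R \<theta>) - ball_profile s z r (x - l *\<^sub>R \<theta>) =
      norm \<theta> powr (2 * s) * (2 * (q * p) powr s - (max 0 ((q + l) * (p - l))) powr s - (max 0 ((q - l) * (p + l))) powr s)"
      if "0 < s" for l s
      unfolding diff[OF that] by (simp add: mult.commute)
    then show ?thesis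
      by (intro that[of q p]) (use False e in auto)
  qed
qed

text \<open>
  By integration along rays the operator in dimension \<open>N\<close> is an average of one-dimensional ones, and
  on each line \<open>interval_integral_le\<close> applies with the distances \<open>a\<close>, \<open>b\<close> of the previous lemma.
\<close>

lemma ball_profile_truncated_operator_le:
  fixes x z :: "'a::euclidean_space"
  assumes s: "0 < s" "s < 1" and x: "norm (x - z) < r" and e: "0 < e" "e \<le> (r - norm (x - z)) / 4"
  defines "d \<equiv> r - norm (x - z)"
  defines "F \<equiv> \<lambda>h. indicator {h. e \<le> norm h} h *
    (2 * ball_profile s z r x - ball_profile s z r (x + h) - ball_profile s z r (x - h))"
  shows "integrable lborel (\<lambda>h. F h * frac_kernel s h)"
    and "(LINT h|lborel. F h * frac_kernel s h) \<le> measure lborel (dyadic_shell :: 'a set) / ln 2 *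
      (interval_const s + (4 * r / d) powr s * ((2 * e / d) powr (2 - 2 * s) / (2 * s)))"
proof -
  have d: "0 < d" "e \<le> d / 4" "d \<le> r" using x e by (auto simp: d_def)
  have [measurable]: "{h::'a. e \<le> norm h} \<in> sets borel" by measurable
  have Fm [measurable]: "F \<in> borel_measurable borel" unfolding F_def by measurable
  show int: "integrable lborel (\<lambda>h. F h * frac_kernel s h)"
  proof (rule integrable_kernel_away[OF s e(1) Fm])
    fix h
    show "\<bar>F h\<bar> \<le> 4 * (r\<^sup>2) powr s"
      using ball_profile_le[OF s(1), of z r x] ball_profile_le[OF s(1), of z r "x + h"]
        ball_profile_le[OF s(1), of z r "x - h"] ball_profile_nonneg[of s z r x]
        ball_profile_nonneg[of s z r "x + h"] ball_profile_nonneg[of s z r "x - h"]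
      unfolding F_def indicator_def by (auto simp del: ball_profile_nonneg)
  qed (auto simp: F_def)
  define Bd where "Bd = interval_const s + (4 * r / d) powr s * ((2 * e / d) powr (2 - 2 * s) / (2 * s))"
  have Bd: "0 \<le> Bd" using s by (auto simp: Bd_def interval_const_def intro!: add_nonneg_nonneg)
  note pol = integral_polar[OF int]
  have inner: "(LINT l|lborel. polar_weight (\<theta>, l) * (F (l *\<^sub>R \<theta>) * frac_kernel s (l *\<^sub>R \<theta>))) \<le> indicator dyadic_shell \<theta> * Bd" for \<theta>
  proof (cases "\<theta> \<in> dyadic_shell")
    case True
    then have th: "1 \<le> norm \<theta>" "norm \<theta> \<le> 2" by (auto simp: dyadic_shell_def)
    obtain a b where ab: "d / 2 \<le> a" "a \<le> b" "b \<le> 2 * r" and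
      diff: "\<And>l s. 0 < s \<Longrightarrow> 2 * ball_profile s z r x - ball_profile s z r (x + l *\<^sub>R \<theta>) - ball_profile s z r (x - l *\<^sub>R \<theta>) =
        norm \<theta> powr (2 * s) * (2 * (a * b) powr s - (max 0 ((a + l) * (b - l))) powr s - (max 0 ((a - l) * (b + l))) powr s)"
      using ball_profile_on_line[OF x th] unfolding d_def by metis
    define f where "f = (\<lambda>t. (2 * (a * b) powr s - (max 0 ((a + t) * (b - t))) powr s
        - (max 0 ((a - t) * (b + t))) powr s) * t powr (- 1 - 2 * s))"
    define e' where "e' = e / norm \<theta>"
    have np: "0 < norm \<theta>" using th by linarith
    have "e / norm \<theta> \<le> e / 1" using th e by (intro divide_left_mono) auto
    then have e': "0 < e'" "e' \<le> e" using np e by (simp_all add: e'_def del: zero_less_norm_iff)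
    then have e2: "e' \<le> a / 2" using ab d by linarith
    have a0: "0 < a" using ab d by linarith
    note iv = interval_integral_le[OF s a0 ab(2) e'(1) e2, folded f_def]
    have [measurable]: "f \<in> borel_measurable borel" unfolding f_def by measurable
    have "(LINT l|lborel. indicator {e'..} l * f l) = (LINT l|lebesgue. indicator {e'..} l * f l)"
      by (rule integral_completion[symmetric]) measurable
    also have "\<dots> = integral {e'..} f"
      using set_lebesgue_integral_eq_integral(2)[OF iv(1)] by (simp add: set_lebesgue_integral_def)
    also have "\<dots> \<le> interval_const s + (b / a) powr s * ((e' / a) powr (2 - 2 * s) / (2 * s))"
      by (rule iv(2))
    also have "\<dots> \<le> Bd"
    proof -
      have "b / a \<le> (2 * r) / (d / 2)" using ab d by (intro frac_le) auto
      moreover have "e' / a \<le> e / (d / 2)" using ab d e' by (intro frac_le) auto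
      ultimately show ?thesis
        unfolding Bd_def using s a0 ab e'
        by (intro add_left_mono mult_mono divide_right_mono powr_mono2) (auto simp: mult.commute)
    qed
    finally have L: "(LINT l|lborel. indicator {e'..} l * f l) \<le> Bd" .
    have "polar_weight (\<theta>, l) * (F (l *\<^sub>R \<theta>) * frac_kernel s (l *\<^sub>R \<theta>)) =
        frac_kernel s \<theta> * norm \<theta> powr (2 * s) * (indicator {e'..} l * f l)" for l
    proof -
      have i: "indicator {0<..} l * indicator {h. e \<le> norm h} (l *\<^sub>R \<theta>) = (indicator {e'..} l :: real)"
      proof (cases "0 < l")
        case True
        then show ?thesis using np
          by (simp add: indicator_def e'_def pos_divide_le_eq del: zero_less_norm_iff)
      next
        case False
        then show ?thesis using e'(1) by (simp add: indicator_def)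
      qed
      have "polar_weight (\<theta>, l) * (F (l *\<^sub>R \<theta>) * frac_kernel s (l *\<^sub>R \<theta>)) =
          (polar_weight (\<theta>, l) * frac_kernel s (l *\<^sub>R \<theta>)) * F (l *\<^sub>R \<theta>)" by simp
      also have "\<dots> = frac_kernel s \<theta> * l powr (- 1 - 2 * s) * ((indicator {0<..} l * indicator {h. e \<le> norm h} (l *\<^sub>R \<theta>)) *
          (2 * ball_profile s z r x - ball_profile s z r (x + l *\<^sub>R \<theta>) - ball_profile s z r (x - l *\<^sub>R \<theta>)))"
        unfolding polar_weight_kernel F_def using True by simp
      also have "\<dots> = frac_kernel s \<theta> * norm \<theta> powr (2 * s) * (indicator {e'..} l * f l)"
        unfolding i diff[OF s(1)] f_def by (simp only: mult_ac)
      finally show ?thesis .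
    qed
    then have "(LINT l|lborel. polar_weight (\<theta>, l) * (F (l *\<^sub>R \<theta>) * frac_kernel s (l *\<^sub>R \<theta>))) =
        frac_kernel s \<theta> * norm \<theta> powr (2 * s) * (LINT l|lborel. indicator {e'..} l * f l)" by simp
    also have "\<dots> \<le> frac_kernel s \<theta> * norm \<theta> powr (2 * s) * Bd"
      using L by (intro mult_left_mono) auto
    also have "\<dots> \<le> 1 * Bd"
    proof (rule mult_right_mono[OF _ Bd])
      have "norm \<theta> powr (2 * s) \<le> norm \<theta> powr (real DIM('a) + 2 * s)"
        using th by (intro powr_mono) auto
      then show "frac_kernel s \<theta> * norm \<theta> powr (2 * s) \<le> 1"
        using th by (simp add: frac_kernel_def divide_le_eq_1)
    qed
    finally show ?thesis using True by simp
  qed (simp add: polar_weight_def)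
  have shell: "integrable lborel (\<lambda>\<theta>::'a. indicator dyadic_shell \<theta> * Bd)"
    using emeasure_dyadic_shell[where 'a='a] by (intro integrable_mult_left integrable_real_indicator) auto
  have "ln 2 * (LINT h|lborel. F h * frac_kernel s h) =
      (LINT \<theta>|lborel. LINT l|lborel. polar_weight (\<theta>, l) * (F (l *\<^sub>R \<theta>) * frac_kernel s (l *\<^sub>R \<theta>)))"
    by (rule pol(2))
  also have "\<dots> \<le> (LINT \<theta>|lborel. indicator dyadic_shell (\<theta> :: 'a) * Bd)"
    using lborel_pair.integrable_fst'[OF pol(1)] shell inner by (intro integral_mono) auto
  also have "\<dots> = measure lborel (dyadic_shell :: 'a set) * Bd" by simp
  finally show "(LINT h|lborel. F h * frac_kernel s h) \<le> measure lborel (dyadic_shell :: 'a set) / ln 2 *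
      (interval_const s + (4 * r / d) powr s * ((2 * e / d) powr (2 - 2 * s) / (2 * s)))"
    by (simp add: Bd_def field_simps)
qed

text \<open>
  The summand \<open>1\<close> absorbs the truncation error.
\<close>

definition barrier_const :: "'a::euclidean_space itself \<Rightarrow> real \<Rightarrow> real" where
  "barrier_const _ s = measure lborel (dyadic_shell :: 'a set) / ln 2 * interval_const s + 1"

lemma ball_profile_operator_le:
  fixes x z :: "'a::euclidean_space"
  assumes s: "0 < s" "s < 1" and x: "norm (x - z) < r"
  shows "\<forall>\<^sub>F e in at_right 0. (LINT h|lborel. indicator {h. e \<le> norm h} h *
    (2 * ball_profile s z r x - ball_profile s z r (x + h) - ball_profile s z r (x - h)) * frac_kernel s h)
    \<le> barrier_const TYPE('a) s"
proof -
  define d where "d = r - norm (x - z)"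
  define M where "M = measure lborel (dyadic_shell :: 'a set) / ln 2"
  have d: "0 < d" using x by (simp add: d_def)
  have "((\<lambda>e. M * ((4 * r / d) powr s * ((2 * e / d) powr (2 - 2 * s) / (2 * s)))) \<longlongrightarrow>
      M * ((4 * r / d) powr s * ((2 * 0 / d) powr (2 - 2 * s) / (2 * s)))) (at_right 0)"
    using s d eventually_at_right_less[of 0]
    by (intro tendsto_intros tendsto_powr') (auto elim!: eventually_mono)
  then have "\<forall>\<^sub>F e in at_right 0. M * ((4 * r / d) powr s * ((2 * e / d) powr (2 - 2 * s) / (2 * s))) < 1"
    by (rule order_tendstoD(2)) (use s in simp)
  moreover have "\<forall>\<^sub>F e in at_right 0. e \<in> {0<..<d / 4}"
    using d by (intro eventually_at_right_real) auto
  ultimately show ?thesis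
  proof eventually_elim
    case (elim e)
    have "(LINT h|lborel. indicator {h. e \<le> norm h} h *
      (2 * ball_profile s z r x - ball_profile s z r (x + h) - ball_profile s z r (x - h)) * frac_kernel s h)
      \<le> M * (interval_const s + (4 * r / d) powr s * ((2 * e / d) powr (2 - 2 * s) / (2 * s)))"
      unfolding M_def d_def using ball_profile_truncated_operator_le(2)[OF s x] elim by (auto simp: d_def)
    then show ?case using elim by (simp add: barrier_const_def M_def distrib_left)
  qed
qed

section \<open>The weak form and mollification\<close>

lemma integrable_continuous_compact_support:
  fixes f :: "'a::euclidean_space \<Rightarrow> real"
  assumes "continuous_on UNIV f" "\<And>x. x \<notin> cball a r \<Longrightarrow> f x = 0"
  shows "integrable lborel f"
proof -
  have "integrable lborel (\<lambda>x. indicator (cball a r) x *\<^sub>R f x)"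
    by (rule borel_integrable_compact) (use continuous_on_subset[OF assms(1)] in auto)
  moreover have "(\<lambda>x. indicator (cball a r) x *\<^sub>R f x) = f"
    using assms(2) by (auto simp: indicator_def fun_eq_iff)
  ultimately show ?thesis by simp
qed

text \<open>
  In the variables \<open>x\<close> and \<open>h = y - x\<close> the kernel depends on \<open>h\<close> alone. Finite energies make the double
  integral absolutely convergent, which justifies exchanging the order of integration.
\<close>

lemma gagliardo_form_shift:
  fixes u \<phi> :: "'a::euclidean_space \<Rightarrow> real"
  assumes [measurable]: "u \<in> borel_measurable borel" "\<phi> \<in> borel_measurable borel"
    and E: "gagliardo_energy s u < \<infinity>" "gagliardo_energy s \<phi> < \<infinity>"
  shows "integrable (lborel \<Otimes>\<^sub>M lborel)
      (\<lambda>(x, h). (u x - u (x + h)) * (\<phi> x - \<phi> (x + h)) * frac_kernel s h)"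
    and "gagliardo_form s u \<phi> = (LINT h|lborel. LINT x|lborel.
      (u x - u (x + h)) * (\<phi> x - \<phi> (x + h)) * frac_kernel s h)"
proof -
  let ?G = "\<lambda>(x, h). (u x - u (x + h)) * (\<phi> x - \<phi> (x + h)) * frac_kernel s h"
  have [measurable]: "?G \<in> borel_measurable (lborel \<Otimes>\<^sub>M lborel)" by measurable
  show i: "integrable (lborel \<Otimes>\<^sub>M lborel) ?G"
  proof (rule integrableI_bounded)
    have "(\<integral>\<^sup>+p. ennreal (norm (?G p)) \<partial>(lborel \<Otimes>\<^sub>M lborel)) =
      (\<integral>\<^sup>+x. \<integral>\<^sup>+h. ennreal (norm (?G (x, h))) \<partial>lborel \<partial>lborel)"
      by (rule lborel.nn_integral_fst[symmetric]) measurable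
    also have "\<dots> \<le> (\<integral>\<^sup>+x. \<integral>\<^sup>+h. ennreal ((u x - u (x + h))\<^sup>2 * frac_kernel s h)
        + ennreal ((\<phi> x - \<phi> (x + h))\<^sup>2 * frac_kernel s h) \<partial>lborel \<partial>lborel)"
    proof (intro nn_integral_mono)
      fix x h :: 'a
      define a b where "a = \<bar>u x - u (x + h)\<bar>" and "b = \<bar>\<phi> x - \<phi> (x + h)\<bar>"
      have "0 \<le> (a - b)\<^sup>2" by simp
      then have "2 * (a * b) \<le> a\<^sup>2 + b\<^sup>2" by (simp add: power2_eq_square algebra_simps)
      moreover have "0 \<le> a * b" by (simp add: a_def b_def)
      ultimately have "a * b \<le> a\<^sup>2 + b\<^sup>2" by linarith
      from mult_right_mono[OF this, of "frac_kernel s h"]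
      have "norm (?G (x, h)) \<le> (u x - u (x + h))\<^sup>2 * frac_kernel s h
          + (\<phi> x - \<phi> (x + h))\<^sup>2 * frac_kernel s h"
        by (simp add: a_def b_def abs_mult distrib_right)
      then show "ennreal (norm (?G (x, h))) \<le> ennreal ((u x - u (x + h))\<^sup>2 * frac_kernel s h)
          + ennreal ((\<phi> x - \<phi> (x + h))\<^sup>2 * frac_kernel s h)"
        by (subst ennreal_plus[symmetric]) (simp_all only: ennreal_leI frac_kernel_nonneg zero_le_power2 mult_nonneg_nonneg)
    qed
    also have "\<dots> = (\<integral>\<^sup>+x. (\<integral>\<^sup>+h. ennreal ((u x - u (x + h))\<^sup>2 * frac_kernel s h) \<partial>lborel)
        + (\<integral>\<^sup>+h. ennreal ((\<phi> x - \<phi> (x + h))\<^sup>2 * frac_kernel s h) \<partial>lborel) \<partial>lborel)"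
      by (intro nn_integral_cong nn_integral_add) measurable
    also have "\<dots> = gagliardo_shift_energy s u + gagliardo_shift_energy s \<phi>"
      unfolding gagliardo_shift_energy_def by (intro nn_integral_add) measurable
    also have "\<dots> < \<infinity>"
      using E by (simp add: gagliardo_energy_eq_shift)
    finally show "(\<integral>\<^sup>+p. ennreal (norm (?G p)) \<partial>(lborel \<Otimes>\<^sub>M lborel)) < \<infinity>" .
  qed measurable
  have "gagliardo_form s u \<phi> = (LINT x|lebesgue. LINT y|lborel.
      (u x - u y) * (\<phi> x - \<phi> y) * frac_kernel s (x - y))"
    unfolding gagliardo_form_def
    by (subst integral_completion) (auto simp: frac_kernel_def)
  also have "\<dots> = (LINT x|lborel. LINT y|lborel. (u x - u y) * (\<phi> x - \<phi> y) * frac_kernel s (x - y))"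
    by (rule integral_completion) measurable
  also have "\<dots> = (LINT x|lborel. LINT h|lborel. (u x - u (x + h)) * (\<phi> x - \<phi> (x + h)) * frac_kernel s h)"
  proof (rule Bochner_Integration.integral_cong[OF refl])
    fix x :: 'a
    have "(LINT y|lborel. (u x - u y) * (\<phi> x - \<phi> y) * frac_kernel s (x - y)) =
      (LINT h|lborel. (u x - u (x + 1 *\<^sub>R h)) * (\<phi> x - \<phi> (x + 1 *\<^sub>R h)) * frac_kernel s (x - (x + 1 *\<^sub>R h)))"
      by (rule integral_lborel_affine_unit(1)[symmetric]) auto
    then show "(LINT y|lborel. (u x - u y) * (\<phi> x - \<phi> y) * frac_kernel s (x - y)) =
      (LINT h|lborel. (u x - u (x + h)) * (\<phi> x - \<phi> (x + h)) * frac_kernel s h)"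
      by simp
  qed
  also have "\<dots> = (LINT h|lborel. LINT x|lborel. (u x - u (x + h)) * (\<phi> x - \<phi> (x + h)) * frac_kernel s h)"
    using lborel_pair.Fubini_integral[OF i] by simp
  finally show "gagliardo_form s u \<phi> = (LINT h|lborel. LINT x|lborel.
      (u x - u (x + h)) * (\<phi> x - \<phi> (x + h)) * frac_kernel s h)" .
qed

text \<open>
  Convolution with the reflection of \<open>\<rho>\<close>.
\<close>

definition mollified :: "('a::euclidean_space \<Rightarrow> real) \<Rightarrow> ('a \<Rightarrow> real) \<Rightarrow> 'a \<Rightarrow> real" where
  "mollified \<rho> u x = (LINT k|lborel. u (x + k) * \<rho> k)"

lemma mollified_shift:
  fixes u \<rho> :: "'a::euclidean_space \<Rightarrow> real"
  assumes u: "continuous_on UNIV u" and r: "continuous_on UNIV \<rho>" "\<And>k. k \<notin> cball 0 e \<Longrightarrow> \<rho> k = 0"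
  shows "integrable lborel (\<lambda>x. u (x + p) * \<rho> (x + q))"
    and "(LINT x|lborel. u (x + p) * \<rho> (x + q)) = mollified \<rho> u (p - q)"
proof -
  have [measurable]: "u \<in> borel_measurable borel" "\<rho> \<in> borel_measurable borel"
    using u r by (auto intro: borel_measurable_continuous_onI)
  have "integrable lborel (\<lambda>k. u (p - q + k) * \<rho> k)"
    by (rule integrable_continuous_compact_support[where a=0 and r=e])
       (use r in \<open>auto intro!: continuous_intros continuous_on_compose2[OF u]\<close>)
  moreover have 1: "(\<lambda>x. u (x + p) * \<rho> (x + q)) = (\<lambda>x. (\<lambda>k. u (p - q + k) * \<rho> k) (q + 1 *\<^sub>R x))"
    by (auto simp: algebra_simps)
  ultimately show "integrable lborel (\<lambda>x. u (x + p) * \<rho> (x + q))"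
    unfolding 1 by (subst integral_lborel_affine_unit(2)) auto
  show "(LINT x|lborel. u (x + p) * \<rho> (x + q)) = mollified \<rho> u (p - q)"
    unfolding 1 mollified_def by (subst integral_lborel_affine_unit(1)) auto
qed

text \<open>
  Testing with a translated bump function produces second differences of the mollified function at
  one point. In this way the weak inequality becomes a pointwise one although \<open>u\<close> is only continuous,
  and the only test functions ever needed are smooth and explicit.
\<close>

lemma gagliardo_form_translate_bump:
  fixes u \<rho> :: "'a::euclidean_space \<Rightarrow> real"
  assumes u: "continuous_on UNIV u" and r: "continuous_on UNIV \<rho>" "\<And>k. k \<notin> cball 0 e \<Longrightarrow> \<rho> k = 0"
    and E: "gagliardo_energy s u < \<infinity>" "gagliardo_energy s (\<lambda>y. \<rho> (y - x1)) < \<infinity>"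
  defines "V \<equiv> \<lambda>h. (2 * mollified \<rho> u x1 - mollified \<rho> u (x1 + h) - mollified \<rho> u (x1 - h)) * frac_kernel s h"
  shows "integrable lborel V" and "gagliardo_form s u (\<lambda>y. \<rho> (y - x1)) = (LINT h|lborel. V h)"
proof -
  have [measurable]: "u \<in> borel_measurable borel" "\<rho> \<in> borel_measurable borel"
    using u r by (auto intro: borel_measurable_continuous_onI)
  note sh = mollified_shift[OF u r]
  have V: "(LINT x|lborel. (u x - u (x + h)) * (\<rho> (x - x1) - \<rho> (x + h - x1)) * frac_kernel s h) = V h" for h
  proof -
    have 1: "(\<lambda>x. (u x - u (x + h)) * (\<rho> (x - x1) - \<rho> (x + h - x1)) * frac_kernel s h) =
      (\<lambda>x. (u (x + 0) * \<rho> (x + (- x1)) - u (x + 0) * \<rho> (x + (h - x1))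
        - (u (x + h) * \<rho> (x + (- x1)) - u (x + h) * \<rho> (x + (h - x1)))) * frac_kernel s h)"
      by (auto simp: algebra_simps)
    show ?thesis unfolding 1 V_def
      by (simp only: integral_mult_left_zero Bochner_Integration.integral_diff Bochner_Integration.integrable_diff sh)
         (simp add: algebra_simps)
  qed
  note f = gagliardo_form_shift[OF _ _ E]
  have "integrable lborel (\<lambda>h. LINT x|lborel. (u x - u (x + h)) * (\<rho> (x - x1) - \<rho> (x + h - x1)) * frac_kernel s h)"
    using lborel_pair.integrable_snd[OF f(1)] by simp
  then show "integrable lborel V" unfolding V .
  show "gagliardo_form s u (\<lambda>y. \<rho> (y - x1)) = (LINT h|lborel. V h)"
    by (subst f(2)) (simp_all only: V, auto)
qed

section \<open>Smooth bump functions\<close>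

lemma Ck_continuous: "Ck k f \<Longrightarrow> continuous_on UNIV f"
proof (cases k)
  case (Suc n)
  assume "Ck k f"
  then show ?thesis using Suc
    by (auto intro!: differentiable_imp_continuous_on simp: differentiable_on_def
        intro: differentiable_at_withinI)
qed simp

lemma Ck_lower: "Ck (Suc k) f \<Longrightarrow> Ck k f"
proof (induction k arbitrary: f)
  case 0
  then show ?case using Ck_continuous by fastforce
next
  case (Suc k)
  have "\<forall>x. f differentiable (at x)"
    and "\<forall>b\<in>Basis. Ck (Suc k) (\<lambda>x. frechet_derivative f (at x) b)"
    using Suc.prems by (subst (asm) Ck.simps(2), blast)+
  then have "\<forall>b\<in>Basis. Ck k (\<lambda>x. frechet_derivative f (at x) b)"
    using Suc.IH by blast
  then show ?case
    using \<open>\<forall>x. f differentiable (at x)\<close> by (subst Ck.simps(2)) blast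
qed

lemma Ck_const: "Ck k (\<lambda>x. c)"
  by (induction k arbitrary: c) auto

lemma Ck_add: "Ck k f \<Longrightarrow> Ck k g \<Longrightarrow> Ck k (\<lambda>x. f x + g x)"
proof (induction k arbitrary: f g)
  case 0
  then show ?case by (auto intro: continuous_on_add)
next
  case (Suc k)
  have "frechet_derivative (\<lambda>x. f x + g x) (at x) b =
     frechet_derivative f (at x) b + frechet_derivative g (at x) b" for x b
  proof -
    have "(f has_derivative frechet_derivative f (at x)) (at x)"
      "(g has_derivative frechet_derivative g (at x)) (at x)"
      using Suc.prems by (auto simp: frechet_derivative_works[symmetric])
    from has_derivative_add[OF this]
    show ?thesis by (simp add: frechet_derivative_at[symmetric])
  qed
  then show ?case using Suc by (auto intro!: differentiable_add)
qed

lemma Ck_mult: "Ck k f \<Longrightarrow> Ck k g \<Longrightarrow> Ck k (\<lambda>x. f x * g x)"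
proof (induction k arbitrary: f g)
  case 0
  then show ?case by (auto intro: continuous_on_mult)
next
  case (Suc k)
  have "frechet_derivative (\<lambda>x. f x * g x) (at x) b =
     f x * frechet_derivative g (at x) b + frechet_derivative f (at x) b * g x" for x b
  proof -
    have "(f has_derivative frechet_derivative f (at x)) (at x)"
      "(g has_derivative frechet_derivative g (at x)) (at x)"
      using Suc.prems by (auto simp: frechet_derivative_works[symmetric])
    from has_derivative_mult[OF this]
    show ?thesis by (simp add: frechet_derivative_at[symmetric])
  qed
  then show ?case using Suc Ck_lower[of k f] Ck_lower[of k g] by (auto intro!: Ck_add)
qed

lemma Ck_inner: "Ck k (\<lambda>x. x \<bullet> b)"
proof (cases k)
  case (Suc n)
  have "((\<lambda>x. x \<bullet> b) has_derivative (\<lambda>h. h \<bullet> b)) (at x)" for x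
    by (auto intro!: derivative_eq_intros)
  then have "frechet_derivative (\<lambda>x. x \<bullet> b) (at x) = (\<lambda>h. h \<bullet> b)" for x
    by (metis frechet_derivative_at)
  then show ?thesis using Suc by (auto simp: Ck_const)
qed (auto intro!: continuous_intros)

text \<open>
  The functions \<open>exp (- 1 / t) / t ^ m\<close>, flat at \<open>0\<close>: up to linear combinations, the family of all \<open>m\<close> is closed
  under differentiation, so that smoothness of its members follows by one induction.
\<close>

definition flat_exp :: "nat \<Rightarrow> real \<Rightarrow> real" where
  "flat_exp m t = (if 0 < t then exp (- 1 / t) / t ^ m else 0)"

lemma flat_exp_bound: "\<bar>flat_exp m t\<bar> \<le> fact (m + k) * \<bar>t\<bar> ^ k"
proof (cases "0 < t")
  case True
  have "(1 / t) ^ (m + k) / fact (m + k) \<le> exp (1 / t)"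
  proof -
    have "(1 / t) ^ (m + k) / fact (m + k) = (\<Sum>n\<in>{m + k}. (1 / t) ^ n /\<^sub>R fact n)"
      by (simp add: field_simps)
    also have "\<dots> \<le> exp (1 / t)" unfolding exp_def
      by (rule sum_le_suminf) (use True summable_exp_generic[of "1/t"] in auto)
    finally show ?thesis .
  qed
  then have "exp (- 1 / t) \<le> fact (m + k) * t ^ (m + k)"
    using True by (simp add: exp_minus field_simps power_divide)
  then show ?thesis using True by (simp add: flat_exp_def field_simps power_add)
qed (simp add: flat_exp_def)

lemma flat_exp_deriv:
  "(flat_exp m has_real_derivative (flat_exp (m + 2) t - real m * flat_exp (m + 1) t)) (at t)"
proof -
  consider "t > 0" | "t < 0" | "t = 0" by linarith
  then show ?thesis
  proof cases
    case 1
    have "((\<lambda>t. exp (- 1 / t) / t ^ m) has_real_derivative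
       (flat_exp (m + 2) t - real m * flat_exp (m + 1) t)) (at t)"
      using 1 apply (auto intro!: derivative_eq_intros simp: flat_exp_def)
      apply (cases m) 
      apply (auto simp: field_simps power2_eq_square)
      done
    then show ?thesis
      apply (rule has_field_derivative_transform_within_open[where S="{0<..}"])
      using 1 by (auto simp: flat_exp_def)
  next
    case 2
    have "((\<lambda>t. 0::real) has_real_derivative 0) (at t)" by simp
    then have "(flat_exp m has_real_derivative 0) (at t)"
      apply (rule has_field_derivative_transform_within_open[where S="{..<0}"])
      using 2 by (auto simp: flat_exp_def)
    then show ?thesis using 2 by (simp add: flat_exp_def)
  next
    case 3
    have "(\<lambda>h. flat_exp m h / h) \<midarrow>0\<rightarrow> 0"
    proof (rule Lim_null_comparison)
      show "\<forall>\<^sub>F h in at 0. norm (flat_exp m h / h) \<le> fact (m + 2) * \<bar>h\<bar>"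
      proof (intro always_eventually allI)
        fix h :: real
        show "norm (flat_exp m h / h) \<le> fact (m + 2) * \<bar>h\<bar>"
          using flat_exp_bound[of m h 2]
          by (cases "h = 0") (simp_all add: pos_divide_le_eq power2_eq_square mult.assoc)
      qed
      show "((\<lambda>h::real. fact (m + 2) * \<bar>h\<bar>) \<longlongrightarrow> 0) (at 0)"
        by (auto intro!: tendsto_eq_intros)
    qed
    then show ?thesis using 3 by (simp add: DERIV_def flat_exp_def)
  qed
qed

text \<open>
  A partial derivative is a linear function times a combination of two members of the family.
\<close>

lemma Ck_flat_exp_sphere: "Ck k (\<lambda>x. flat_exp m (c - norm (x - a) ^ 2))"
proof (induction k arbitrary: m)
  have D: "((\<lambda>x. flat_exp m (c - norm (x - a) ^ 2)) has_derivative
     (\<lambda>h. - 2 * ((x - a) \<bullet> h) * (flat_exp (m + 2) (c - norm (x - a) ^ 2)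
         - real m * flat_exp (m + 1) (c - norm (x - a) ^ 2)))) (at x)" for x m
  proof -
    have "((\<lambda>x. c - norm (x - a) ^ 2) has_derivative (\<lambda>h. - 2 * ((x - a) \<bullet> h))) (at x)"
      by (auto simp: power2_norm_eq_inner inner_commute intro!: derivative_eq_intros)
    from DERIV_compose_FDERIV[OF flat_exp_deriv this] show ?thesis by simp
  qed
  case 0
  show ?case
    unfolding Ck.simps by (rule has_derivative_continuous_on) (rule has_derivative_at_withinI[OF D])
  case (Suc k)
  have e: "frechet_derivative (\<lambda>x. flat_exp m (c - norm (x - a) ^ 2)) (at x) b =
     (2 * (a \<bullet> b) + (- 2) * (x \<bullet> b)) * (flat_exp (m + 2) (c - norm (x - a) ^ 2)
         + (- real m) * flat_exp (m + 1) (c - norm (x - a) ^ 2))" for x b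
    unfolding frechet_derivative_at[OF D, symmetric] by (simp add: algebra_simps)
  have "Ck k (\<lambda>x. (2 * (a \<bullet> b) + (- 2) * (x \<bullet> b)) * (flat_exp (m + 2) (c - norm (x - a) ^ 2)
         + (- real m) * flat_exp (m + 1) (c - norm (x - a) ^ 2)))" for b
    by (intro Ck_mult Ck_add Ck_const Ck_inner Suc)
  moreover have "(\<lambda>x. flat_exp m (c - norm (x - a) ^ 2)) differentiable (at x)" for x
    using D differentiable_def by blast
  ultimately show ?case unfolding Ck.simps(2) e by blast
qed

definition raw_bump :: "real \<Rightarrow> 'a::euclidean_space \<Rightarrow> real" where
  "raw_bump e k = flat_exp 0 (e\<^sup>2 - (norm k)\<^sup>2)"

definition bump :: "real \<Rightarrow> 'a::euclidean_space \<Rightarrow> real" where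
  "bump e k = raw_bump e k / (LINT k|lborel. raw_bump e (k :: 'a))"

lemma flat_exp_lipschitz: "\<bar>flat_exp 0 a - flat_exp 0 b\<bar> \<le> 2 * \<bar>a - b\<bar>"
proof -
  have "norm (flat_exp 0 a - flat_exp 0 b) \<le> 2 * norm (a - b)"
  proof (rule field_differentiable_bound[where S=UNIV and f'="flat_exp 2"])
    fix t :: real
    show "(flat_exp 0 has_field_derivative flat_exp 2 t) (at t within UNIV)"
      using flat_exp_deriv[of 0 t] by (simp add: numeral_2_eq_2)
    show "norm (flat_exp 2 t) \<le> 2" using flat_exp_bound[of 2 t 0] by simp
  qed auto
  then show ?thesis by simp
qed

lemma flat_exp_0_mono: "0 < a \<Longrightarrow> a \<le> b \<Longrightarrow> flat_exp 0 a \<le> flat_exp 0 b"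
  by (simp add: flat_exp_def frac_le)

text \<open>
  Beyond radius \<open>e\<close> the function is zero, so \<open>norm x\<close> may be replaced by \<open>min (norm x) e\<close>, on
  which the square is Lipschitz with constant \<open>2 * e\<close>.
\<close>

lemma raw_bump_lipschitz:
  assumes "0 < e"
  shows "\<bar>raw_bump e x - raw_bump e y\<bar> \<le> 4 * e * norm (x - y)"
proof -
  define m where "m = (\<lambda>x::'a. min (norm x) e)"
  have m: "0 \<le> m x" "m x \<le> e" for x using assms by (auto simp: m_def)
  have rb: "raw_bump e x = flat_exp 0 (e\<^sup>2 - (m x)\<^sup>2)" for x :: 'a
  proof (cases "norm x \<le> e")
    case False
    then have "e\<^sup>2 \<le> (norm x)\<^sup>2" using assms by (intro power_mono) auto
    then show ?thesis using False by (simp add: raw_bump_def m_def flat_exp_def)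
  qed (simp add: raw_bump_def m_def)
  have "\<bar>raw_bump e x - raw_bump e y\<bar> \<le> 2 * \<bar>(e\<^sup>2 - (m x)\<^sup>2) - (e\<^sup>2 - (m y)\<^sup>2)\<bar>"
    unfolding rb by (rule flat_exp_lipschitz)
  also have "(e\<^sup>2 - (m x)\<^sup>2) - (e\<^sup>2 - (m y)\<^sup>2) = (m y - m x) * (m y + m x)"
    by (simp add: power2_eq_square algebra_simps)
  also have "2 * \<bar>(m y - m x) * (m y + m x)\<bar> \<le> 2 * (norm (x - y) * (e + e))"
  proof -
    have "\<bar>m y - m x\<bar> \<le> norm (x - y)"
      using norm_triangle_ineq3[of x y] by (auto simp: m_def min_def)
    moreover have "\<bar>m y + m x\<bar> \<le> e + e" using m[of x] m[of y] by linarith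
    ultimately show ?thesis unfolding abs_mult by (intro mult_left_mono mult_mono) auto
  qed
  finally show ?thesis by (simp add: algebra_simps)
qed

lemma raw_bump_outside: "0 < e \<Longrightarrow> k \<notin> ball 0 e \<Longrightarrow> raw_bump e k = 0"
  using power_mono[of e "norm k" 2] by (auto simp: raw_bump_def flat_exp_def not_less)

lemma raw_bump_nonneg: "0 \<le> raw_bump e k"
  by (simp add: raw_bump_def flat_exp_def)

lemma continuous_raw_bump: "continuous_on UNIV (raw_bump e)"
  using Ck_continuous[OF Ck_flat_exp_sphere[of 0 0 "e\<^sup>2" 0]] by (simp add: raw_bump_def[abs_def])

lemma integral_raw_bump_pos:
  assumes "0 < e"
  shows "0 < (LINT k|lborel. raw_bump e (k :: 'a::euclidean_space))"
proof -
  define c where "c = flat_exp 0 (3 / 4 * e\<^sup>2)"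
  have c: "0 < c" using assms by (simp add: c_def flat_exp_def)
  have ge: "indicator (ball 0 (e / 2)) k * c \<le> raw_bump e k" for k :: 'a
  proof (cases "k \<in> ball 0 (e / 2)")
    case True
    then have "(norm k)\<^sup>2 \<le> (e / 2)\<^sup>2" by (intro power_mono) auto
    then have "3 / 4 * e\<^sup>2 \<le> e\<^sup>2 - (norm k)\<^sup>2" by (simp add: power_divide)
    moreover have "0 < 3 / 4 * e\<^sup>2" using assms by simp
    ultimately have "c \<le> raw_bump e k" unfolding c_def raw_bump_def by (intro flat_exp_0_mono)
    then show ?thesis using True by simp
  qed (simp add: raw_bump_nonneg)
  have "0 < measure lborel (ball (0::'a) (e / 2)) * c"
    using c assms content_ball_pos[of "e / 2" "0::'a"] by simp
  also have "\<dots> = (LINT k|lborel. indicator (ball (0::'a) (e / 2)) k * c)" by simp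
  also have "\<dots> \<le> (LINT k|lborel. raw_bump e (k :: 'a))"
  proof (rule integral_mono)
    show "integrable lborel (\<lambda>k. indicator (ball (0::'a) (e / 2)) k * c)"
      using emeasure_lborel_ball_finite[of "0::'a" "e / 2"]
      by (intro integrable_mult_left integrable_real_indicator) auto
    show "integrable lborel (raw_bump e :: 'a \<Rightarrow> real)"
      by (rule integrable_continuous_compact_support[OF continuous_raw_bump, of 0 e])
         (rule raw_bump_outside[OF assms], auto)
  qed (rule ge)
  finally show ?thesis .
qed

context
  fixes e :: real assumes e: "0 < e"
begin

lemma bump_outside: "k \<notin> cball 0 e \<Longrightarrow> bump e k = 0"
  using raw_bump_outside[OF e, of k] by (auto simp: bump_def)

lemma bump_nonneg: "0 \<le> bump e k"
  using integral_raw_bump_pos[OF e] raw_bump_nonneg[of e k] by (auto simp: bump_def intro!: divide_nonneg_pos)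

lemma continuous_bump: "continuous_on UNIV (bump e :: 'a::euclidean_space \<Rightarrow> real)"
  unfolding bump_def[abs_def] using continuous_raw_bump[of e] integral_raw_bump_pos[OF e, where 'a='a]
  by (intro continuous_intros) auto

lemma integrable_bump: "integrable lborel (bump e :: 'a::euclidean_space \<Rightarrow> real)"
  by (rule integrable_continuous_compact_support[OF continuous_bump bump_outside])

lemma integral_bump: "(LINT k|lborel. bump e (k :: 'a::euclidean_space)) = 1"
  unfolding bump_def using integral_raw_bump_pos[OF e, where 'a='a] by simp

lemma bump_Cc_infinity:
  assumes "cball (x1 :: 'a::euclidean_space) e \<subseteq> \<Omega>"
  shows "(\<lambda>y. bump e (y - x1)) \<in> Cc_infinity \<Omega>"
proof -
  have "Ck k (\<lambda>y. bump e (y - x1))" for k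
  proof -
    have "Ck k (\<lambda>y. inverse (LINT k|lborel. raw_bump e (k :: 'a)) * flat_exp 0 (e\<^sup>2 - (norm (y - x1))\<^sup>2))"
      by (intro Ck_mult Ck_const Ck_flat_exp_sphere)
    then show ?thesis by (simp add: bump_def raw_bump_def divide_inverse mult.commute)
  qed
  moreover have c: "closure {y. bump e (y - x1) \<noteq> 0} \<subseteq> cball x1 e"
  proof (rule closure_minimal)
    show "{y. bump e (y - x1) \<noteq> 0} \<subseteq> cball x1 e"
    proof clarify
      fix y assume "bump e (y - x1) \<noteq> 0"
      then have "y - x1 \<in> cball 0 e" using bump_outside by blast
      then show "y \<in> cball x1 e" by (simp add: dist_norm norm_minus_commute)
    qed
  qed simp
  moreover have "compact (closure {y. bump e (y - x1) \<noteq> 0})"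
    using c by (meson bounded_cball bounded_subset closed_closure compact_eq_bounded_closed)
  ultimately show ?thesis using assms unfolding Cc_infinity_def by blast
qed

lemma bump_energy_finite:
  fixes x1 :: "'a::euclidean_space"
  assumes s: "0 < s" "s < 1"
  shows "gagliardo_energy s (\<lambda>y. bump e (y - x1)) < \<infinity>"
proof -
  define Z where "Z = (LINT k|lborel. raw_bump e (k :: 'a))"
  have Z: "0 < Z" using integral_raw_bump_pos[OF e] by (simp add: Z_def)
  show ?thesis
  proof (rule gagliardo_energy_lipschitz_finite[OF s, where L="4 * e / Z" and B="1 / Z" and a=x1 and r=e])
    fix x y :: 'a
    have "\<bar>bump e (x - x1) - bump e (y - x1)\<bar> = \<bar>raw_bump e (x - x1) - raw_bump e (y - x1)\<bar> / Z"
      using Z unfolding bump_def Z_def[symmetric] by (simp add: diff_divide_distrib[symmetric])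
    also have "\<dots> \<le> 4 * e * norm (x - y) / Z"
      using raw_bump_lipschitz[OF e, of "x - x1" "y - x1"] Z by (intro divide_right_mono) auto
    finally show "\<bar>bump e (x - x1) - bump e (y - x1)\<bar> \<le> 4 * e / Z * norm (x - y)" by simp
    have "\<bar>raw_bump e (x - x1)\<bar> \<le> 1"
      using flat_exp_bound[of 0 _ 0] by (simp add: raw_bump_def)
    then show "\<bar>bump e (x - x1)\<bar> \<le> 1 / Z"
      using Z by (simp add: bump_def Z_def[symmetric] divide_right_mono)
    show "bump e (x - x1) = 0" if "x \<notin> cball x1 e"
      by (rule bump_outside) (use that in \<open>auto simp: dist_norm norm_minus_commute\<close>)
    show "(\<lambda>y. bump e (y - x1)) \<in> borel_measurable borel"
      using borel_measurable_continuous_onI[OF continuous_bump] by measurable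
  qed
qed

lemma bump_Hs0:
  fixes x1 :: "'a::euclidean_space"
  assumes s: "0 < s" "s < 1" and "cball x1 e \<subseteq> \<Omega>"
  shows "(\<lambda>y. bump e (y - x1)) \<in> Hs0 s \<Omega>"
proof -
  let ?f = "\<lambda>y. bump e (y - x1)"
  have f: "continuous_on UNIV ?f"
    by (rule continuous_on_compose2[OF continuous_bump]) (auto intro!: continuous_intros)
  have z: "?f y = 0" if "y \<notin> cball x1 e" for y
    by (rule bump_outside) (use that in \<open>auto simp: dist_norm norm_minus_commute\<close>)
  have [measurable]: "?f \<in> borel_measurable borel" using f by (rule borel_measurable_continuous_onI)
  have "integrable lborel (\<lambda>y. (?f y)\<^sup>2)"
    by (rule integrable_continuous_compact_support[of _ x1 e]) (use f z in \<open>auto intro!: continuous_intros\<close>)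
  then have "integrable lebesgue (\<lambda>y. (?f y)\<^sup>2)" by (subst integrable_completion) auto
  moreover have "?f \<in> borel_measurable lebesgue" by (rule measurable_completion) simp
  ultimately have "?f \<in> Hs s" using bump_energy_finite[OF s, of x1] by (simp add: Hs_def)
  have "gagliardo_seminorm s (\<lambda>x. ?f x - ?f x) = 0"
    by (simp add: gagliardo_seminorm_def gagliardo_energy_def)
  have "?f x = 0" if "x \<notin> \<Omega>" for x by (rule z) (use assms(3) that in blast)
  show ?thesis
    unfolding Hs0_def
  proof (intro CollectI conjI allI impI)
    show "AE x in lebesgue. x \<notin> \<Omega> \<longrightarrow> ?f x = 0"
      using \<open>\<And>x. x \<notin> \<Omega> \<Longrightarrow> ?f x = 0\<close> by simp
    fix \<epsilon> :: real assume "0 < \<epsilon>"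
    then show "\<exists>f\<in>Cc_infinity \<Omega>. gagliardo_seminorm s (\<lambda>x. ?f x - f x) < \<epsilon>"
      using bump_Cc_infinity[OF assms(3)] \<open>gagliardo_seminorm s (\<lambda>x. ?f x - ?f x) = 0\<close>
      by (intro bexI[of _ ?f]) simp_all
  qed fact
qed

end

section \<open>Mollified supersolutions\<close>

lemma mollified_const_le:
  fixes u :: "'a::euclidean_space \<Rightarrow> real"
  assumes e: "0 < e" and u: "continuous_on UNIV u"
  shows "(\<And>k. k \<in> cball 0 e \<Longrightarrow> m \<le> u (x + k)) \<Longrightarrow> m \<le> mollified (bump e) u x"
    and "(\<And>k. k \<in> cball 0 e \<Longrightarrow> u (x + k) \<le> m) \<Longrightarrow> mollified (bump e) u x \<le> m"
proof -
  note cb = continuous_bump[OF e] bump_outside[OF e]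
  have i: "integrable lborel (\<lambda>k. u (x + k) * bump e k)" 
    using mollified_shift(1)[where p=x and q=0, OF u cb] by (simp add: add.commute)
  have j: "(LINT k|lborel. m * bump e (k::'a)) = m" using integral_bump[OF e, where 'a='a] by simp
  have k: "integrable lborel (\<lambda>k::'a. m * bump e k)" using integrable_bump[OF e, where 'a='a] by simp
  show "m \<le> mollified (bump e) u x" if "\<And>k. k \<in> cball 0 e \<Longrightarrow> m \<le> u (x + k)"
  proof -
    have "m * bump e k \<le> u (x + k) * bump e k" for k
      using that[of k] bump_nonneg[OF e, of k] bump_outside[OF e, of k]
      by (cases "k \<in> cball 0 e") (auto intro!: mult_right_mono)
    then have "(LINT k|lborel. m * bump e (k::'a)) \<le> mollified (bump e) u x"
      unfolding mollified_def using i k by (intro integral_mono) auto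
    then show ?thesis unfolding j .
  qed
  show "mollified (bump e) u x \<le> m" if "\<And>k. k \<in> cball 0 e \<Longrightarrow> u (x + k) \<le> m"
  proof -
    have "u (x + k) * bump e k \<le> m * bump e k" for k
      using that[of k] bump_nonneg[OF e, of k] bump_outside[OF e, of k]
      by (cases "k \<in> cball 0 e") (auto intro!: mult_right_mono)
    then have "mollified (bump e) u x \<le> (LINT k|lborel. m * bump e (k::'a))"
      unfolding mollified_def using i k by (intro integral_mono) auto
    then show ?thesis unfolding j .
  qed
qed

text \<open>
  The modulus of continuity of \<open>u\<close> on a compact ball passes to the mollified function, because the
  bump function has integral one.
\<close>

lemma continuous_mollified:
  fixes u :: "'a::euclidean_space \<Rightarrow> real"
  assumes e: "0 < e" and u: "continuous_on UNIV u"
  shows "continuous_on UNIV (mollified (bump e) u)"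
  unfolding continuous_on_iff
proof (intro ballI allI impI)
  fix x :: 'a and \<tau> :: real assume "0 < \<tau>"
  have "uniformly_continuous_on (cball x (1 + e)) u"
    using compact_uniformly_continuous[OF continuous_on_subset[OF u]] by simp
  then obtain d where d: "0 < d" and
    ud: "\<And>a b. a \<in> cball x (1 + e) \<Longrightarrow> b \<in> cball x (1 + e) \<Longrightarrow> dist b a < d \<Longrightarrow> dist (u b) (u a) < \<tau> / 2"
    using \<open>0 < \<tau>\<close> unfolding uniformly_continuous_on_def by (metis half_gt_zero)
  have "dist (mollified (bump e) u y) (mollified (bump e) u x) < \<tau>" if y: "dist y x < min 1 d" for y
  proof -
    let ?w = "\<lambda>k. u k - u (k + (x - y))"
    note sh = mollified_shift[where q=0, OF u continuous_bump[OF e] bump_outside[OF e]]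
    have w: "continuous_on UNIV ?w"
      by (intro continuous_intros u continuous_on_compose2[OF u]) auto
    have "mollified (bump e) ?w y = mollified (bump e) u y - mollified (bump e) u x"
    proof -
      have "mollified (bump e) ?w y = (LINT k|lborel. u (k + y) * bump e (k + 0) - u (k + x) * bump e (k + 0))"
        unfolding mollified_def by (simp add: algebra_simps)
      also have "\<dots> = (LINT k|lborel. u (k + y) * bump e (k + 0)) - (LINT k|lborel. u (k + x) * bump e (k + 0))"
        by (rule Bochner_Integration.integral_diff) (rule sh(1), simp)+
      finally show ?thesis unfolding mollified_def by (simp add: add.commute)
    qed
    moreover have ab: "\<bar>?w (y + k)\<bar> \<le> \<tau> / 2" if "k \<in> cball 0 e" for k
    proof -
      have "dist x (y + k) \<le> 1 + e" "dist x (x + k) \<le> 1 + e"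
        using that y norm_triangle_ineq4[of "x - y" k] by (auto simp: dist_norm norm_minus_commute algebra_simps)
      then have "dist (u (y + k)) (u (x + k)) < \<tau> / 2"
        using y by (intro ud) (auto simp: dist_norm)
      then show ?thesis by (simp add: dist_real_def algebra_simps)
    qed
    moreover have "- (\<tau> / 2) \<le> mollified (bump e) ?w y"
      by (rule mollified_const_le(1)[OF e w]) (use ab in \<open>metis abs_le_D2 minus_le_iff\<close>)
    moreover have "mollified (bump e) ?w y \<le> \<tau> / 2"
      by (rule mollified_const_le(2)[OF e w]) (use ab in \<open>metis abs_le_D1\<close>)
    ultimately show ?thesis using \<open>0 < \<tau>\<close> by (simp add: dist_real_def)
  qed
  then show "\<exists>d>0. \<forall>y\<in>UNIV. dist y x < d \<longrightarrow> dist (mollified (bump e) u y) (mollified (bump e) u x) < \<tau>"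
    using d by (intro exI[of _ "min 1 d"]) auto
qed

lemma mollified_uniform_approx:
  fixes u :: "'a::euclidean_space \<Rightarrow> real"
  assumes u: "continuous_on UNIV u" and "0 < \<tau>"
  obtains d where "0 < d" and "\<And>e x. 0 < e \<Longrightarrow> e < d \<Longrightarrow> x \<in> cball a R \<Longrightarrow> \<bar>mollified (bump e) u x - u x\<bar> \<le> \<tau>"
proof -
  have "uniformly_continuous_on (cball a (R + 1)) u"
    using compact_uniformly_continuous[OF continuous_on_subset[OF u]] by simp
  then obtain d where d: "0 < d" and
    ud: "\<And>b c. b \<in> cball a (R + 1) \<Longrightarrow> c \<in> cball a (R + 1) \<Longrightarrow> dist c b < d \<Longrightarrow> dist (u c) (u b) < \<tau>"
    using \<open>0 < \<tau>\<close> unfolding uniformly_continuous_on_def by metis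
  show ?thesis
  proof (rule that[of "min 1 d"])
    fix e :: real and x assume e: "0 < e" "e < min 1 d" and x: "x \<in> cball a R"
    have ab: "\<bar>u (x + k) - u x\<bar> < \<tau>" if "k \<in> cball 0 e" for k
    proof -
      have "dist a (x + k) \<le> R + 1"
        using that e x norm_triangle_ineq4[of "a - x" k] by (auto simp: dist_norm algebra_simps)
      then have "dist (u (x + k)) (u x) < \<tau>"
        using that e x by (intro ud) (auto simp: dist_norm)
      then show ?thesis by (simp add: dist_real_def)
    qed
    have "u x - \<tau> \<le> mollified (bump e) u x"
      by (rule mollified_const_le(1)[OF e(1) u]) (use ab in \<open>force simp: abs_less_iff\<close>)
    moreover have "mollified (bump e) u x \<le> u x + \<tau>"
      by (rule mollified_const_le(2)[OF e(1) u]) (use ab in \<open>force simp: abs_less_iff\<close>)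
    ultimately show "\<bar>mollified (bump e) u x - u x\<bar> \<le> \<tau>" by linarith
  qed (use d in auto)
qed

text \<open>
  The zero-order term is bounded by \<open>C * mollified (bump e) u x1\<close>, as \<open>u\<close> is nonnegative on the support of
  the test function.
\<close>

lemma supersolution_mollified_ge:
  fixes u c :: "'a::euclidean_space \<Rightarrow> real"
  assumes s: "0 < s" "s < 1" and u: "continuous_on UNIV u" and sup: "weak_supersolution s \<Omega> c u"
    and \<Omega>: "open \<Omega>" and c: "c \<in> borel_measurable (lebesgue_on \<Omega>)"
    and C: "AE x in lebesgue_on \<Omega>. \<bar>c x\<bar> \<le> C" "0 \<le> C"
    and e: "0 < e" and sub: "cball x1 e \<subseteq> \<Omega>" and pos: "\<And>x. x \<in> cball x1 e \<Longrightarrow> 0 \<le> u x"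
  defines "v \<equiv> mollified (bump e) u"
  shows "integrable lborel (\<lambda>h. (2 * v x1 - v (x1 + h) - v (x1 - h)) * frac_kernel s h)"
    and "- C * v x1 \<le> (LINT h|lborel. (2 * v x1 - v (x1 + h) - v (x1 - h)) * frac_kernel s h)"
proof -
  let ?\<phi> = "\<lambda>y. bump e (y - x1)"
  have uE: "gagliardo_energy s u < \<infinity>" using sup by (auto simp: weak_supersolution_def Hs_def)
  have cb: "continuous_on UNIV (bump e :: 'a \<Rightarrow> real)" by (rule continuous_bump[OF e])
  note rep = gagliardo_form_translate_bump[OF u cb bump_outside[OF e] uE bump_energy_finite[OF e s]]
  show "integrable lborel (\<lambda>h. (2 * v x1 - v (x1 + h) - v (x1 - h)) * frac_kernel s h)"
    unfolding v_def by (rule rep(1)) simp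
  have [measurable]: "u \<in> borel_measurable borel" "(bump e :: 'a \<Rightarrow> real) \<in> borel_measurable borel"
    using u cb by (auto intro: borel_measurable_continuous_onI)
  have \<phi>0: "?\<phi> x = 0" if "x \<notin> cball x1 e" for x
    by (rule bump_outside[OF e]) (use that in \<open>auto simp: dist_norm norm_minus_commute\<close>)
  have u\<phi>: "0 \<le> u x * ?\<phi> x" for x
    using pos[of x] \<phi>0[of x] bump_nonneg[OF e, of "x - x1"] by (cases "x \<in> cball x1 e") auto
  have iu: "integrable lborel (\<lambda>x. u x * ?\<phi> x)" "(LINT x|lborel. u x * ?\<phi> x) = v x1"
    using mollified_shift[where p=0 and q="- x1", OF u cb bump_outside[OF e]] by (auto simp: v_def)
  have iu': "integrable lebesgue (\<lambda>x. u x * ?\<phi> x)" "(LINT x|lebesgue. u x * ?\<phi> x) = v x1"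
    using iu by (subst integrable_completion, auto) (subst integral_completion, auto)
  have \<Omega>s: "\<Omega> \<in> sets lebesgue" using \<Omega> by simp
  have i\<Omega>: "integrable (lebesgue_on \<Omega>) (\<lambda>x. u x * ?\<phi> x)" "(LINT x|lebesgue_on \<Omega>. u x * ?\<phi> x) = v x1"
  proof -
    have eq: "(\<lambda>x. indicator \<Omega> x *\<^sub>R (u x * ?\<phi> x)) = (\<lambda>x. u x * ?\<phi> x)"
    proof
      fix x show "indicator \<Omega> x *\<^sub>R (u x * ?\<phi> x) = u x * ?\<phi> x"
      proof (cases "x \<in> \<Omega>")
        case False
        then have "x \<notin> cball x1 e" using sub by blast
        then show ?thesis using \<phi>0[of x] by simp
      qed simp
    qed
    show "integrable (lebesgue_on \<Omega>) (\<lambda>x. u x * ?\<phi> x)"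
      using \<Omega>s iu' by (subst integrable_restrict_space) (auto simp: eq simp del: real_scaleR_def)
    show "(LINT x|lebesgue_on \<Omega>. u x * ?\<phi> x) = v x1"
      using \<Omega>s iu' by (subst integral_restrict_space) (auto simp: eq simp del: real_scaleR_def)
  qed
  have "(LINT x|lebesgue_on \<Omega>. - C * (u x * ?\<phi> x)) \<le> (LINT x|lebesgue_on \<Omega>. c x * u x * ?\<phi> x)"
  proof (rule integral_mono_AE)
    show "integrable (lebesgue_on \<Omega>) (\<lambda>x. - C * (u x * ?\<phi> x))"
      using i\<Omega>(1) by (rule integrable_mult_right)
    have m: "(\<lambda>x. u x * ?\<phi> x) \<in> borel_measurable (lebesgue_on \<Omega>)"
      using i\<Omega>(1) by (rule borel_measurable_integrable)
    show "integrable (lebesgue_on \<Omega>) (\<lambda>x. c x * u x * ?\<phi> x)"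
    proof (rule Bochner_Integration.integrable_bound)
      show "integrable (lebesgue_on \<Omega>) (\<lambda>x. C * (u x * ?\<phi> x))"
        using i\<Omega>(1) by (rule integrable_mult_right)
      show "(\<lambda>x. c x * u x * ?\<phi> x) \<in> borel_measurable (lebesgue_on \<Omega>)"
        using borel_measurable_times[OF c m] by (simp add: mult.assoc)
      show "AE x in lebesgue_on \<Omega>. norm (c x * u x * ?\<phi> x) \<le> norm (C * (u x * ?\<phi> x))"
        using C(1)
      proof eventually_elim
        case (elim x)
        have "\<bar>c x\<bar> * \<bar>u x * ?\<phi> x\<bar> \<le> C * \<bar>u x * ?\<phi> x\<bar>" using elim by (intro mult_right_mono) auto
        then show ?case using C(2) by (simp add: abs_mult mult.assoc)
      qed
    qed
    show "AE x in lebesgue_on \<Omega>. - C * (u x * ?\<phi> x) \<le> c x * u x * ?\<phi> x"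
      using C(1)
    proof eventually_elim
      case (elim x)
      have "- C * (u x * ?\<phi> x) \<le> c x * (u x * ?\<phi> x)" using elim u\<phi> by (intro mult_right_mono) auto
      then show ?case by (simp add: mult.assoc)
    qed
  qed
  also have "\<dots> \<le> gagliardo_form s u ?\<phi>"
  proof -
    have "\<forall>\<phi>\<in>Hs0 s \<Omega>. (AE x in lebesgue_on \<Omega>. 0 \<le> \<phi> x) \<longrightarrow>
        (LINT x|lebesgue_on \<Omega>. c x * u x * \<phi> x) \<le> gagliardo_form s u \<phi>"
      using sup by (simp add: weak_supersolution_def)
    then have "(AE x in lebesgue_on \<Omega>. 0 \<le> ?\<phi> x) \<longrightarrow>
        (LINT x|lebesgue_on \<Omega>. c x * u x * ?\<phi> x) \<le> gagliardo_form s u ?\<phi>"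
      by (rule bspec) (rule bump_Hs0[OF e s sub])
    then show ?thesis
      by (rule mp) (rule AE_I2, rule bump_nonneg[OF e])
  qed
  also have "\<dots> = (LINT h|lborel. (2 * v x1 - v (x1 + h) - v (x1 - h)) * frac_kernel s h)"
    unfolding v_def by (rule rep(2)) simp
  finally show "- C * v x1 \<le> (LINT h|lborel. (2 * v x1 - v (x1 + h) - v (x1 - h)) * frac_kernel s h)"
    using i\<Omega> by simp
qed

section \<open>Comparison with the barrier\<close>

definition annulus :: "'a::euclidean_space \<Rightarrow> real \<Rightarrow> real \<Rightarrow> 'a set" where
  "annulus x0 \<rho> d = {y. \<rho> \<le> norm (y - x0) \<and> norm (y - x0) \<le> d}"

lemma compact_annulus: "compact (annulus x0 \<rho> d)"
proof -
  have "annulus x0 \<rho> d = cball x0 d - ball x0 \<rho>"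
    by (auto simp: annulus_def dist_norm norm_minus_commute)
  then show ?thesis by (simp add: compact_diff)
qed

lemma annulus_sets [measurable]: "annulus x0 \<rho> d \<in> sets borel"
  by (rule borel_closed[OF compact_imp_closed[OF compact_annulus]])

lemma integrable_annulus:
  fixes g :: "'a::euclidean_space \<Rightarrow> real"
  assumes s: "0 < s" "s < 1" and "0 < \<rho>" and g: "continuous_on UNIV g"
  shows "integrable lborel (\<lambda>y. indicator (annulus x0 \<rho> d) y * g y * frac_kernel s (y - x0))"
proof -
  have "integrable lborel (\<lambda>y. indicator (annulus x0 \<rho> d) y *\<^sub>R (g y * frac_kernel s (y - x0)))"
  proof (rule borel_integrable_compact[OF compact_annulus])
    show "continuous_on (annulus x0 \<rho> d) (\<lambda>y. g y * frac_kernel s (y - x0))"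
      unfolding frac_kernel_def using \<open>0 < \<rho>\<close>
      by (intro continuous_intros continuous_on_subset[OF g]) (auto simp: annulus_def)
  qed
  then show ?thesis by (simp add: mult.assoc)
qed

text \<open>
  The part over the annulus of the integral of \<open>u y * norm (y - x0) powr - (N + 2 * s)\<close>. Its divergence as
  \<open>\<rho>\<close> tends to \<open>0\<close> is the property that links the two conditions of the theorem.
\<close>

definition kernel_mass :: "real \<Rightarrow> ('a::euclidean_space \<Rightarrow> real) \<Rightarrow> 'a \<Rightarrow> real \<Rightarrow> real \<Rightarrow> real" where
  "kernel_mass s u x0 \<rho> d = (LINT y|lborel. indicator (annulus x0 \<rho> d) y * u y * frac_kernel s (y - x0))"

text \<open>
  Multiplied by a bound for the negative part of \<open>u\<close>, this controls the harm done by the negative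
  values at distance more than \<open>d\<close> from \<open>x0\<close>.
\<close>

definition kernel_tail :: "'a::euclidean_space itself \<Rightarrow> real \<Rightarrow> real \<Rightarrow> real" where
  "kernel_tail _ s d = (LINT w|lborel. indicator {w :: 'a. d < norm w} w * frac_kernel s w)"

lemma truncated_integral_tendsto:
  fixes f :: "'a::euclidean_space \<Rightarrow> real"
  assumes f: "integrable lborel f"
  shows "((\<lambda>e. LINT h|lborel. indicator {h. e \<le> norm h} h * f h) \<longlongrightarrow> (LINT h|lborel. f h)) (at_right 0)"
proof -
  have [measurable]: "f \<in> borel_measurable borel" using f by auto
  have [measurable]: "{h::'a. e \<le> norm h} \<in> sets borel" for e by measurable
  have "((\<lambda>t. LINT h|lborel. indicator {h. inverse t \<le> norm h} h * f h) \<longlongrightarrow> (LINT h|lborel. f h)) at_top"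
  proof (rule integral_dominated_convergence_at_top[where w="\<lambda>h. norm (f h)"])
    show "AE h in lborel. ((\<lambda>t. indicator {h. inverse t \<le> norm h} h * f h) \<longlongrightarrow> f h) at_top"
      using AE_lborel_singleton[of "0::'a"]
    proof eventually_elim
      case (elim h)
      have "\<forall>\<^sub>F t in at_top. inverse (norm h) \<le> t" by (rule eventually_ge_at_top)
      then have "\<forall>\<^sub>F t in at_top. indicator {h. inverse t \<le> norm h} h * f h = f h"
      proof eventually_elim
        case (elim t)
        have "inverse t \<le> inverse (inverse (norm h))"
          using elim \<open>h \<noteq> 0\<close> by (intro le_imp_inverse_le) auto
        then show ?case by simp
      qed
      then show ?case by (rule tendsto_eventually)
    qed
    show "\<forall>\<^sub>F t in at_top. AE h in lborel. norm (indicator {h. inverse t \<le> norm h} h * f h) \<le> norm (f h)"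
      by (intro always_eventually allI AE_I2) (simp add: indicator_def)
    show "integrable lborel (\<lambda>h. norm (f h))" using f by (rule integrable_norm)
  qed measurable
  then show ?thesis
    unfolding filterlim_at_right_to_top .
qed

text \<open>
  Let \<open>v - ball_profile s z r\<close> be minimal at \<open>x1\<close> among the points near \<open>x0\<close>. There the differences of \<open>v\<close> are at
  most those of the barrier. On the annulus the barrier vanishes and the nonnegative values of \<open>v\<close> lower
  the integral by a multiple of the mass of \<open>v\<close>, and beyond the distance \<open>d\<close> the values of \<open>v\<close> are at
  least \<open>- M\<close>. The factors \<open>2 powr p\<close> come from replacing the kernel centred at \<open>x1\<close> by the one
  centred at \<open>x0\<close>, both seen from outside the ball of radius \<open>\<rho>\<close>.
\<close>

lemma contact_point_operator_le:
  fixes v :: "'a::euclidean_space \<Rightarrow> real" and x0 z x1 :: 'a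
  assumes s: "0 < s" "s < 1" and v: "continuous_on UNIV v"
    and V: "integrable lborel (\<lambda>h. (2 * v x1 - v (x1 + h) - v (x1 - h)) * frac_kernel s h)"
    and \<rho>: "0 < \<rho>" "\<rho> \<le> d" and B: "ball z r \<subseteq> ball x0 (\<rho> / 2)"
    and x1: "x1 \<in> ball z r"
    and low: "\<And>y. - M \<le> v y" "0 \<le> M" and pos: "\<And>y. y \<in> cball x0 d \<Longrightarrow> 0 \<le> v y"
    and below: "v x1 \<le> ball_profile s z r x1"
    and contact: "\<And>y. y \<in> ball x0 \<rho> \<Longrightarrow> v x1 - v y \<le> ball_profile s z r x1 - ball_profile s z r y"
  defines "p \<equiv> real DIM('a) + 2 * s"
  shows "(LINT h|lborel. (2 * v x1 - v (x1 + h) - v (x1 - h)) * frac_kernel s h)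
    \<le> barrier_const TYPE('a) s + 2 * (M * (2 powr p * kernel_tail TYPE('a) s d) - 2 powr (- p) * kernel_mass s v x0 \<rho> d)"
proof -
  define \<psi> where "\<psi> = ball_profile s z r"
  \<comment> \<open>The correction to the contact inequality at points outside the ball of radius \<open>\<rho>\<close> around \<open>x0\<close>.\<close>
  define m where "m = (\<lambda>y. (if d < norm (y - x0) then M else 0) - indicator (annulus x0 \<rho> d) y * v y)"
  have [measurable]: "v \<in> borel_measurable borel" "\<psi> \<in> borel_measurable borel"
    using v by (auto intro: borel_measurable_continuous_onI simp: \<psi>_def)
  have mm [measurable]: "m \<in> borel_measurable borel" unfolding m_def by measurable
  have sh [measurable]: "{h::'a. e \<le> norm h} \<in> sets borel" for e by measurable
  have r0: "0 < r" using x1 by (metis ball_eq_empty empty_iff not_le)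
  have \<psi>0: "\<psi> y = 0" if "\<rho> \<le> norm (y - x0)" for y
  proof -
    have "y \<notin> ball x0 (\<rho> / 2)" using that \<rho> by (auto simp: dist_norm norm_minus_commute)
    then show ?thesis unfolding \<psi>_def using B r0 s by (intro ball_profile_outside) auto
  qed
  have "x1 \<in> ball x0 (\<rho> / 2)" using x1 B by blast
  then have near: "norm (x1 - x0) < \<rho> / 2" by (simp add: dist_norm norm_minus_commute)
  have comp: "v x1 - v y \<le> \<psi> x1 - \<psi> y + m y" for y
  proof -
    consider "d < norm (y - x0)" | "\<rho> \<le> norm (y - x0)" "norm (y - x0) \<le> d" | "norm (y - x0) < \<rho>" by linarith
    then show ?thesis
    proof cases
      case 1
      then show ?thesis using below low(1)[of y] \<psi>0[of y] \<rho> by (simp add: m_def annulus_def \<psi>_def)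
    next
      case 2
      then show ?thesis using below \<psi>0[of y] by (simp add: m_def annulus_def \<psi>_def)
    next
      case 3
      then show ?thesis using contact[of y] \<rho>
        by (simp add: m_def annulus_def \<psi>_def dist_norm norm_minus_commute)
    qed
  qed
  obtain Bv where Bv: "\<And>y. y \<in> annulus x0 \<rho> d \<Longrightarrow> \<bar>v y\<bar> \<le> Bv"
  proof -
    have "bounded (v ` annulus x0 \<rho> d)"
      by (intro compact_imp_bounded compact_continuous_image compact_annulus continuous_on_subset[OF v]) auto
    then show ?thesis using that unfolding bounded_iff by auto
  qed
  have mb: "\<bar>m y\<bar> \<le> M + \<bar>Bv\<bar>" for y
    using low(2) Bv[of y] by (auto simp: m_def indicator_def annulus_def)
  have m0: "m (x1 + h) = 0" if "norm h < \<rho> / 2" for h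
  proof -
    have "norm (x1 + h - x0) \<le> norm (x1 - x0) + norm h"
      using norm_triangle_ineq[of "x1 - x0" h] by (simp add: algebra_simps)
    then have "norm (x1 + h - x0) < \<rho>" using near that by linarith
    then show ?thesis using \<rho> by (simp add: m_def annulus_def)
  qed
  have im: "integrable lborel (\<lambda>h. m (x1 + h) * frac_kernel s h)"
    by (rule integrable_kernel_away[OF s, where e="\<rho> / 2" and C="M + \<bar>Bv\<bar>"]) (use \<rho> mb m0 in auto)
  define J where "J = (LINT h|lborel. m (x1 + h) * frac_kernel s h)"
  have im': "integrable lborel (\<lambda>h. m (x1 - h) * frac_kernel s h)"
    and J': "(LINT h|lborel. m (x1 - h) * frac_kernel s h) = J"
    using integral_lborel_affine_unit[of "\<lambda>h. m (x1 + h) * frac_kernel s h" "-1" 0] im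
    by (simp_all add: J_def)
  have [measurable]: "{w::'a. d < norm w} \<in> sets borel" by measurable
  have "integrable lborel (\<lambda>w::'a. indicator {w. d < norm w} w * frac_kernel s w)"
    by (rule integrable_kernel_away[OF s, where e=d and C=1]) (use \<rho> in \<open>auto simp: indicator_def\<close>)
  then have tail: "integrable lborel (\<lambda>y. indicator {w. d < norm w} (y - x0) * frac_kernel s (y - x0))"
    using integral_lborel_affine_unit(2)[of "\<lambda>w. indicator {w. d < norm w} w * frac_kernel s w" 1 "- x0"]
    by simp
  have J: "J \<le> M * (2 powr p * kernel_tail TYPE('a) s d) - 2 powr (- p) * kernel_mass s v x0 \<rho> d"
  proof -
    have "J = (LINT y|lborel. m y * frac_kernel s (y - x1))"
      using integral_lborel_affine_unit(1)[of "\<lambda>y. m y * frac_kernel s (y - x1)" 1 x1]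
      by (simp add: J_def)
    also have "\<dots> \<le> (LINT y|lborel. (M * 2 powr p) * (indicator {w. d < norm w} (y - x0) * frac_kernel s (y - x0))
        - 2 powr (- p) * (indicator (annulus x0 \<rho> d) y * v y * frac_kernel s (y - x0)))"
    proof (rule integral_mono)
      show "integrable lborel (\<lambda>y. m y * frac_kernel s (y - x1))"
        using integral_lborel_affine_unit(2)[of "\<lambda>y. m y * frac_kernel s (y - x1)" 1 x1] im by simp
      show "integrable lborel (\<lambda>y. (M * 2 powr p) * (indicator {w. d < norm w} (y - x0) * frac_kernel s (y - x0))
        - 2 powr (- p) * (indicator (annulus x0 \<rho> d) y * v y * frac_kernel s (y - x0)))"
        by (intro Bochner_Integration.integrable_diff integrable_mult_right tail integrable_annulus[OF s \<rho>(1) v])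
      fix y :: 'a
      show "m y * frac_kernel s (y - x1) \<le> (M * 2 powr p) * (indicator {w. d < norm w} (y - x0) * frac_kernel s (y - x0))
        - 2 powr (- p) * (indicator (annulus x0 \<rho> d) y * v y * frac_kernel s (y - x0))"
      proof -
        consider "d < norm (y - x0)" | "y \<in> annulus x0 \<rho> d" | "norm (y - x0) < \<rho>"
          unfolding annulus_def mem_Collect_eq by linarith
        then show ?thesis
        proof cases
          case 1
          have "norm (y - x0) \<le> norm (y - x1) + norm (x1 - x0)"
            using norm_triangle_ineq[of "y - x1" "x1 - x0"] by simp
          then have "norm (y - x0) \<le> 2 * norm (y - x1)" using near 1 \<rho> by linarith
          moreover have "y - x0 \<noteq> 0" using 1 \<rho> by auto
          ultimately have "frac_kernel s (y - x1) \<le> 2 powr p * frac_kernel s (y - x0)"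
            unfolding p_def using s by (intro frac_kernel_le) auto
          from mult_left_mono[OF this low(2)]
          show ?thesis using 1 by (simp add: m_def annulus_def mult.assoc)
        next
          case 2
          then have 3: "\<rho> \<le> norm (y - x0)" "norm (y - x0) \<le> d" by (auto simp: annulus_def)
          have "norm (y - x1) \<le> norm (y - x0) + norm (x1 - x0)"
            using norm_triangle_ineq4[of "y - x0" "x1 - x0"] by simp
          then have "norm (y - x1) \<le> 2 * norm (y - x0)" using near 3 \<rho> by linarith
          moreover have "y - x1 \<noteq> 0" using near 3 \<rho> by auto
          ultimately have "frac_kernel s (y - x0) \<le> 2 powr p * frac_kernel s (y - x1)"
            unfolding p_def using s by (intro frac_kernel_le) auto
          then have "2 powr (- p) * frac_kernel s (y - x0) \<le> 2 powr (- p) * (2 powr p * frac_kernel s (y - x1))"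
            by (rule mult_left_mono) simp
          also have "\<dots> = frac_kernel s (y - x1)" by (simp add: powr_add[symmetric] mult.assoc[symmetric])
          finally have "v y * (2 powr (- p) * frac_kernel s (y - x0)) \<le> v y * frac_kernel s (y - x1)"
            using pos[of y] 3 by (intro mult_left_mono) (auto simp: dist_norm norm_minus_commute)
          then show ?thesis using 2 3 by (simp add: m_def mult_ac)
        next
          case 3
          then show ?thesis using \<rho> by (simp add: m_def annulus_def)
        qed
      qed
    qed
    also have "\<dots> = (M * 2 powr p) * (LINT y|lborel. indicator {w. d < norm w} (y - x0) * frac_kernel s (y - x0))
        - 2 powr (- p) * kernel_mass s v x0 \<rho> d"
    proof -
      show ?thesis
        unfolding kernel_mass_def using tail integrable_annulus[OF s \<rho>(1) v, of x0 d]
        by (subst Bochner_Integration.integral_diff) (auto simp del: of_bool_eq)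
    qed
    also have "(LINT y|lborel. indicator {w. d < norm w} (y - x0) * frac_kernel s (y - x0)) = kernel_tail TYPE('a) s d"
      unfolding kernel_tail_def
      using integral_lborel_affine_unit(1)[of "\<lambda>w. indicator {w. d < norm w} w * frac_kernel s w" 1 "- x0"]
      by simp
    finally show ?thesis by (simp add: mult.assoc)
  qed
  let ?I = "\<lambda>e h. indicator {h::'a. e \<le> norm h} h :: real"
  have x1z: "norm (x1 - z) < r" using x1 by (simp add: dist_norm norm_minus_commute)
  have le: "(LINT h|lborel. ?I e h * ((2 * v x1 - v (x1 + h) - v (x1 - h)) * frac_kernel s h)) \<le>
      (LINT h|lborel. ?I e h * (2 * \<psi> x1 - \<psi> (x1 + h) - \<psi> (x1 - h)) * frac_kernel s h) + 2 * J"
    if e: "0 < e" "e \<le> \<rho> / 2" "e \<le> (r - norm (x1 - z)) / 4" for e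
  proof -
    note i\<psi> = ball_profile_truncated_operator_le(1)[OF s x1z e(1,3), folded \<psi>_def]
    have "(LINT h|lborel. ?I e h * ((2 * v x1 - v (x1 + h) - v (x1 - h)) * frac_kernel s h)) \<le>
      (LINT h|lborel. ?I e h * (2 * \<psi> x1 - \<psi> (x1 + h) - \<psi> (x1 - h)) * frac_kernel s h
        + (m (x1 + h) * frac_kernel s h + m (x1 - h) * frac_kernel s h))"
    proof (rule integral_mono)
      show "integrable lborel (\<lambda>h. ?I e h * ((2 * v x1 - v (x1 + h) - v (x1 - h)) * frac_kernel s h))"
        using integrable_real_mult_indicator[OF _ V, of "{h. e \<le> norm h}"] by (simp add: mult.commute)
      show "integrable lborel (\<lambda>h. ?I e h * (2 * \<psi> x1 - \<psi> (x1 + h) - \<psi> (x1 - h)) * frac_kernel s h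
        + (m (x1 + h) * frac_kernel s h + m (x1 - h) * frac_kernel s h))"
        by (intro Bochner_Integration.integrable_add i\<psi> im im')
      fix h :: 'a
      show "?I e h * ((2 * v x1 - v (x1 + h) - v (x1 - h)) * frac_kernel s h) \<le>
        ?I e h * (2 * \<psi> x1 - \<psi> (x1 + h) - \<psi> (x1 - h)) * frac_kernel s h
        + (m (x1 + h) * frac_kernel s h + m (x1 - h) * frac_kernel s h)"
      proof (cases "e \<le> norm h")
        case True
        have "2 * v x1 - v (x1 + h) - v (x1 - h) \<le> 2 * \<psi> x1 - \<psi> (x1 + h) - \<psi> (x1 - h) + m (x1 + h) + m (x1 - h)"
          using comp[of "x1 + h"] comp[of "x1 - h"] by linarith
        from mult_right_mono[OF this, of "frac_kernel s h"] show ?thesis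
          using True by (simp add: distrib_right)
      next
        case False
        then have "m (x1 + h) = 0" "m (x1 - h) = 0" using m0[of h] m0[of "- h"] e by auto
        then show ?thesis using False by simp
      qed
    qed
    also have "\<dots> = (LINT h|lborel. ?I e h * (2 * \<psi> x1 - \<psi> (x1 + h) - \<psi> (x1 - h)) * frac_kernel s h) + (J + J)"
      using i\<psi> im im' by (simp add: J' J_def[symmetric] del: of_bool_eq)
    finally show ?thesis by simp
  qed
  have "\<forall>\<^sub>F e in at_right 0. e \<in> {0<..<min (\<rho> / 2) ((r - norm (x1 - z)) / 4)}"
    using \<rho> x1z by (intro eventually_at_right_real) auto
  then have "\<forall>\<^sub>F e in at_right 0. (LINT h|lborel. ?I e h * ((2 * v x1 - v (x1 + h) - v (x1 - h)) * frac_kernel s h))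
      \<le> barrier_const TYPE('a) s + 2 * J"
    using ball_profile_operator_le[OF s x1z]
  proof eventually_elim
    case (elim e)
    then show ?case using le[of e] unfolding \<psi>_def by auto
  qed
  from tendsto_upperbound[OF truncated_integral_tendsto[OF V] this]
  have "(LINT h|lborel. (2 * v x1 - v (x1 + h) - v (x1 - h)) * frac_kernel s h) \<le> barrier_const TYPE('a) s + 2 * J"
    by simp
  then show ?thesis by (rule order_trans[OF _ add_left_mono[OF mult_left_mono[OF J]]]) simp
qed

section \<open>Growth at the boundary point\<close>

text \<open>
  By continuity a lower bound that holds almost everywhere in an open set holds everywhere in it.
\<close>

lemma lower_bound_from_neg_part:
  fixes u :: "'a::euclidean_space \<Rightarrow> real"
  assumes "open \<Omega>" and u: "continuous_on UNIV u" and z: "\<And>x. x \<notin> \<Omega> \<Longrightarrow> u x = 0"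
    and n: "neg_part u \<in> L_infinity \<Omega>"
  obtains M where "0 \<le> M" "\<And>x. - M \<le> u x"
proof -
  obtain C where C: "AE x in lebesgue_on \<Omega>. \<bar>neg_part u x\<bar> \<le> C"
    using n by (auto simp: L_infinity_def)
  define M where "M = max C 0"
  define S where "S = \<Omega> \<inter> {x. u x < - M}"
  have oS: "open S" unfolding S_def
    by (intro open_Int open_Collect_less continuous_intros u assms)
  have "AE x in lebesgue. x \<in> \<Omega> \<longrightarrow> \<bar>neg_part u x\<bar> \<le> C"
    using C \<open>open \<Omega>\<close> by (subst (asm) AE_restrict_space_iff) auto
  then have "AE x in lebesgue. x \<notin> S"
    by eventually_elim (auto simp: S_def M_def neg_part_def)
  then have "S \<in> null_sets lebesgue"
    using oS by (subst AE_iff_null_sets) auto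
  have "S = {}"
  proof (rule ccontr)
    assume "S \<noteq> {}"
    then obtain a e where e: "0 < e" "ball a e \<subseteq> S" using oS openE by blast
    then have "ball a e \<in> null_sets lebesgue"
      using null_sets_subset[OF \<open>S \<in> null_sets lebesgue\<close> _ e(2)] by simp
    then have "measure lebesgue (ball a e) = 0" by (simp add: measure_eq_0_null_sets)
    then show False using content_ball_pos[OF e(1), of a] by simp
  qed
  have "- M \<le> u x" for x
  proof (cases "x \<in> \<Omega>")
    case True
    then show ?thesis using \<open>S = {}\<close> by (auto simp: S_def not_less)
  qed (simp add: z M_def)
  then show ?thesis by (intro that[of M]) (auto simp: M_def)
qed

lemma kernel_mass_nonneg:
  assumes "\<And>y. y \<in> cball x0 d \<Longrightarrow> 0 \<le> u y"
  shows "0 \<le> kernel_mass s u x0 \<rho> d"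
  unfolding kernel_mass_def
proof (rule Bochner_Integration.integral_nonneg)
  fix y show "0 \<le> indicator (annulus x0 \<rho> d) y * u y * frac_kernel s (y - x0)"
    using assms[of y] by (auto simp: indicator_def annulus_def dist_norm norm_minus_commute)
qed

text \<open>
  If a mollified \<open>u\<close> is below the barrier, lowered by \<open>\<epsilon> / 2\<close>, somewhere in the ball, then at a point of contact
  the weak inequality bounds the integral of the second differences from below by \<open>- C\<close>, while
  \<open>contact_point_operator_le\<close> and the assumption on the mass bound it from above by less than \<open>- C\<close>.
  Lowering the barrier confines the points of contact to a compact subset of the ball, where bump functions of
  small radius are admissible.
\<close>

lemma supersolution_ge_ball_profile:
  fixes u c :: "'a::euclidean_space \<Rightarrow> real"
  assumes s: "0 < s" "s < 1" and u: "continuous_on UNIV u" and sup: "weak_supersolution s \<Omega> c u"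
    and \<Omega>: "open \<Omega>" and c: "c \<in> borel_measurable (lebesgue_on \<Omega>)"
    and C: "AE x in lebesgue_on \<Omega>. \<bar>c x\<bar> \<le> C" "0 \<le> C"
    and low: "\<And>y. - M \<le> u y" "0 \<le> M" and pos: "\<And>y. y \<in> cball x0 (2 * d) \<Longrightarrow> 0 \<le> u y"
    and \<rho>: "0 < \<rho>" "\<rho> \<le> d" and B: "ball z r \<subseteq> ball x0 (\<rho> / 2)" "ball z r \<subseteq> \<Omega>"
    and r: "0 < r" "r \<le> 1"
    and mass: "barrier_const TYPE('a) s + C + 2 * (M * (2 powr (real DIM('a) + 2 * s) * kernel_tail TYPE('a) s d))
      < 2 * (2 powr (- (real DIM('a) + 2 * s)) * (kernel_mass s u x0 \<rho> d - 1))"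
    and x: "x \<in> ball z r"
  shows "ball_profile s z r x \<le> u x"
proof (rule field_le_epsilon)
  fix \<epsilon> :: real assume \<epsilon>: "0 < \<epsilon>"
  define T where "T = kernel_mass s (\<lambda>_. 1) x0 \<rho> d"
  have T: "0 \<le> T" unfolding T_def by (rule kernel_mass_nonneg) auto
  define \<tau> where "\<tau> = min (\<epsilon> / 2) (1 / (T + 1))"
  have \<tau>: "0 < \<tau>" "\<tau> \<le> \<epsilon> / 2" "\<tau> * T \<le> 1"
  proof -
    show "0 < \<tau>" "\<tau> \<le> \<epsilon> / 2" using \<epsilon> T by (auto simp: \<tau>_def)
    have "\<tau> * T \<le> 1 / (T + 1) * T" using T by (intro mult_right_mono) (auto simp: \<tau>_def)
    also have "\<dots> \<le> 1" using T by simp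
    finally show "\<tau> * T \<le> 1" .
  qed
  obtain e0 where e0: "0 < e0" and
    approx: "\<And>e x. 0 < e \<Longrightarrow> e < e0 \<Longrightarrow> x \<in> cball x0 d \<Longrightarrow> \<bar>mollified (bump e) u x - u x\<bar> \<le> \<tau>"
    using mollified_uniform_approx[OF u \<tau>(1)] by metis
  define \<psi> where "\<psi> = ball_profile s z r"
  have \<psi>c: "continuous_on UNIV \<psi>" unfolding \<psi>_def by (rule ball_profile_continuous[OF s(1)])
  define K where "K = {y. \<epsilon> / 2 \<le> \<psi> y}"
  have KB: "K \<subseteq> ball z r"
    using ball_profile_outside[of s r] s r \<epsilon> by (fastforce simp: K_def \<psi>_def)
  have "closed K" unfolding K_def by (intro closed_Collect_le continuous_intros \<psi>c)
  then have cK: "compact K" using KB by (meson bounded_ball bounded_subset compact_eq_bounded_closed)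
  obtain e1 where e1: "0 < e1" "(\<Union>y\<in>K. cball y e1) \<subseteq> ball z r"
    using compact_subset_open_imp_cball_epsilon_subset[OF cK open_ball KB] by blast
  define e where "e = min (e0 / 2) (min e1 d)"
  have e: "0 < e" "e < e0" "e \<le> e1" "e \<le> d" using e0 e1 \<rho> by (auto simp: e_def)
  define v where "v = mollified (bump e) u"
  have vc: "continuous_on UNIV v" unfolding v_def by (rule continuous_mollified[OF e(1) u])
  have vlow: "- M \<le> v y" for y unfolding v_def by (rule mollified_const_le(1)[OF e(1) u]) (rule low)
  have vpos: "0 \<le> v y" if "y \<in> cball x0 d" for y
    unfolding v_def
  proof (rule mollified_const_le(1)[OF e(1) u], rule pos)
    fix k :: 'a assume "k \<in> cball 0 e"
    then show "y + k \<in> cball x0 (2 * d)"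
      using that e norm_triangle_ineq4[of "x0 - y" k] by (auto simp: dist_norm algebra_simps)
  qed
  have vu: "\<bar>v y - u y\<bar> \<le> \<tau>" if "y \<in> cball x0 d" for y unfolding v_def by (rule approx[OF e(1,2) that])
  have Bd: "y \<in> cball x0 d" if "y \<in> ball z r" for y
  proof -
    have "y \<in> ball x0 (\<rho> / 2)" using B that by blast
    then show ?thesis using \<rho> by auto
  qed
  have main: "\<psi> y - \<epsilon> / 2 \<le> v y" if yK: "y \<in> K" for y
  proof (rule ccontr)
    assume ny: "\<not> \<psi> y - \<epsilon> / 2 \<le> v y"
    have "continuous_on K (\<lambda>y. v y - \<psi> y)"
      by (intro continuous_intros continuous_on_subset[OF vc] continuous_on_subset[OF \<psi>c]) auto
    then obtain x1 where x1: "x1 \<in> K" and min: "\<And>w. w \<in> K \<Longrightarrow> v x1 - \<psi> x1 \<le> v w - \<psi> w"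
      using continuous_attains_inf[OF cK] yK by blast
    have neg: "v x1 < \<psi> x1 - \<epsilon> / 2" using min[OF yK] ny by linarith
    have x1B: "x1 \<in> ball z r" using x1 KB by blast
    have cb: "cball x1 e \<subseteq> ball z r"
      using e1(2) e(3) x1 subset_cball[of e e1 x1] by blast
    have sub: "cball x1 e \<subseteq> \<Omega>" using cb B by blast
    have pos1: "0 \<le> u w" if "w \<in> cball x1 e" for w
    proof (rule pos)
      have "w \<in> cball x0 d" using cb that Bd by blast
      then show "w \<in> cball x0 (2 * d)" using \<rho> by auto
    qed
    note sm = supersolution_mollified_ge[OF s u sup \<Omega> c C e(1) sub pos1, folded v_def]
    have contact: "v x1 - v w \<le> \<psi> x1 - \<psi> w" if "w \<in> ball x0 \<rho>" for w
    proof (cases "w \<in> K")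
      case True
      then show ?thesis using min[of w] by linarith
    next
      case False
      then have "\<psi> w < \<epsilon> / 2" by (simp add: K_def)
      moreover have "0 \<le> v w" using that \<rho> by (intro vpos) auto
      ultimately show ?thesis using neg by linarith
    qed
    have below: "v x1 \<le> \<psi> x1" using neg \<epsilon> by linarith
    note up = contact_point_operator_le[OF s vc sm(1) \<rho> B(1) x1B vlow low(2) vpos below[unfolded \<psi>_def] contact[unfolded \<psi>_def]]
    have "\<psi> x1 \<le> (r\<^sup>2) powr s" unfolding \<psi>_def by (rule ball_profile_le[OF s(1)])
    also have "\<dots> \<le> 1" using r s by (intro powr_le1) (auto simp: power_le_one)
    finally have "v x1 \<le> 1" using below by linarith
    then have CV: "C * v x1 \<le> C * 1" using C(2) by (rule mult_left_mono)
    have "kernel_mass s u x0 \<rho> d - 1 \<le> kernel_mass s v x0 \<rho> d"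
    proof -
      have "kernel_mass s u x0 \<rho> d - \<tau> * T = (LINT y|lborel. indicator (annulus x0 \<rho> d) y * u y * frac_kernel s (y - x0)
          - \<tau> * (indicator (annulus x0 \<rho> d) y * 1 * frac_kernel s (y - x0)))"
        unfolding kernel_mass_def T_def
        using integrable_annulus[OF s \<rho>(1) u, of x0 d] integrable_annulus[OF s \<rho>(1), of "\<lambda>_. 1" x0 d]
        by (subst Bochner_Integration.integral_diff) auto
      also have "\<dots> \<le> kernel_mass s v x0 \<rho> d"
        unfolding kernel_mass_def
      proof (rule integral_mono)
        show "integrable lborel (\<lambda>y. indicator (annulus x0 \<rho> d) y * u y * frac_kernel s (y - x0)
          - \<tau> * (indicator (annulus x0 \<rho> d) y * 1 * frac_kernel s (y - x0)))"
          by (intro Bochner_Integration.integrable_diff integrable_mult_right integrable_annulus[OF s \<rho>(1)] u) auto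
        show "integrable lborel (\<lambda>y. indicator (annulus x0 \<rho> d) y * v y * frac_kernel s (y - x0))"
          by (rule integrable_annulus[OF s \<rho>(1) vc])
        fix w
        show "indicator (annulus x0 \<rho> d) w * u w * frac_kernel s (w - x0)
          - \<tau> * (indicator (annulus x0 \<rho> d) w * 1 * frac_kernel s (w - x0))
          \<le> indicator (annulus x0 \<rho> d) w * v w * frac_kernel s (w - x0)"
        proof (cases "w \<in> annulus x0 \<rho> d")
          case True
          then have "u w - \<tau> \<le> v w"
            using vu[of w] by (auto simp: annulus_def dist_norm norm_minus_commute)
          from mult_right_mono[OF this, of "frac_kernel s (w - x0)"] show ?thesis
            using True by (simp add: left_diff_distrib)
        qed simp
      qed
      finally show ?thesis using \<tau>(3) by linarith
    qed
    then have QQ: "2 powr (- (real DIM('a) + 2 * s)) * (kernel_mass s u x0 \<rho> d - 1)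
        \<le> 2 powr (- (real DIM('a) + 2 * s)) * kernel_mass s v x0 \<rho> d"
      by (rule mult_left_mono) simp
    define E where "E = (LINT h|lborel. (2 * v x1 - v (x1 + h) - v (x1 - h)) * frac_kernel s h)"
    define P where "P = M * (2 powr (real DIM('a) + 2 * s) * kernel_tail TYPE('a) s d)"
    define Q where "Q = 2 powr (- (real DIM('a) + 2 * s)) * kernel_mass s v x0 \<rho> d"
    define Q' where "Q' = 2 powr (- (real DIM('a) + 2 * s)) * (kernel_mass s u x0 \<rho> d - 1)"
    have "- C * v x1 \<le> E" unfolding E_def by (rule sm(2))
    moreover have "E \<le> barrier_const TYPE('a) s + 2 * (P - Q)"
      unfolding E_def P_def Q_def by (rule up)
    moreover have "barrier_const TYPE('a) s + C + 2 * P < 2 * Q'"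
      unfolding P_def Q'_def by (rule mass)
    moreover have "Q' \<le> Q" unfolding Q_def Q'_def by (rule QQ)
    ultimately show False using CV by (simp add: algebra_simps)
  qed
  have xd: "x \<in> cball x0 d" using x Bd by blast
  show "ball_profile s z r x \<le> u x + \<epsilon>"
  proof (cases "x \<in> K")
    case True
    then show ?thesis using main[OF True] vu[OF xd] \<tau>(2) by (simp add: \<psi>_def)
  next
    case False
    have "0 \<le> u x" by (rule pos) (use xd \<rho> in auto)
    then show ?thesis using False \<epsilon> by (simp add: K_def \<psi>_def)
  qed
qed

text \<open>
  On the ball of radius \<open>r / 2\<close> the integrand is at least a constant times
  \<open>r powr (2 * s) * r powr - (N + 2 * s)\<close>, so the ball contributes an amount independent of \<open>r\<close>. Balls
  of sufficiently different scales are disjoint. The exponent \<open>2 * s\<close> is critical here: the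
  divergence is logarithmic, for every \<open>\<kappa> > 0\<close>.
\<close>

lemma kernel_mass_unbounded:
  fixes u :: "'a::euclidean_space \<Rightarrow> real"
  assumes s: "0 < s" "s < 1" and u: "continuous_on UNIV u"
    and pos: "\<And>y. y \<in> cball x0 d \<Longrightarrow> 0 \<le> u y" and d: "0 < d" and \<kappa>: "0 < \<kappa>"
    and balls: "\<And>\<epsilon>. 0 < \<epsilon> \<Longrightarrow> \<exists>r z. 0 < r \<and> r < \<epsilon> \<and> dist z x0 = r \<and> (\<forall>x\<in>ball z (r / 2). \<kappa> * r powr (2 * s) \<le> u x)"
  shows "\<exists>\<rho>. 0 < \<rho> \<and> \<rho> \<le> d \<and> Q < kernel_mass s u x0 \<rho> d"
proof -
  define p where "p = real DIM('a) + 2 * s"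
  define \<omega> where "\<omega> = measure lborel (ball (0::'a) 1)"
  define \<kappa>' where "\<kappa>' = \<kappa> * (3 / 2) powr (- p) * (1 / 2) ^ DIM('a) * \<omega>"
  have \<omega>: "0 < \<omega>" unfolding \<omega>_def using content_ball_pos[of 1 "0::'a"] by simp
  have \<kappa>': "0 < \<kappa>'" using \<kappa> \<omega> by (simp add: \<kappa>'_def)
  have ind: "\<exists>\<rho>. 0 < \<rho> \<and> \<rho> \<le> d \<and> real n * \<kappa>' \<le> kernel_mass s u x0 \<rho> d" for n
  proof (induction n)
    case 0
    show ?case using d kernel_mass_nonneg[of x0 d u s d] pos by (intro exI[of _ d]) auto
  next
    case (Suc n)
    then obtain \<rho> where \<rho>: "0 < \<rho>" "\<rho> \<le> d" "real n * \<kappa>' \<le> kernel_mass s u x0 \<rho> d" by blast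
    have "0 < \<rho> / 2" using \<rho> by simp
    from balls[OF this] obtain r z where r: "0 < r" "r < \<rho> / 2" "dist z x0 = r"
      and ub: "\<And>x. x \<in> ball z (r / 2) \<Longrightarrow> \<kappa> * r powr (2 * s) \<le> u x"
      by blast
    define b where "b = \<kappa> * r powr (2 * s) * (3 / 2 * r) powr (- p)"
    have b: "b * measure lborel (ball z (r / 2)) = \<kappa>'"
    proof -
      have "measure lborel (ball z (r / 2)) = (1 / 2) ^ DIM('a) * r powr real DIM('a) * \<omega>"
        unfolding \<omega>_def using r content_ball_conv_unit_ball[of "r / 2" z]
        by (simp add: powr_realpow power_divide)
      moreover have powr_three_halves: "(3 / 2 * r) powr (- p) = (3 / 2) powr (- p) * r powr (- p)"
        by (rule powr_mult)
      ultimately have "b * measure lborel (ball z (r / 2)) =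
        \<kappa>' * (r powr (2 * s) * r powr (- p) * r powr real DIM('a))"
        unfolding b_def \<kappa>'_def powr_three_halves by simp
      also have "r powr (2 * s) * r powr (- p) * r powr real DIM('a) = 1"
        using r by (simp only: powr_add[symmetric]) (simp add: p_def)
      finally show ?thesis by simp
    qed
    have "kernel_mass s u x0 \<rho> d + \<kappa>' = (LINT y|lborel. indicator (annulus x0 \<rho> d) y * u y * frac_kernel s (y - x0)
        + b * indicator (ball z (r / 2)) y)"
    proof -
      have "integrable lborel (\<lambda>y. b * indicator (ball z (r / 2)) y)"
        using emeasure_lborel_ball_finite[of z "r / 2"]
        by (intro integrable_mult_right integrable_real_indicator) auto
      then show ?thesis unfolding kernel_mass_def
        using integrable_annulus[OF s \<rho>(1) u, of x0 d] b
        by (subst Bochner_Integration.integral_add) auto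
    qed
    also have "\<dots> \<le> kernel_mass s u x0 (r / 2) d"
      unfolding kernel_mass_def
    proof (rule integral_mono)
      show "integrable lborel (\<lambda>y. indicator (annulus x0 \<rho> d) y * u y * frac_kernel s (y - x0)
        + b * indicator (ball z (r / 2)) y)"
        using emeasure_lborel_ball_finite[of z "r / 2"]
        by (intro Bochner_Integration.integrable_add integrable_mult_right integrable_real_indicator integrable_annulus[OF s \<rho>(1) u]) auto
      show "integrable lborel (\<lambda>y. indicator (annulus x0 (r / 2) d) y * u y * frac_kernel s (y - x0))"
        using r by (intro integrable_annulus s u) auto
      fix y
      have k: "0 \<le> frac_kernel s (y - x0)" by simp
      show "indicator (annulus x0 \<rho> d) y * u y * frac_kernel s (y - x0) + b * indicator (ball z (r / 2)) y
        \<le> indicator (annulus x0 (r / 2) d) y * u y * frac_kernel s (y - x0)"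
      proof (cases "y \<in> ball z (r / 2)")
        case True
        have "norm (y - x0) \<le> norm (y - z) + norm (z - x0)"
          using norm_triangle_ineq[of "y - z" "z - x0"] by simp
        moreover have "norm (z - x0) \<le> norm (y - z) + norm (y - x0)"
          using norm_triangle_ineq4[of "y - x0" "y - z"] by simp
        moreover have "norm (y - z) < r / 2" "norm (z - x0) = r"
          using True r by (auto simp: dist_norm norm_minus_commute)
        ultimately have n: "norm (y - x0) < 3 / 2 * r" "r / 2 < norm (y - x0)" by linarith+
        have "(3 / 2 * r) powr (- p) \<le> norm (y - x0) powr (- p)"
          using n r s by (intro powr_mono2') (auto simp: p_def)
        also have "\<dots> = frac_kernel s (y - x0)" unfolding frac_kernel_def p_def by (rule powr_minus_divide)
        finally have k_ge: "(3 / 2 * r) powr (- p) \<le> frac_kernel s (y - x0)" .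
        have "0 \<le> \<kappa> * r powr (2 * s)" using \<kappa> by simp
        then have "0 \<le> u y" using ub[OF True] by linarith
        then have "b \<le> u y * frac_kernel s (y - x0)"
          unfolding b_def using ub[OF True] k_ge by (intro mult_mono) auto
        moreover have "y \<notin> annulus x0 \<rho> d" "y \<in> annulus x0 (r / 2) d"
          using n r(1,2) \<rho> by (auto simp: annulus_def)
        ultimately show ?thesis using True by simp
      next
        case False
        have "0 \<le> u y" if "y \<in> annulus x0 (r / 2) d"
          using that pos[of y] by (auto simp: annulus_def dist_norm norm_minus_commute)
        moreover have "annulus x0 \<rho> d \<subseteq> annulus x0 (r / 2) d" using r(1,2) by (auto simp: annulus_def)
        ultimately show ?thesis using False k
          by (cases "y \<in> annulus x0 \<rho> d"; cases "y \<in> annulus x0 (r / 2) d") auto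
      qed
    qed
    finally have "real (Suc n) * \<kappa>' \<le> kernel_mass s u x0 (r / 2) d" using \<rho>(3) by (simp add: algebra_simps)
    then show ?case using r \<rho> by (intro exI[of _ "r / 2"]) auto
  qed
  obtain n where "Q < real n * \<kappa>'" using reals_Archimedean3[OF \<kappa>'] by blast
  then show ?thesis using ind[of n] by force
qed

text \<open>
  The constants in the requirement on the mass depend neither on \<open>\<rho>\<close> nor on the ball, so
  \<open>\<rho>\<close> can be chosen first; after that every small ball in \<open>\<Omega>\<close> with \<open>x0\<close> on its boundary is allowed,
  whatever its direction.
\<close>

lemma supersolution_ge_ball_profile_of_growth:
  fixes u c :: "'a::euclidean_space \<Rightarrow> real"
  assumes s: "0 < s" "s < 1" and \<Omega>: "open \<Omega>" and c: "c \<in> L_infinity \<Omega>" and u: "continuous_on UNIV u"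
    and sup: "weak_supersolution s \<Omega> c u" and n: "neg_part u \<in> L_infinity \<Omega>"
    and \<delta>: "0 < \<delta>" and pos: "\<forall>x \<in> ball x0 \<delta> \<inter> \<Omega>. 0 \<le> u x"
    and \<kappa>: "0 < \<kappa>"
    and balls: "\<And>\<epsilon>. 0 < \<epsilon> \<Longrightarrow> \<exists>r z. 0 < r \<and> r < \<epsilon> \<and> dist z x0 = r \<and> (\<forall>x\<in>ball z (r / 2). \<kappa> * r powr (2 * s) \<le> u x)"
  obtains r0 where "0 < r0"
    and "\<And>r z x. 0 < r \<Longrightarrow> r \<le> r0 \<Longrightarrow> ball z r \<subseteq> \<Omega> \<Longrightarrow> dist z x0 = r \<Longrightarrow> x \<in> ball z r \<Longrightarrow> ball_profile s z r x \<le> u x"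
proof -
  have z: "u x = 0" if "x \<notin> \<Omega>" for x using sup that by (simp add: weak_supersolution_def)
  obtain M where M: "0 \<le> M" "\<And>x. - M \<le> u x"
    using lower_bound_from_neg_part[OF \<Omega> u z n] by blast
  obtain C0 where C0: "AE x in lebesgue_on \<Omega>. \<bar>c x\<bar> \<le> C0" and cm: "c \<in> borel_measurable (lebesgue_on \<Omega>)"
    using c by (auto simp: L_infinity_def)
  define C where "C = max C0 0"
  have C: "AE x in lebesgue_on \<Omega>. \<bar>c x\<bar> \<le> C" "0 \<le> C"
    using C0 by (auto simp: C_def elim!: eventually_mono)
  define d where "d = \<delta> / 4"
  have d: "0 < d" using \<delta> by (simp add: d_def)
  have pos2: "0 \<le> u y" if "y \<in> cball x0 (2 * d)" for y
  proof (cases "y \<in> \<Omega>")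
    case True
    moreover have "y \<in> ball x0 \<delta>" using that \<delta> by (simp add: d_def)
    ultimately show ?thesis using pos by blast
  qed (simp add: z)
  \<comment> \<open>All bounded contributions, which the mass has to exceed.\<close>
  define P where "P = barrier_const TYPE('a) s + C + 2 * (M * (2 powr (real DIM('a) + 2 * s) * kernel_tail TYPE('a) s d))"
  define q where "q = 2 powr (- (real DIM('a) + 2 * s))"
  have q: "0 < q" by (simp add: q_def)
  obtain \<rho> where \<rho>: "0 < \<rho>" "\<rho> \<le> d" and "P / (2 * q) + 1 < kernel_mass s u x0 \<rho> d"
    using kernel_mass_unbounded[OF s u _ d \<kappa> balls, of "P / (2 * q) + 1"] pos2 d by auto
  then have mass: "P < 2 * (q * (kernel_mass s u x0 \<rho> d - 1))"
    using q by (simp add: field_simps)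
  show thesis
  proof (rule that[of "min 1 (\<rho> / 4)"])
    fix r z x assume r: "0 < r" "r \<le> min 1 (\<rho> / 4)" and B: "ball z r \<subseteq> \<Omega>" and zr: "dist z x0 = r"
      and x: "x \<in> ball z r"
    have "ball z r \<subseteq> ball x0 (\<rho> / 2)"
    proof
      fix y assume "y \<in> ball z r"
      then have "dist x0 y < r + r" using dist_triangle[of x0 y z] zr by (simp add: dist_commute)
      then show "y \<in> ball x0 (\<rho> / 2)" using r by auto
    qed
    then show "ball_profile s z r x \<le> u x"
      by (intro supersolution_ge_ball_profile[OF s u sup \<Omega> cm C M(2,1) pos2 \<rho> _ B _ _ mass[unfolded P_def q_def] x])
        (use r in auto)
  qed (use \<rho> in auto)
qed

lemma arccos_less_iff:
  assumes "0 \<le> \<beta>" "\<beta> \<le> pi" "\<bar>y\<bar> \<le> 1"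
  shows "arccos y < \<beta> \<longleftrightarrow> cos \<beta> < y"
  using arccos_less_mono[of y "cos \<beta>"] assms by (simp add: arccos_cos)

theorem theorem4p1:
  fixes \<Omega> :: "'a::euclidean_space set" and s :: real and c u :: "'a \<Rightarrow> real"
    and x0 y0 :: 'a and R \<delta> :: real and z :: "real \<Rightarrow> 'a"
  assumes "0 < s" and "s < 1"
    and "open \<Omega>"
    and "c \<in> L_infinity \<Omega>"
    and "u \<in> Hs0 s \<Omega>" and "continuous_on UNIV u"
    and "weak_supersolution s \<Omega> c u"
    and "neg_part u \<in> L_infinity \<Omega>"
    and "x0 \<in> frontier \<Omega>"
    and "0 < R" and "ball y0 R \<subseteq> \<Omega>" and "x0 \<in> frontier (ball y0 R)"
    and "0 < \<delta>" and "\<forall>x \<in> ball x0 \<delta> \<inter> \<Omega>. 0 \<le> u x"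
    and "\<forall>\<^sub>F r in at_right 0. z r \<in> \<Omega> \<and> ball (z r) r \<subseteq> \<Omega> \<and> x0 \<in> frontier (ball (z r) r)"
  shows "Limsup (at_right 0)
           (\<lambda>r. ereal (1 / r powr (2 * s) * (INF x\<in>ball (z r) (r / 2). \<bar>u x\<bar>))) > 0
     \<longleftrightarrow> (\<forall>\<beta>. 0 < \<beta> \<and> \<beta> < pi / 2 \<longrightarrow>
           Liminf (at x0 within interior_cone \<Omega> x0 y0 \<beta>)
             (\<lambda>x. ereal (u x / norm (x - x0) powr s)) > 0)"
  (is "?i \<longleftrightarrow> ?ii")
proof -
  note s = assms(1,2)
  define e where "e = (y0 - x0) /\<^sub>R norm (y0 - x0)"
  have y0: "norm (y0 - x0) = R" using assms(10,12) by (simp add: frontier_ball dist_norm)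
  then have e: "norm e = 1" "y0 - x0 = R *\<^sub>R e" using assms(10) by (auto simp: e_def)
  have ee: "e \<bullet> e = 1" using e(1) by (simp add: norm_eq_1)
  have z_ev: "\<forall>\<^sub>F r in at_right 0. 0 < r \<and> ball (z r) r \<subseteq> \<Omega> \<and> dist (z r) x0 = r"
    using assms(15) eventually_at_right_less[of 0]
    by eventually_elim (auto simp: frontier_ball)
  \<comment> \<open>Smaller balls inside the interior ball, tangent to it at \<open>x0\<close>.\<close>
  have tangent: "ball (x0 + r *\<^sub>R e) r \<subseteq> ball y0 R" "dist (x0 + r *\<^sub>R e) x0 = r" if "0 < r" "r \<le> R" for r
  proof -
    have "dist y0 (x0 + r *\<^sub>R e) = norm ((R - r) *\<^sub>R e)"
      using e by (simp add: dist_norm algebra_simps)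
    then have 1: "dist y0 (x0 + r *\<^sub>R e) = R - r" using that e by simp
    show "ball (x0 + r *\<^sub>R e) r \<subseteq> ball y0 R"
    proof
      fix x assume "x \<in> ball (x0 + r *\<^sub>R e) r"
      then show "x \<in> ball y0 R" using 1 dist_triangle[of y0 x "x0 + r *\<^sub>R e"] by simp
    qed
    show "dist (x0 + r *\<^sub>R e) x0 = r" using that e by (simp add: dist_norm)
  qed
  have cone: "x \<in> interior_cone \<Omega> x0 y0 \<beta> \<longleftrightarrow> x \<in> \<Omega> \<and> cos \<beta> * norm (x - x0) < (x - x0) \<bullet> e"
    if "0 < \<beta>" "\<beta> < pi / 2" "x \<noteq> x0" for x \<beta>
  proof -
    define y where "y = ((x - x0) /\<^sub>R norm (x - x0)) \<bullet> e"
    have "\<bar>y\<bar> \<le> norm ((x - x0) /\<^sub>R norm (x - x0)) * norm e" unfolding y_def by (rule Cauchy_Schwarz_ineq2)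
    then have "\<bar>y\<bar> \<le> 1" using that e by simp
    then have "arccos y < \<beta> \<longleftrightarrow> cos \<beta> < y" using that by (intro arccos_less_iff) auto
    moreover have "y = ((x - x0) \<bullet> e) / norm (x - x0)" by (simp add: y_def divide_inverse mult.commute)
    then have "cos \<beta> < y \<longleftrightarrow> cos \<beta> * norm (x - x0) < (x - x0) \<bullet> e"
      using that by (simp add: pos_less_divide_eq)
    moreover have "x \<in> interior_cone \<Omega> x0 y0 \<beta> \<longleftrightarrow> x \<in> \<Omega> \<and> arccos y < \<beta>"
      unfolding interior_cone_def y_def e_def by simp
    ultimately show ?thesis by simp
  qed
  note core = supersolution_ge_ball_profile_of_growth[OF s assms(3,4,6,7,8,13,14)]
  have conclude: "?i \<and> ?ii" if \<kappa>: "0 < \<kappa>" and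
    balls: "\<And>\<epsilon>. 0 < \<epsilon> \<Longrightarrow> \<exists>r z. 0 < r \<and> r < \<epsilon> \<and> dist z x0 = r \<and> (\<forall>x\<in>ball z (r / 2). \<kappa> * r powr (2 * s) \<le> u x)" for \<kappa>
  proof -
    obtain r0 where r0: "0 < r0" and ge: "\<And>r z x. 0 < r \<Longrightarrow> r \<le> r0 \<Longrightarrow> ball z r \<subseteq> \<Omega> \<Longrightarrow> dist z x0 = r \<Longrightarrow>
        x \<in> ball z r \<Longrightarrow> ball_profile s z r x \<le> u x"
      using core[OF \<kappa> balls] by blast
    have ?i
    proof -
      have "\<forall>\<^sub>F r in at_right 0. ereal ((3 / 4) powr s) \<le> ereal (1 / r powr (2 * s) * (INF x\<in>ball (z r) (r / 2). \<bar>u x\<bar>))"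
        using z_ev eventually_at_right_real[OF r0]
      proof eventually_elim
        case (elim r)
        have "(3 / 4) powr s * r powr (2 * s) \<le> (INF x\<in>ball (z r) (r / 2). \<bar>u x\<bar>)"
        proof (rule cINF_greatest)
          fix x assume x: "x \<in> ball (z r) (r / 2)"
          then have "(norm (x - z r))\<^sup>2 \<le> (r / 2)\<^sup>2"
            by (intro power_mono) (auto simp: dist_norm norm_minus_commute)
          then have "(3 / 4) * r\<^sup>2 \<le> r\<^sup>2 - (norm (x - z r))\<^sup>2" by (simp add: power_divide)
          then have "(3 / 4) * r\<^sup>2 \<le> max 0 (r\<^sup>2 - (norm (x - z r))\<^sup>2)" by (rule max.coboundedI2)
          then have "((3 / 4) * r\<^sup>2) powr s \<le> ball_profile s (z r) r x"
            unfolding ball_profile_def using s by (intro powr_mono2) auto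
          also have "((3 / 4) * r\<^sup>2) powr s = (3 / 4) powr s * (r\<^sup>2) powr s"
            by (rule powr_mult)
          also have "(r\<^sup>2) powr s = r powr (2 * s)"
            using elim by (simp add: powr_powr[symmetric] powr_numeral)
          also have "ball_profile s (z r) r x \<le> u x" using elim x by (intro ge) auto
          finally show "(3 / 4) powr s * r powr (2 * s) \<le> \<bar>u x\<bar>" by linarith
        qed (use elim in auto)
        then show ?case using elim by (simp add: field_simps)
      qed
      then have "ereal ((3 / 4) powr s) \<le> Liminf (at_right 0) (\<lambda>r. ereal (1 / r powr (2 * s) * (INF x\<in>ball (z r) (r / 2). \<bar>u x\<bar>)))"
        by (rule Liminf_bounded)
      also have "\<dots> \<le> Limsup (at_right 0) (\<lambda>r. ereal (1 / r powr (2 * s) * (INF x\<in>ball (z r) (r / 2). \<bar>u x\<bar>)))"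
        by (rule Liminf_le_Limsup) simp
      finally show ?thesis by (rule less_le_trans[rotated]) simp
    qed
    moreover have ?ii
    proof (intro allI impI, elim conjE)
      fix \<beta> :: real assume \<beta>: "0 < \<beta>" "\<beta> < pi / 2"
      define r where "r = min r0 R"
      have r: "0 < r" "r \<le> r0" "r \<le> R" using r0 assms(10) by (auto simp: r_def)
      \<comment> \<open>In the cone \<open>r\<^sup>2 - (norm (x - z))\<^sup>2 \<ge> t * (2 * r * cos \<beta> - t)\<close> with \<open>t = norm (x - x0)\<close>, hence \<open>a * t\<close> is a lower bound for \<open>t < a\<close>.\<close>
      define a where "a = r * cos \<beta>"
      have a: "0 < a" using r \<beta> by (simp add: a_def cos_gt_zero)
      have "\<forall>\<^sub>F x in at x0 within interior_cone \<Omega> x0 y0 \<beta>. ereal (a powr s) \<le> ereal (u x / norm (x - x0) powr s)"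
        unfolding eventually_at
      proof (intro exI[of _ a] conjI ballI impI a)
        fix x assume x: "x \<in> interior_cone \<Omega> x0 y0 \<beta>" "x \<noteq> x0 \<and> dist x x0 < a"
        define t where "t = norm (x - x0)"
        have t: "0 < t" "t < a" using x(2) by (auto simp: t_def dist_norm)
        have ang: "cos \<beta> * t < (x - x0) \<bullet> e" using cone[OF \<beta>] x by (auto simp: t_def)
        let ?z = "x0 + r *\<^sub>R e"
        have "(norm (x - ?z))\<^sup>2 = (norm ((x - x0) - r *\<^sub>R e))\<^sup>2" by (simp add: algebra_simps)
        also have "\<dots> = t\<^sup>2 - 2 * r * ((x - x0) \<bullet> e) + r\<^sup>2"
          unfolding t_def power2_norm_eq_inner using ee
          by (simp add: inner_diff_left inner_diff_right inner_commute power2_eq_square algebra_simps)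
        finally have "r\<^sup>2 - (norm (x - ?z))\<^sup>2 = 2 * r * ((x - x0) \<bullet> e) - t\<^sup>2" by simp
        moreover have "2 * r * (cos \<beta> * t) \<le> 2 * r * ((x - x0) \<bullet> e)"
          using ang r by (intro mult_left_mono) auto
        moreover have "t * t \<le> a * t" using t by (intro mult_right_mono) auto
        ultimately have q: "a * t \<le> r\<^sup>2 - (norm (x - ?z))\<^sup>2"
          by (simp add: a_def power2_eq_square algebra_simps)
        moreover have "0 < a * t" using a t by simp
        ultimately have "(norm (x - ?z))\<^sup>2 < r\<^sup>2" by linarith
        then have "norm (x - ?z) < r" by (rule power_less_imp_less_base) (use r in simp)
        then have xb: "x \<in> ball ?z r" by (simp add: dist_norm norm_minus_commute)
        have "(a * t) powr s \<le> ball_profile s ?z r x"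
          unfolding ball_profile_def using q a t s by (intro powr_mono2) auto
        also have "\<dots> \<le> u x"
          using tangent[OF r(1,3)] assms(11) r xb by (intro ge) auto
        finally have "a powr s * t powr s \<le> u x" using a t by (simp add: powr_mult)
        then show "ereal (a powr s) \<le> ereal (u x / norm (x - x0) powr s)"
          using t by (simp add: t_def[symmetric] pos_le_divide_eq)
      qed
      then have "ereal (a powr s) \<le> Liminf (at x0 within interior_cone \<Omega> x0 y0 \<beta>) (\<lambda>x. ereal (u x / norm (x - x0) powr s))"
        by (rule Liminf_bounded)
      moreover have "0 < ereal (a powr s)" using a by simp
      ultimately show "0 < Liminf (at x0 within interior_cone \<Omega> x0 y0 \<beta>) (\<lambda>x. ereal (u x / norm (x - x0) powr s))"
        by (rule less_le_trans[rotated])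
    qed
    ultimately show ?thesis by blast
  qed
  show ?thesis
  proof
    assume ?i
    then obtain \<kappa> where \<kappa>: "0 < ereal \<kappa>" "ereal \<kappa> < Limsup (at_right 0)
           (\<lambda>r. ereal (1 / r powr (2 * s) * (INF x\<in>ball (z r) (r / 2). \<bar>u x\<bar>)))"
      using ereal_dense2 by blast
    have fr: "\<exists>\<^sub>F r in at_right 0. ereal \<kappa> < ereal (1 / r powr (2 * s) * (INF x\<in>ball (z r) (r / 2). \<bar>u x\<bar>))"
    proof (rule ccontr)
      assume "\<not> ?thesis"
      then have "\<forall>\<^sub>F r in at_right 0. ereal (1 / r powr (2 * s) * (INF x\<in>ball (z r) (r / 2). \<bar>u x\<bar>)) \<le> ereal \<kappa>"
        by (simp add: frequently_def not_less)
      from Limsup_bounded[OF this] show False using \<kappa>(2) by simp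
    qed
    show ?ii
    proof (rule conclude[THEN conjunct2])
      show "0 < \<kappa>" using \<kappa>(1) by simp
      fix \<epsilon> :: real assume \<epsilon>: "0 < \<epsilon>"
      have "\<forall>\<^sub>F r in at_right 0. r \<in> {0<..<min \<epsilon> (\<delta> / 2)}"
        using \<epsilon> assms(13) by (intro eventually_at_right_real) auto
      with z_ev have "\<forall>\<^sub>F r in at_right 0. (0 < r \<and> ball (z r) r \<subseteq> \<Omega> \<and> dist (z r) x0 = r) \<and> r \<in> {0<..<min \<epsilon> (\<delta> / 2)}"
        by (rule eventually_conj)
      from frequently_ex[OF frequently_eventually_conj[OF fr this]]
      obtain r where r: "0 < r" "ball (z r) r \<subseteq> \<Omega>" "dist (z r) x0 = r" "r < \<epsilon>" "r < \<delta> / 2"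
        and big: "\<kappa> < 1 / r powr (2 * s) * (INF x\<in>ball (z r) (r / 2). \<bar>u x\<bar>)" by auto
      have "\<kappa> * r powr (2 * s) \<le> u x" if x: "x \<in> ball (z r) (r / 2)" for x
      proof -
        have "\<kappa> * r powr (2 * s) \<le> (INF x\<in>ball (z r) (r / 2). \<bar>u x\<bar>)"
          using big r by (simp add: field_simps)
        also have "\<dots> \<le> \<bar>u x\<bar>"
          by (rule cINF_lower) (use x in \<open>auto intro!: bdd_belowI[of _ 0]\<close>)
        also have "\<bar>u x\<bar> = u x"
        proof -
          have "x \<in> ball (z r) r" using x r(1) by simp
          then have "x \<in> \<Omega>" using r(2) by blast
          moreover have "x \<in> ball x0 \<delta>"
            using x r dist_triangle[of x0 x "z r"] by (simp add: dist_commute)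
          ultimately show ?thesis using assms(14) by simp
        qed
        finally show ?thesis .
      qed
      then show "\<exists>r z. 0 < r \<and> r < \<epsilon> \<and> dist z x0 = r \<and> (\<forall>x\<in>ball z (r / 2). \<kappa> * r powr (2 * s) \<le> u x)"
        using r by blast
    qed
  next
    assume ii: ?ii
    have "0 < Liminf (at x0 within interior_cone \<Omega> x0 y0 (pi / 4)) (\<lambda>x. ereal (u x / norm (x - x0) powr s))"
      using ii[rule_format, of "pi / 4"] by simp
    then obtain \<kappa> where \<kappa>: "0 < ereal \<kappa>"
      "ereal \<kappa> < Liminf (at x0 within interior_cone \<Omega> x0 y0 (pi / 4)) (\<lambda>x. ereal (u x / norm (x - x0) powr s))"
      using ereal_dense2 by blast
    from less_LiminfD[OF \<kappa>(2)] obtain \<eta> where \<eta>: "0 < \<eta>" and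
      lower: "\<And>x. x \<in> interior_cone \<Omega> x0 y0 (pi / 4) \<Longrightarrow> x \<noteq> x0 \<Longrightarrow> dist x x0 < \<eta> \<Longrightarrow> \<kappa> < u x / norm (x - x0) powr s"
      unfolding eventually_at by auto
    have \<kappa>0: "0 < \<kappa>" using \<kappa>(1) by simp
    show ?i
    proof (rule conclude[THEN conjunct1])
      show "0 < \<kappa> * (1 / 2) powr s" using \<kappa>0 by simp
      fix \<epsilon> :: real assume \<epsilon>: "0 < \<epsilon>"
      \<comment> \<open>The ball of radius \<open>r / 2\<close> around \<open>x0 + r *\<^sub>R e\<close> is seen from \<open>x0\<close> under the angle \<open>pi / 6\<close>, so the cone of angle \<open>pi / 4\<close> contains it.\<close>
      define r where "r = min (min 1 (R / 2)) (min (\<epsilon> / 2) (\<eta> / 2))"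
      have r: "0 < r" "r \<le> 1" "r < R" "r < \<epsilon>" "r \<le> \<eta> / 2"
        using \<epsilon> \<eta> assms(10) by (auto simp: r_def min_less_iff_disj)
      let ?z = "x0 + r *\<^sub>R e"
      have "\<kappa> * (1 / 2) powr s * r powr (2 * s) \<le> u x" if x: "x \<in> ball ?z (r / 2)" for x
      proof -
        define w where "w = x - ?z"
        have w: "norm w < r / 2" using x by (simp add: w_def dist_norm norm_minus_commute)
        have xw: "x - x0 = r *\<^sub>R e + w" by (simp add: w_def)
        have n1: "r / 2 < norm (x - x0)" "norm (x - x0) < 3 / 2 * r"
          using norm_triangle_ineq[of "r *\<^sub>R e" w] norm_diff_ineq[of "r *\<^sub>R e" w] w r e
          unfolding xw by auto
        have "x \<in> ball ?z r" using x r by simp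
        then have "x \<in> \<Omega>" using tangent(1)[of r] r(1,3) assms(11) by (meson less_imp_le subsetD)
        define b where "b = w \<bullet> e"
        have "\<bar>b\<bar> \<le> norm w" unfolding b_def using Cauchy_Schwarz_ineq2[of w e] e by simp
        then have rb: "0 < r + b" using w r by linarith
        have d: "(x - x0) \<bullet> e = r + b" unfolding xw b_def using ee by (simp add: inner_add_left)
        have "(norm (x - x0))\<^sup>2 = r\<^sup>2 + 2 * r * b + (norm w)\<^sup>2"
          unfolding xw b_def power2_norm_eq_inner using ee
          by (simp add: inner_add_left inner_add_right inner_commute power2_eq_square algebra_simps)
        also have "(norm w)\<^sup>2 < (r / 2)\<^sup>2" using w by (intro power_strict_mono) auto
        also have "r\<^sup>2 + 2 * r * b + (r / 2)\<^sup>2 \<le> 2 * (r + b)\<^sup>2"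
        proof -
          have "0 \<le> 2 * (r + 2 * b)\<^sup>2 + r\<^sup>2" by simp
          then show ?thesis by (simp add: power2_eq_square algebra_simps)
        qed
        finally have "(norm (x - x0))\<^sup>2 < 2 * (r + b)\<^sup>2" by simp
        moreover have "(sqrt 2 / 2 * norm (x - x0))\<^sup>2 = (norm (x - x0))\<^sup>2 / 2"
          by (simp add: power_mult_distrib power_divide)
        ultimately have "(sqrt 2 / 2 * norm (x - x0))\<^sup>2 < (r + b)\<^sup>2" by linarith
        then have "sqrt 2 / 2 * norm (x - x0) < r + b"
          by (rule power_less_imp_less_base) (use rb in simp)
        moreover have "x \<noteq> x0" using n1(1) r(1) by auto
        ultimately have "x \<in> interior_cone \<Omega> x0 y0 (pi / 4)"
          using cone[of "pi / 4" x] \<open>x \<in> \<Omega>\<close> d by (auto simp: cos_45)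
        moreover note \<open>x \<noteq> x0\<close>
        moreover have "dist x x0 < \<eta>" using n1 r by (simp add: dist_norm)
        ultimately have "\<kappa> < u x / norm (x - x0) powr s" by (rule lower)
        then have "\<kappa> * norm (x - x0) powr s < u x" using \<open>x \<noteq> x0\<close> by (simp add: field_simps)
        moreover have "(1 / 2) powr s * r powr (2 * s) \<le> norm (x - x0) powr s"
        proof -
          have "r powr (2 * s) \<le> r powr s" using r s by (intro powr_mono') auto
          then have "(1 / 2) powr s * r powr (2 * s) \<le> (1 / 2) powr s * r powr s"
            by (intro mult_left_mono) auto
          also have "\<dots> = (r / 2) powr s" using r by (simp add: powr_divide)
          also have "\<dots> \<le> norm (x - x0) powr s" using n1 r s by (intro powr_mono2) auto
          finally show ?thesis .
        qed
        then have "\<kappa> * ((1 / 2) powr s * r powr (2 * s)) \<le> \<kappa> * norm (x - x0) powr s"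
          using \<kappa>0 by (intro mult_left_mono) auto
        ultimately show ?thesis unfolding mult.assoc by (rule order_trans[OF _ less_imp_le, rotated])
      qed
      then show "\<exists>r z. 0 < r \<and> r < \<epsilon> \<and> dist z x0 = r \<and> (\<forall>x\<in>ball z (r / 2). \<kappa> * (1 / 2) powr s * r powr (2 * s) \<le> u x)"
        using r tangent(2)[of r] by (intro exI[of _ r] exI[of _ ?z]) auto
    qed
  qed
qed

end
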